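(* Let $\mathcal S$ be the support of a simple pseudoline arrangement with $m$ intersection points, $\chi$ a cut of $\mathcal S$ given by a filter $F$, and $V$ a subset of the vertices of $\mathcal S$. Let $G_\chi(\mathcal S\mid V)$ be the subgraph of $G_\chi(\mathcal S)$ induced by the pseudoline arrangements supported by $\mathcal S$ whose set of contact points contains $V$. Then $G_\chi(\mathcal S\mid V)$ is either empty or an acyclic connected directed graph with a unique source $\Gamma$, characterized (for any sweep $F=F_m\supset\dots\supset F_0=\tau(F)$) by the property that for all $0\le i<m$: (i) if $v_i\in V$ then $\sigma_{i+1}^\Gamma=\sigma_i^\Gamma$; (ii) if $v_i\notin V$ then $\sigma_{i+1}^\Gamma$ is obtained from $\sigma_i^\Gamma$ by sorting its $i^\square$th and $(i^\square+1)$th entries.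
   Context: Möbius strip: $\tau(x,y)=(x+\pi,-y)$ on $\mathbb R^2$, $\mathcal M=\mathbb R^2/\tau$, projection $\pi$. A pseudoline is the image under $\pi$ of the graph of a continuous $f:\mathbb R\to\mathbb R$ with $f(x+\pi)=-f(x)$. Two pseudolines meet in finitely many points, each a crossing or a contact point (touching without crossing). A pseudoline arrangement (with contact points) is a finite set of pseudolines any two of which have exactly one crossing point and possibly contact points; arrangements are simple. Support = union of the pseudolines, a graph with vertices the intersection points; an arrangement is supported by $\mathcal S$ if its support is $\mathcal S$. Flipping a contact point $v$ of two pseudolines with crossing point $w$ yields the unique arrangement with the same support and contact set $(V\setminus\{v\})\cup\{w\}$. $\bar{\mathcal S}=\pi^{-1}(\mathcal S)$ with edges oriented by increasing abscissa, partial order $\preceq$ on its vertices by oriented paths. A filter is a nonempty proper upward-closed set $F$ of vertices of $\bar{\mathcal S}$; it determines a cut $\chi$. Every vertex $v$ of $\mathcal S$ has a unique preimage $\bar v\in F\setminus\tau(F)$; $v\preceq_\chi w$ iff $\bar v\preceq\bar w$. A flip of $v$ (with crossing point $w$) is $\chi$-increasing if $v\prec_\chi w$; $G_\chi(\mathcal S)$ is the directed graph of $\chi$-increasing flips on arrangements supported by $\mathcal S$. A sweep is a chain of filters $F=F_m\supset\dots\supset F_0=\tau(F)$ with $F_{i+1}\setminus F_i=\{\bar v_i\}$, $v_i=\pi(\bar v_i)$; $e_i^1,\dots,e_i^n$ are the edges of $\bar{\mathcal S}$ with exactly one endpoint in $F_i$, top to bottom; $\bar v_i$ is the common endpoint of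 $e_i^{i^\square}$ and $e_i^{i^\square+1}$. For an arrangement $\Lambda=\{\lambda_1,\dots,\lambda_n\}$ supported by $\mathcal S$, $\sigma_i^\Lambda(j)$ is the index of the pseudoline containing $\pi(e_i^j)$, indexed so that $\sigma_0^\Lambda=[n,\dots,1]$. *)

theory Defs
  imports Complex_Main "Graph_Theory.Digraph_Component"
begin

section \<open>The Moebius strip\<close>

definition tau :: "real \<times> real \<Rightarrow> real \<times> real" where
  "tau p = (fst p + pi, - snd p)"

text \<open>As \<open>tau\<close> is bijective, \<open>moebius_rel\<close> is the orbit relation of the group it generates.\<close>

definition moebius_rel :: "real \<times> real \<Rightarrow> real \<times> real \<Rightarrow> bool" where
  "moebius_rel p q \<longleftrightarrow> (\<exists>j k. (tau ^^ j) p = (tau ^^ k) q)"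

quotient_type moebius = "real \<times> real" / moebius_rel
  morphisms rep_moebius mproj
proof (rule equivpI)
  show "reflp moebius_rel"
    by (rule reflpI) (auto simp: moebius_rel_def)
  show "symp moebius_rel"
    by (rule sympI) (metis moebius_rel_def)
  show "transp moebius_rel"
  proof (rule transpI)
    fix p q r assume "moebius_rel p q" "moebius_rel q r"
    then obtain j k l m where
      pq: "(tau ^^ j) p = (tau ^^ k) q" and qr: "(tau ^^ l) q = (tau ^^ m) r"
      unfolding moebius_rel_def by blast
    have "(tau ^^ (l + j)) p = (tau ^^ (l + k)) q"
      using pq by (simp add: funpow_add)
    also have "\<dots> = (tau ^^ (k + m)) r"
      using qr by (simp add: add.commute[of l k] funpow_add)
    finally show "moebius_rel p r"
      unfolding moebius_rel_def by blast
  qed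
qed


section \<open>Pseudoline arrangements with contact points\<close>

definition pseudoline_of :: "(real \<Rightarrow> real) \<Rightarrow> moebius set \<Rightarrow> bool" where
  "pseudoline_of f L \<longleftrightarrow>
     continuous_on UNIV f \<and> (\<forall>x. f (x + pi) = - f x) \<and> L = mproj ` range (\<lambda>x. (x, f x))"

definition pseudoline :: "moebius set \<Rightarrow> bool" where
  "pseudoline L \<longleftrightarrow> (\<exists>f. pseudoline_of f L)"

text \<open>The function representing a pseudoline is unique, and replacing \<open>x\<close> by \<open>x + pi\<close> negates
  both factors below, so the choice of \<open>f\<close>, \<open>g\<close>, \<open>x\<close> is immaterial.\<close>

definition crossing_point :: "moebius set \<Rightarrow> moebius set \<Rightarrow> moebius \<Rightarrow> bool" where
  "crossing_point L M p \<longleftrightarrow>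
     (\<exists>f g x. pseudoline_of f L \<and> pseudoline_of g M \<and> p = mproj (x, f x) \<and> f x = g x \<and>
        (\<exists>\<epsilon>>0. \<forall>s\<in>{x - \<epsilon><..<x}. \<forall>t\<in>{x<..<x + \<epsilon>}. (f s - g s) * (f t - g t) < 0))"

definition contact_point :: "moebius set \<Rightarrow> moebius set \<Rightarrow> moebius \<Rightarrow> bool" where
  "contact_point L M p \<longleftrightarrow> p \<in> L \<inter> M \<and> \<not> crossing_point L M p"

text \<open>The last conjunct is simplicity.\<close>

definition arrangement :: "moebius set set \<Rightarrow> bool" where
  "arrangement \<Lambda> \<longleftrightarrow>
     finite \<Lambda> \<and> (\<forall>L\<in>\<Lambda>. pseudoline L) \<and>
     (\<forall>L\<in>\<Lambda>. \<forall>M\<in>\<Lambda>. L \<noteq> M \<longrightarrow> finite (L \<inter> M) \<and> (\<exists>!p. crossing_point L M p)) \<and>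
     (\<forall>p. card {L \<in> \<Lambda>. p \<in> L} \<le> 2)"

definition intersection_points :: "moebius set set \<Rightarrow> moebius set" where
  "intersection_points \<Lambda> = {p. \<exists>L\<in>\<Lambda>. \<exists>M\<in>\<Lambda>. L \<noteq> M \<and> p \<in> L \<inter> M}"

definition contact_points :: "moebius set set \<Rightarrow> moebius set" where
  "contact_points \<Lambda> = {p. \<exists>L\<in>\<Lambda>. \<exists>M\<in>\<Lambda>. L \<noteq> M \<and> contact_point L M p}"

definition support :: "moebius set set \<Rightarrow> moebius set" where
  "support \<Lambda> = \<Union>\<Lambda>"

definition arrangements_on :: "moebius set \<Rightarrow> moebius set set set" where
  "arrangements_on S = {\<Lambda>. arrangement \<Lambda> \<and> support \<Lambda> = S}"


section \<open>The support as a graph, and its lift to the plane\<close>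

text \<open>All arrangements with support \<open>S\<close> have the same intersection points (the points at which
  \<open>S\<close> branches), so the union below is over equal sets.\<close>

definition vertices :: "moebius set \<Rightarrow> moebius set" where
  "vertices S = (\<Union>\<Lambda>\<in>arrangements_on S. intersection_points \<Lambda>)"

definition lift_support :: "moebius set \<Rightarrow> (real \<times> real) set" where
  "lift_support S = mproj -` S"

definition lift_vertices :: "moebius set \<Rightarrow> (real \<times> real) set" where
  "lift_vertices S = mproj -` vertices S"

text \<open>\<open>e\<close> is an edge of the lifted graph, oriented by increasing abscissa from \<open>u\<close> to \<open>v\<close>; it is
  represented as a closed arc since two vertices may be joined by parallel edges.\<close>

definition edge :: "moebius set \<Rightarrow> (real \<times> real) set \<Rightarrow> real \<times> real \<Rightarrow> real \<times> real \<Rightarrow> bool" where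
  "edge S e u v \<longleftrightarrow>
     fst u < fst v \<and>
     (\<exists>h. continuous_on {fst u..fst v} h \<and> h (fst u) = snd u \<and> h (fst v) = snd v \<and>
        e = (\<lambda>x. (x, h x)) ` {fst u..fst v}) \<and>
     e \<subseteq> lift_support S \<and> e \<inter> lift_vertices S = {u, v}"

definition endpoint :: "moebius set \<Rightarrow> (real \<times> real) set \<Rightarrow> real \<times> real \<Rightarrow> bool" where
  "endpoint S e u \<longleftrightarrow> (\<exists>v. edge S e u v \<or> edge S e v u)"

definition path_le :: "moebius set \<Rightarrow> real \<times> real \<Rightarrow> real \<times> real \<Rightarrow> bool" where
  "path_le S u v \<longleftrightarrow> (u, v) \<in> {(a, b). \<exists>e. edge S e a b}\<^sup>*"

definition cut_filter :: "moebius set \<Rightarrow> (real \<times> real) set \<Rightarrow> bool" where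
  "cut_filter S F \<longleftrightarrow>
     F \<noteq> {} \<and> F \<subset> lift_vertices S \<and>
     (\<forall>u\<in>F. \<forall>v\<in>lift_vertices S. path_le S u v \<longrightarrow> v \<in> F)"

definition filter_lift :: "(real \<times> real) set \<Rightarrow> moebius \<Rightarrow> real \<times> real" where
  "filter_lift F v = (THE u. u \<in> F - tau ` F \<and> mproj u = v)"

definition cut_le :: "moebius set \<Rightarrow> (real \<times> real) set \<Rightarrow> moebius \<Rightarrow> moebius \<Rightarrow> bool" where
  "cut_le S F v w \<longleftrightarrow> path_le S (filter_lift F v) (filter_lift F w)"

definition cut_less :: "moebius set \<Rightarrow> (real \<times> real) set \<Rightarrow> moebius \<Rightarrow> moebius \<Rightarrow> bool" where
  "cut_less S F v w \<longleftrightarrow> cut_le S F v w \<and> v \<noteq> w"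


section \<open>Flips\<close>

definition is_flip ::
    "moebius set set \<Rightarrow> moebius \<Rightarrow> moebius \<Rightarrow> moebius set set \<Rightarrow> bool" where
  "is_flip \<Lambda> v w \<Lambda>' \<longleftrightarrow>
     (\<exists>L\<in>\<Lambda>. \<exists>M\<in>\<Lambda>. L \<noteq> M \<and> contact_point L M v \<and> crossing_point L M w) \<and>
     arrangement \<Lambda>' \<and> support \<Lambda>' = support \<Lambda> \<and>
     contact_points \<Lambda>' = (contact_points \<Lambda> - {v}) \<union> {w}"

definition flip_graph ::
    "moebius set \<Rightarrow> (real \<times> real) set \<Rightarrow> moebius set set pair_pre_digraph" where
  "flip_graph S F =
     \<lparr> pverts = arrangements_on S,
       parcs = {(\<Lambda>, \<Lambda>'). \<Lambda> \<in> arrangements_on S \<and> \<Lambda>' \<in> arrangements_on S \<and>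
                   (\<exists>v w. is_flip \<Lambda> v w \<Lambda>' \<and> cut_less S F v w)} \<rparr>"

definition restricted_flip_graph ::
    "moebius set \<Rightarrow> (real \<times> real) set \<Rightarrow> moebius set \<Rightarrow>
     (moebius set set, moebius set set \<times> moebius set set) pre_digraph" where
  "restricted_flip_graph S F V =
     induce_subgraph (with_proj (flip_graph S F))
       {\<Lambda> \<in> arrangements_on S. V \<subseteq> contact_points \<Lambda>}"

definition source :: "('a, 'b) pre_digraph \<Rightarrow> 'a \<Rightarrow> bool" where
  "source G v \<longleftrightarrow> v \<in> verts G \<and> in_arcs G v = {}"


section \<open>Sweeps\<close>

definition sweep ::
    "moebius set \<Rightarrow> (real \<times> real) set \<Rightarrow> nat \<Rightarrow> (nat \<Rightarrow> (real \<times> real) set) \<Rightarrow> bool" where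
  "sweep S F m Fs \<longleftrightarrow>
     Fs m = F \<and> Fs 0 = tau ` F \<and> (\<forall>i\<le>m. cut_filter S (Fs i)) \<and>
     (\<forall>i<m. Fs i \<subset> Fs (Suc i) \<and> (\<exists>u. Fs (Suc i) - Fs i = {u}))"

definition swept_vertex :: "(nat \<Rightarrow> (real \<times> real) set) \<Rightarrow> nat \<Rightarrow> real \<times> real" where
  "swept_vertex Fs i = the_elem (Fs (Suc i) - Fs i)"

definition cut_edges :: "moebius set \<Rightarrow> (real \<times> real) set \<Rightarrow> (real \<times> real) set set" where
  "cut_edges S F = {e. \<exists>u v. edge S e u v \<and> (u \<in> F) \<noteq> (v \<in> F)}"

text \<open>Edges crossed by a cut may have disjoint ranges of abscissas, so their order from top to
  bottom along the cut is read off their levels: the \<open>j\<close>-th edge runs along the \<open>j\<close>-th strand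
  from the top of the lifted support. At an abscissa carrying a vertex two strands coincide,
  hence the restriction to other abscissas.\<close>

definition at_level :: "moebius set \<Rightarrow> (real \<times> real) set \<Rightarrow> nat \<Rightarrow> bool" where
  "at_level S e j \<longleftrightarrow>
     (\<exists>x y. (x, y) \<in> e \<and> x \<notin> fst ` lift_vertices S \<and>
        card {y'. (x, y') \<in> lift_support S \<and> y \<le> y'} = j)"

definition cut_edge :: "moebius set \<Rightarrow> (real \<times> real) set \<Rightarrow> nat \<Rightarrow> (real \<times> real) set" where
  "cut_edge S F j = (THE e. e \<in> cut_edges S F \<and> at_level S e j)"

definition sweep_position :: "moebius set \<Rightarrow> (nat \<Rightarrow> (real \<times> real) set) \<Rightarrow> nat \<Rightarrow> nat" where
  "sweep_position S Fs i =
     (THE k. k \<in> {1..<card (cut_edges S (Fs i))} \<and>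
        endpoint S (cut_edge S (Fs i) k) (swept_vertex Fs i) \<and>
        endpoint S (cut_edge S (Fs i) (k + 1)) (swept_vertex Fs i))"

definition line_of :: "moebius set set \<Rightarrow> (real \<times> real) set \<Rightarrow> moebius set" where
  "line_of \<Lambda> e = (THE L. L \<in> \<Lambda> \<and> mproj ` e \<subseteq> L)"

text \<open>The indexing by \<open>1, \<dots>, n\<close> for which the cut given by \<open>F0\<close> reads \<open>n, \<dots>, 1\<close> from top to
  bottom.\<close>

definition line_index ::
    "moebius set \<Rightarrow> (real \<times> real) set \<Rightarrow> moebius set set \<Rightarrow> moebius set \<Rightarrow> nat" where
  "line_index S F0 \<Lambda> L =
     (THE k. k \<in> {1..card \<Lambda>} \<and> line_of \<Lambda> (cut_edge S F0 (card \<Lambda> + 1 - k)) = L)"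

definition sigma ::
    "moebius set \<Rightarrow> (nat \<Rightarrow> (real \<times> real) set) \<Rightarrow> moebius set set \<Rightarrow> nat \<Rightarrow> nat list" where
  "sigma S Fs \<Lambda> i =
     map (\<lambda>j. line_index S (Fs 0) \<Lambda> (line_of \<Lambda> (cut_edge S (Fs i) j))) [1..<card \<Lambda> + 1]"

text \<open>Sorts the \<open>k\<close>-th and \<open>(k + 1)\<close>-th entries increasingly, entries being counted from 1.\<close>

definition sort_entries :: "nat \<Rightarrow> nat list \<Rightarrow> nat list" where
  "sort_entries k xs =
     xs[k - 1 := min (xs ! (k - 1)) (xs ! k), k := max (xs ! (k - 1)) (xs ! k)]"

end

theory Submission
  imports Defs
begin

text \<open>A flip moves one contact point strictly up in the order of the cut, so the sum of the
  abscissas of the lifted contact points strictly increases along arcs. Hence the graph is acyclic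
  and, being finite, every vertex is reached from a source. By the exchange construction of flips
  on the level of functions, an arrangement is a source iff every contact point outside \<open>V\<close>
  precedes the crossing point of its two lines.

  Sort the values of the lines at each abscissa into continuous strands. A filter cuts exactly one
  edge of each strand, which yields the list of lines along the cut; sweeping a vertex exchanges
  two adjacent entries if the vertex is a crossing and changes nothing otherwise. As two lines
  cross once, they are in reversed order iff their crossing point has already been swept, so the
  condition on contact points says precisely that the lists are sorted greedily. The greedy rule
  determines the lists, the lists determine the contact points, and the contact points determine
  the arrangement: hence the source is unique.\<close>

subsection \<open>Pseudolines as antiperiodic functions\<close>

text \<open>The graph notions refer to the support alone, whereas lines, crossings and lists refer
  to an arrangement. Two bridges are needed: every edge lies on a single line of each arrangement
  with this support, and two such arrangements with equal contact sets coincide. The second bridge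
  also recognises the result of a constructed flip and makes the flip graph finite.

  Being a source is first translated into a condition that mentions no sweep, which is why one
  arrangement obeys the greedy rule for every sweep.

  The cut edges need not lie over a common abscissa, so the order along a cut cannot be read off one
  vertical line; this is why the lists are organised by strands, whose order never changes.

  Orientation: the filters of a sweep grow leftwards, against the orientation of the edges. Of two
  comparable vertices the larger one is swept first.\<close>

definition shift :: "int \<Rightarrow> real \<times> real \<Rightarrow> real \<times> real" where
  "shift k p = (fst p + of_int k * pi, if even k then snd p else - snd p)"

lemma shift_0 [simp]: "shift 0 p = p"
  by (simp add: shift_def)

lemma shift_shift: "shift j (shift k p) = shift (j + k) p"
  by (auto simp: shift_def algebra_simps)

lemma tau_eq_shift: "tau = shift 1"
  by (auto simp: tau_def shift_def fun_eq_iff)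

lemma funpow_tau: "(tau ^^ k) p = shift (int k) p"
  by (induction k) (simp_all add: tau_eq_shift shift_shift)

text \<open>The relation allows iterates of \<open>tau\<close> on both sides because only
  nonnegative powers are at hand there; as \<open>tau\<close> is invertible, they collapse into one
  integer shift. All lifts of a point thus form one orbit of \<open>shift\<close>.\<close>

lemma mproj_eq_iff: "mproj p = mproj q \<longleftrightarrow> (\<exists>k. q = shift k p)"
proof -
  have "mproj p = mproj q \<longleftrightarrow> (\<exists>j k. shift (int j) p = shift (int k) q)"
    by (simp add: moebius.abs_eq_iff moebius_rel_def funpow_tau)
  also have "\<dots> \<longleftrightarrow> (\<exists>k. q = shift k p)"
  proof
    assume "\<exists>j k. shift (int j) p = shift (int k) q"
    then obtain j k where "shift (int j) p = shift (int k) q" by blast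
    then have "shift (- int k) (shift (int j) p) = q"
      by (simp add: shift_shift)
    then show "\<exists>k. q = shift k p" by (metis shift_shift)
  next
    assume "\<exists>k. q = shift k p"
    then obtain k where k: "q = shift k p" by blast
    \<comment> \<open>At least one of \<open>nat k\<close> and \<open>nat (- k)\<close> is 0: they
      are the positive and the negative part of \<open>k\<close>.\<close>
    have "shift (int (nat k)) p = shift (int (nat (- k))) q"
      unfolding k shift_shift by (cases "k \<ge> 0") auto
    then show "\<exists>j k. shift (int j) p = shift (int k) q" by blast
  qed
  finally show ?thesis .
qed

lemma mproj_shift [simp]: "mproj (shift k p) = mproj p"
  using mproj_eq_iff by metis

lemma mproj_surj: "\<exists>x y. p = mproj (x, y)"
  by (metis moebius.abs_eq_iff surj_pair Quotient3_moebius Quotient3_abs_rep)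

definition antiperiodic :: "(real \<Rightarrow> real) \<Rightarrow> bool" where
  "antiperiodic f \<longleftrightarrow> (\<forall>x. f (x + pi) = - f x)"

lemma antiperiodic_diff: "antiperiodic f \<Longrightarrow> antiperiodic g \<Longrightarrow> antiperiodic (\<lambda>x. f x - g x)"
  by (simp add: antiperiodic_def)

lemma antiperiodic_shift:
  assumes "antiperiodic f"
  shows "f (x + of_int k * pi) = (if even k then f x else - f x)"
proof -
  have step: "f (x + pi) = - f x" for x
    using assms by (simp add: antiperiodic_def)
  show ?thesis
  proof (induction k rule: int_induct[where k = 0])
    case base
    then show ?case by simp
  next
    case (step1 i)
    have "f (x + of_int (i + 1) * pi) = f ((x + of_int i * pi) + pi)"
      by (simp add: algebra_simps)
    then show ?case using step1 step by auto
  next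
    case (step2 i)
    have "f (x + of_int i * pi) = f ((x + of_int (i - 1) * pi) + pi)"
      by (simp add: algebra_simps)
    then have "f (x + of_int (i - 1) * pi) = - f (x + of_int i * pi)" using step by auto
    then show ?case using step2 by auto
  qed
qed

lemma shift_graph:
  "antiperiodic f \<Longrightarrow> shift k (x, f x) = (x + of_int k * pi, f (x + of_int k * pi))"
  by (simp add: shift_def antiperiodic_shift)

lemma pseudoline_of_alt:
  "pseudoline_of f L \<longleftrightarrow> continuous_on UNIV f \<and> antiperiodic f \<and> L = mproj ` range (\<lambda>x. (x, f x))"
  by (simp add: pseudoline_of_def antiperiodic_def)

text \<open>The graph of an antiperiodic function is invariant under all shifts, so it is the whole
  preimage of the pseudoline. Membership thus becomes one equation, and the function can be
  recovered from the pseudoline.\<close>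

lemma mproj_in_pseudoline:
  assumes "pseudoline_of f L"
  shows "mproj (x, y) \<in> L \<longleftrightarrow> y = f x"
proof
  assume "mproj (x, y) \<in> L"
  then obtain t where "mproj (t, f t) = mproj (x, y)"
    using assms by (force simp: pseudoline_of_alt)
  then obtain k where "(x, y) = shift k (t, f t)" by (auto simp: mproj_eq_iff)
  then show "y = f x"
    using assms by (simp add: shift_graph pseudoline_of_alt)
next
  assume "y = f x" then show "mproj (x, y) \<in> L"
    using assms by (auto simp: pseudoline_of_def)
qed

definition fn :: "moebius set \<Rightarrow> real \<Rightarrow> real" where
  "fn L = (THE f. pseudoline_of f L)"

lemma pseudoline_of_unique:
  assumes "pseudoline_of f L" "pseudoline_of g L" shows "f = g"
  using mproj_in_pseudoline[OF assms(1)] mproj_in_pseudoline[OF assms(2)] by blast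

lemma fn_eq: "pseudoline_of f L \<Longrightarrow> fn L = f"
  unfolding fn_def using pseudoline_of_unique by blast

lemma pseudoline_of_fn: "pseudoline L \<Longrightarrow> pseudoline_of (fn L) L"
  unfolding pseudoline_def using fn_eq by metis

lemma mem_pseudoline: "pseudoline L \<Longrightarrow> mproj (x, y) \<in> L \<longleftrightarrow> y = fn L x"
  using mproj_in_pseudoline pseudoline_of_fn by blast

lemma continuous_fn: "pseudoline L \<Longrightarrow> continuous_on UNIV (fn L)"
  using pseudoline_of_fn by (auto simp: pseudoline_of_def)

lemma antiperiodic_fn: "pseudoline L \<Longrightarrow> antiperiodic (fn L)"
  using pseudoline_of_fn by (auto simp: pseudoline_of_alt)

lemma pseudoline_eqI: "pseudoline L \<Longrightarrow> pseudoline M \<Longrightarrow> fn L = fn M \<Longrightarrow> L = M"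
  using pseudoline_of_fn by (metis pseudoline_of_def)

section \<open>Sign changes and crossing points\<close>

definition changes_sign :: "(real \<Rightarrow> real) \<Rightarrow> real \<Rightarrow> bool" where
  "changes_sign d x \<longleftrightarrow>
     (\<exists>\<epsilon>>0. \<forall>s\<in>{x - \<epsilon><..<x}. \<forall>t\<in>{x<..<x + \<epsilon>}. d s * d t < 0)"

lemma changes_sign_shift:
  assumes "antiperiodic d" "changes_sign d x"
  shows "changes_sign d (x + of_int k * pi)"
proof -
  obtain \<epsilon> where \<epsilon>: "\<epsilon> > 0" "\<And>s t. s \<in> {x - \<epsilon><..<x} \<Longrightarrow> t \<in> {x<..<x + \<epsilon>} \<Longrightarrow> d s * d t < 0"
    using assms(2) by (auto simp: changes_sign_def)
  have "d s * d t < 0" if "s \<in> {x + of_int k * pi - \<epsilon><..<x + of_int k * pi}"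
    "t \<in> {x + of_int k * pi<..<x + of_int k * pi + \<epsilon>}" for s t
  proof -
    have "d (s - of_int k * pi) * d (t - of_int k * pi) < 0"
      using that by (intro \<epsilon>(2)) auto
    moreover have "d s = (if even k then d (s - of_int k * pi) else - d (s - of_int k * pi))"
      "d t = (if even k then d (t - of_int k * pi) else - d (t - of_int k * pi))"
      using antiperiodic_shift[OF assms(1), of "s - of_int k * pi" k]
        antiperiodic_shift[OF assms(1), of "t - of_int k * pi" k] by simp_all
    ultimately show ?thesis by auto
  qed
  then show ?thesis unfolding changes_sign_def using \<epsilon>(1) by blast
qed

lemma changes_sign_minus: "changes_sign (\<lambda>x. g x - f x) = changes_sign (\<lambda>x. f x - g x :: real)"
proof -
  have "(g s - f s) * (g t - f t) = (f s - g s) * (f t - g t)" for s t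
    by (simp add: algebra_simps)
  then show ?thesis by (simp add: changes_sign_def fun_eq_iff)
qed

text \<open>The definition lets the witness be any lift and any representing function. The functions
  are unique, and a sign change of the antiperiodic difference is carried to every other lift, so it
  can be tested at the given abscissa.\<close>

lemma crossing_point_iff:
  assumes "pseudoline L" "pseudoline M"
  shows "crossing_point L M (mproj (x, y)) \<longleftrightarrow>
     y = fn L x \<and> y = fn M x \<and> changes_sign (\<lambda>x. fn L x - fn M x) x"
proof
  assume "crossing_point L M (mproj (x, y))"
  then obtain f g t where fg: "pseudoline_of f L" "pseudoline_of g M"
    "mproj (x, y) = mproj (t, f t)" "f t = g t" "changes_sign (\<lambda>x. f x - g x) t"
    unfolding crossing_point_def changes_sign_def by blast
  have eq: "f = fn L" "g = fn M" using fg fn_eq by auto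
  obtain k where k: "(x, y) = shift k (t, f t)" using fg(3) mproj_eq_iff by metis
  have "(x, y) = shift k (t, g t)" using k fg by simp
  with k have "x = t + of_int k * pi" "y = fn L x" "y = fn M x"
    using antiperiodic_fn assms by (simp_all add: shift_graph eq)
  moreover have "changes_sign (\<lambda>x. fn L x - fn M x) (t + of_int k * pi)"
    using fg(5) unfolding eq
    by (intro changes_sign_shift antiperiodic_diff antiperiodic_fn assms)
  ultimately show "y = fn L x \<and> y = fn M x \<and> changes_sign (\<lambda>x. fn L x - fn M x) x" by simp
next
  assume "y = fn L x \<and> y = fn M x \<and> changes_sign (\<lambda>x. fn L x - fn M x) x"
  then show "crossing_point L M (mproj (x, y))"
    unfolding crossing_point_def changes_sign_def
    using assms[THEN pseudoline_of_fn] by metis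
qed

lemma crossing_point_sym:
  "pseudoline L \<Longrightarrow> pseudoline M \<Longrightarrow> crossing_point L M p \<longleftrightarrow> crossing_point M L p"
  using mproj_surj[of p] by (auto simp: crossing_point_iff changes_sign_minus[of "fn M" "fn L"])

lemma crossing_point_mem:
  "pseudoline L \<Longrightarrow> pseudoline M \<Longrightarrow> crossing_point L M p \<Longrightarrow> p \<in> L \<inter> M"
  using mproj_surj[of p] by (auto simp: crossing_point_iff mem_pseudoline)

section \<open>Locally finite sets of abscissas and signs near isolated zeros\<close>

definition locally_finite :: "real set \<Rightarrow> bool" where
  "locally_finite X \<longleftrightarrow> (\<forall>a b. finite (X \<inter> {a..b}))"

lemma locally_finite_subset: "locally_finite X \<Longrightarrow> Y \<subseteq> X \<Longrightarrow> locally_finite Y"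
  unfolding locally_finite_def by (meson Int_mono finite_subset order_refl)

lemma locally_finite_UN:
  "finite I \<Longrightarrow> (\<And>i. i \<in> I \<Longrightarrow> locally_finite (X i)) \<Longrightarrow> locally_finite (\<Union>i\<in>I. X i)"
  unfolding locally_finite_def by (auto simp: Int_UN_distrib2 UN_simps(4)[symmetric] simp del: UN_simps)

lemma locally_finite_right_gap:
  assumes "locally_finite X"
  obtains \<epsilon> where "\<epsilon> > 0" "X \<inter> {x<..<x + \<epsilon>} = {}"
proof -
  define A where "A = X \<inter> {x..x + 1} - {x}"
  have fin: "finite A" using assms by (auto simp: A_def locally_finite_def)
  define \<epsilon> where "\<epsilon> = Min (insert 1 ((\<lambda>t. t - x) ` A))"
  have "\<epsilon> > 0" using fin by (auto simp: \<epsilon>_def A_def)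
  moreover have "X \<inter> {x<..<x + \<epsilon>} = {}"
  proof (rule ccontr)
    assume "X \<inter> {x<..<x + \<epsilon>} \<noteq> {}"
    then obtain t where t: "t \<in> X" "x < t" "t < x + \<epsilon>" by auto
    have "\<epsilon> \<le> 1" using fin by (auto simp: \<epsilon>_def)
    then have "t \<in> A" using t by (auto simp: A_def)
    then have "\<epsilon> \<le> t - x" using fin unfolding \<epsilon>_def by (intro Min_le) auto
    then show False using t by simp
  qed
  ultimately show thesis using that by blast
qed

lemma locally_finite_uminus:
  assumes "locally_finite X" shows "locally_finite (uminus ` X)"
proof -
  have "uminus ` X \<inter> {a..b} = uminus ` (X \<inter> {- b..- a})" for a b :: real
    by (auto simp: image_iff)
  then show ?thesis using assms by (simp add: locally_finite_def)
qed

lemma locally_finite_gap: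
  assumes "locally_finite X"
  obtains \<epsilon> where "\<epsilon> > 0" "X \<inter> {x - \<epsilon><..<x} = {}" "X \<inter> {x<..<x + \<epsilon>} = {}"
proof -
  obtain e1 where e1: "e1 > 0" "X \<inter> {x<..<x + e1} = {}"
    using locally_finite_right_gap assms by blast
  obtain e2 where e2: "e2 > 0" "uminus ` X \<inter> {- x<..<- x + e2} = {}"
    using locally_finite_right_gap locally_finite_uminus[OF assms] by blast
  have "X \<inter> {x - e2<..<x} = {}" using e2(2) by (auto simp: disjoint_iff)
  then have "X \<inter> {x - min e1 e2<..<x} = {}" "X \<inter> {x<..<x + min e1 e2} = {}"
    using e1 by (auto simp: disjoint_iff)
  then show thesis using that[of "min e1 e2"] e1 e2 by simp
qed

lemma locally_finite_avoid:
  assumes "locally_finite X" "a < b" obtains x where "a < x" "x < b" "x \<notin> X"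
proof -
  obtain \<epsilon> where \<epsilon>: "\<epsilon> > 0" "X \<inter> {a<..<a + \<epsilon>} = {}"
    using locally_finite_right_gap assms by blast
  have "a < a + min \<epsilon> (b - a) / 2" "a + min \<epsilon> (b - a) / 2 < b" "a + min \<epsilon> (b - a) / 2 < a + \<epsilon>"
    using \<epsilon>(1) assms(2) by (auto simp: min_def field_simps)
  then show thesis using that \<epsilon>(2) by (metis disjoint_iff greaterThanLessThan_iff)
qed

text \<open>Finiteness is lost in the lift, but the lifts of one point differ by multiples of
  \<open>pi\<close> in their abscissas, so only finitely many lie over a bounded interval.\<close>

lemma finite_inter_imp_locally_finite:
  assumes "pseudoline L" "finite (L \<inter> M)"
  shows "locally_finite {x. mproj (x, fn L x) \<in> M}"
  unfolding locally_finite_def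
proof (intro allI)
  fix a b
  let ?g = "\<lambda>x. mproj (x, fn L x)"
  have "finite (?g -` (L \<inter> M) \<inter> {a..b})"
  proof (rule finite_finite_vimage_IntI[OF assms(2)])
    fix p
    have "finite ({x. ?g x = p} \<inter> {a..b})"
    proof (cases "\<exists>x0. ?g x0 = p")
      case True
      then obtain x0 where x0: "?g x0 = p" by blast
      have "{x. ?g x = p} \<inter> {a..b} \<subseteq>
        (\<lambda>k. x0 + of_int k * pi) ` {\<lfloor>(a - x0) / pi\<rfloor>..\<lceil>(b - x0) / pi\<rceil>}"
      proof
        fix x assume x: "x \<in> {x. ?g x = p} \<inter> {a..b}"
        then have "mproj (x0, fn L x0) = mproj (x, fn L x)" using x0 by simp
        then obtain k where "(x, fn L x) = shift k (x0, fn L x0)"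
          unfolding mproj_eq_iff by blast
        then have k: "x = x0 + of_int k * pi" by (simp add: shift_def)
        have "(a - x0) / pi \<le> of_int k" "of_int k \<le> (b - x0) / pi"
          using x k by (auto simp: field_simps)
        then have "k \<in> {\<lfloor>(a - x0) / pi\<rfloor>..\<lceil>(b - x0) / pi\<rceil>}"
          by (simp add: floor_le_iff le_ceiling_iff)
        then show "x \<in> (\<lambda>k. x0 + of_int k * pi) ` {\<lfloor>(a - x0) / pi\<rfloor>..\<lceil>(b - x0) / pi\<rceil>}"
          using k by blast
      qed
      then show ?thesis by (rule finite_subset) simp
    qed auto
    then show "finite (?g -` {p} \<inter> {a..b})" by (simp add: vimage_def)
  qed
  moreover have "?g -` (L \<inter> M) = {x. ?g x \<in> M}"
    using mem_pseudoline[OF assms(1)] by auto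
  ultimately show "finite ({x. ?g x \<in> M} \<inter> {a..b})" by simp
qed

lemma same_sign_on_interval:
  fixes d :: "real \<Rightarrow> real"
  assumes "continuous_on UNIV d" "\<And>x. x \<in> {s..t} \<Longrightarrow> d x \<noteq> 0" "s \<le> t"
  shows "d s * d t > 0"
proof (rule ccontr)
  assume "\<not> d s * d t > 0"
  moreover have "d s \<noteq> 0" "d t \<noteq> 0" using assms by auto
  ultimately consider "d s \<le> 0 \<and> 0 \<le> d t" | "d t \<le> 0 \<and> 0 \<le> d s"
    by (metis linear mult_neg_neg mult_pos_pos not_le)
  then show False
  proof cases
    case 1
    then obtain x where "s \<le> x" "x \<le> t" "d x = 0"
      using IVT'[of d s 0 t] assms continuous_on_subset by blast
    then show False using assms(2) by auto
  next
    case 2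
    then obtain x where "s \<le> x" "x \<le> t" "d x = 0"
      using IVT2'[of d t 0 s] assms continuous_on_subset by blast
    then show False using assms(2) by auto
  qed
qed

lemma sign_near_zero:
  fixes d :: "real \<Rightarrow> real"
  assumes "continuous_on UNIV d" "locally_finite {x. d x = 0}"
  obtains \<epsilon> where "\<epsilon> > 0"
    "\<And>s t. s \<in> {x - \<epsilon><..<x} \<Longrightarrow> t \<in> {x - \<epsilon><..<x} \<Longrightarrow> d s * d t > 0"
    "\<And>s t. s \<in> {x<..<x + \<epsilon>} \<Longrightarrow> t \<in> {x<..<x + \<epsilon>} \<Longrightarrow> d s * d t > 0"
proof -
  obtain \<epsilon> where \<epsilon>: "\<epsilon> > 0" "{x. d x = 0} \<inter> {x - \<epsilon><..<x} = {}" "{x. d x = 0} \<inter> {x<..<x + \<epsilon>} = {}"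
    using locally_finite_gap assms(2) by blast
  have pos: "d s * d t > 0" if "{x. d x = 0} \<inter> {a<..<b} = {}" "s \<in> {a<..<b}" "t \<in> {a<..<b}" for s t a b
  proof (cases "s \<le> t")
    case True
    then show ?thesis
      using that by (intro same_sign_on_interval[OF assms(1)]) (auto simp: disjoint_iff)
  next
    case False
    then have "d t * d s > 0"
      using that by (intro same_sign_on_interval[OF assms(1)]) (auto simp: disjoint_iff)
    then show ?thesis by (simp add: mult.commute)
  qed
  show thesis using that[OF \<epsilon>(1) pos[OF \<epsilon>(2)] pos[OF \<epsilon>(3)]] by blast
qed

text \<open>Negating \<open>changes_sign\<close> yields only one suitable pair in each
  neighbourhood. As the zeros are isolated, the sign is constant on either side of \<open>x\<close>,
  and one pair decides for all. This is the touching behaviour at a contact.\<close>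

lemma not_changes_sign:
  fixes d :: "real \<Rightarrow> real"
  assumes "continuous_on UNIV d" "locally_finite {x. d x = 0}" "\<not> changes_sign d x"
  obtains \<epsilon> where "\<epsilon> > 0" "\<And>s t. s \<in> {x - \<epsilon><..<x} \<Longrightarrow> t \<in> {x<..<x + \<epsilon>} \<Longrightarrow> d s * d t > 0"
proof -
  obtain \<epsilon> where \<epsilon>: "\<epsilon> > 0"
    "\<And>s t. s \<in> {x - \<epsilon><..<x} \<Longrightarrow> t \<in> {x - \<epsilon><..<x} \<Longrightarrow> d s * d t > 0"
    "\<And>s t. s \<in> {x<..<x + \<epsilon>} \<Longrightarrow> t \<in> {x<..<x + \<epsilon>} \<Longrightarrow> d s * d t > 0"
    using sign_near_zero assms by blast
  obtain s t where st: "s \<in> {x - \<epsilon><..<x}" "t \<in> {x<..<x + \<epsilon>}" "\<not> d s * d t < 0"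
    using assms(3) \<epsilon>(1) unfolding changes_sign_def by blast
  have "d s' * d t' > 0" if "s' \<in> {x - \<epsilon><..<x}" "t' \<in> {x<..<x + \<epsilon>}" for s' t'
    using \<epsilon>(2)[OF st(1) that(1)] \<epsilon>(3)[OF st(2) that(2)] st(3)
    by (smt (verit) zero_less_mult_iff mult_less_0_iff)
  then show thesis using that \<epsilon>(1) by blast
qed

text \<open>Antiperiodicity gives opposite signs at distance \<open>pi\<close>. The zero chosen is
  the infimum of the later points with a negative value: no negative value before it, negative
  values arbitrarily close after it.\<close>

lemma antiperiodic_changes_sign:
  assumes cont: "continuous_on UNIV d" and lf: "locally_finite {x. d x = 0}" and ap: "antiperiodic d"
  obtains x where "d x = 0" "changes_sign d x"
proof -
  obtain a0 where a0: "d a0 \<noteq> 0" using locally_finite_avoid[OF lf, of 0 1] by auto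
  obtain a where a: "d a > 0"
  proof (cases "d a0 > 0")
    case False
    then have "d (a0 + pi) > 0" using a0 ap by (simp add: antiperiodic_def)
    then show ?thesis using that by blast
  qed (use that in blast)
  define T where "T = {t. a \<le> t \<and> d t < 0}"
  have ne: "a + pi \<in> T" using a ap by (simp add: T_def antiperiodic_def)
  have bdd: "bdd_below T" unfolding T_def by (rule bdd_belowI[of _ a]) auto
  define x where "x = Inf T"
  have ax: "a \<le> x" unfolding x_def using ne T_def by (intro cInf_greatest) auto
  have left: "d t \<ge> 0" if "a \<le> t" "t < x" for t
    using cInf_lower[OF _ bdd, of t] that unfolding x_def T_def by force
  have right: "\<exists>t\<in>{x..<x + \<epsilon>}. d t < 0" if "\<epsilon> > 0" for \<epsilon>
  proof -
    have "Inf T < x + \<epsilon>" using that by (simp add: x_def)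
    then obtain t where "t \<in> T" "t < x + \<epsilon>" using cInf_lessD ne by blast
    moreover have "x \<le> t" using cInf_lower[OF \<open>t \<in> T\<close> bdd] by (simp add: x_def)
    ultimately show ?thesis by (auto simp: T_def)
  qed
  have isC: "isCont d x" using cont by (simp add: continuous_on_eq_continuous_at)
  have "\<not> d x > 0"
  proof
    assume "d x > 0"
    then have "eventually (\<lambda>t. d t > 0) (at x)"
      using isC by (simp add: isCont_def order_tendstoD)
    then obtain \<epsilon> where \<epsilon>: "\<epsilon> > 0" "\<And>t. t \<noteq> x \<Longrightarrow> dist t x < \<epsilon> \<Longrightarrow> d t > 0"
      by (auto simp: eventually_at)
    obtain t where "x \<le> t" "t < x + \<epsilon>" "d t < 0" using right[OF \<epsilon>(1)] by auto
    then show False using \<epsilon>(2)[of t] \<open>d x > 0\<close> by (cases "t = x") (auto simp: dist_real_def)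
  qed
  moreover have "\<not> d x < 0"
  proof
    assume n: "d x < 0"
    then have "a < x" using ax a by (cases "a = x") auto
    have "eventually (\<lambda>t. d t < 0) (at x)"
      using isC n by (simp add: isCont_def order_tendstoD)
    then obtain \<epsilon> where \<epsilon>: "\<epsilon> > 0" "\<And>t. t \<noteq> x \<Longrightarrow> dist t x < \<epsilon> \<Longrightarrow> d t < 0"
      by (auto simp: eventually_at)
    define t where "t = max a (x - \<epsilon> / 2)"
    have "d t < 0" "a \<le> t" "t < x" using \<epsilon> \<open>a < x\<close> by (auto simp: t_def dist_real_def max_def)
    then show False using left by force
  qed
  ultimately have x0: "d x = 0" by simp
  then have "a < x" using a ax by (cases "a = x") auto
  obtain \<epsilon> where \<epsilon>: "\<epsilon> > 0"
    "\<And>s t. s \<in> {x - \<epsilon><..<x} \<Longrightarrow> t \<in> {x - \<epsilon><..<x} \<Longrightarrow> d s * d t > 0"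
    "\<And>s t. s \<in> {x<..<x + \<epsilon>} \<Longrightarrow> t \<in> {x<..<x + \<epsilon>} \<Longrightarrow> d s * d t > 0"
    using sign_near_zero[OF cont lf] by blast
  define \<delta> where "\<delta> = min \<epsilon> (x - a)"
  have \<delta>: "\<delta> > 0" using \<epsilon> \<open>a < x\<close> by (simp add: \<delta>_def)
  obtain u where u: "u \<in> {x..<x + \<delta>}" "d u < 0" using right \<delta> by blast
  have "d s * d t < 0" if "s \<in> {x - \<delta><..<x}" "t \<in> {x<..<x + \<delta>}" for s t
  proof -
    have "d s \<ge> 0" using that by (intro left) (auto simp: \<delta>_def)
    \<comment> \<open>\<open>left\<close> is only a weak inequality; using \<open>s\<close> twice in
      the local constancy of the sign rules out \<open>d s = 0\<close>.\<close>
    moreover have "d s * d s > 0" using that by (intro \<epsilon>(2)) (auto simp: \<delta>_def)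
    moreover have "u \<in> {x<..<x + \<delta>}" using u x0 by (cases "u = x") auto
    then have "d u * d t > 0" using that by (intro \<epsilon>(3)) (auto simp: \<delta>_def)
    then have "d t < 0" using u(2) by (simp add: zero_less_mult_iff)
    ultimately show ?thesis by (auto simp: mult_less_0_iff zero_less_mult_iff)
  qed
  then have "changes_sign d x" unfolding changes_sign_def using \<delta> by blast
  then show thesis using that x0 by blast
qed

subsection \<open>Arrangements with a common support\<close>

definition crossings :: "moebius set set \<Rightarrow> moebius set" where
  "crossings \<Lambda> = {p. \<exists>L\<in>\<Lambda>. \<exists>M\<in>\<Lambda>. L \<noteq> M \<and> crossing_point L M p}"

locale arr =
  fixes \<Lambda> :: "moebius set set"
  assumes arrangement: "arrangement \<Lambda>"
begin

lemma finite_lines: "finite \<Lambda>"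
  using arrangement by (simp add: arrangement_def)

lemma pseudoline: "L \<in> \<Lambda> \<Longrightarrow> pseudoline L"
  using arrangement by (simp add: arrangement_def)

lemma finite_inter: "L \<in> \<Lambda> \<Longrightarrow> M \<in> \<Lambda> \<Longrightarrow> L \<noteq> M \<Longrightarrow> finite (L \<inter> M)"
  using arrangement by (simp add: arrangement_def)

lemma ex1_crossing: "L \<in> \<Lambda> \<Longrightarrow> M \<in> \<Lambda> \<Longrightarrow> L \<noteq> M \<Longrightarrow> \<exists>!p. crossing_point L M p"
  using arrangement by (simp add: arrangement_def)

lemma mem_line: "L \<in> \<Lambda> \<Longrightarrow> mproj (x, y) \<in> L \<longleftrightarrow> y = fn L x"
  using mem_pseudoline pseudoline by blast

lemma continuous: "L \<in> \<Lambda> \<Longrightarrow> continuous_on A (fn L)"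
  using continuous_fn pseudoline continuous_on_subset by blast

lemma antiperiodic: "L \<in> \<Lambda> \<Longrightarrow> antiperiodic (fn L)"
  using antiperiodic_fn pseudoline by blast

lemma at_most_two:
  assumes "L \<in> \<Lambda>" "M \<in> \<Lambda>" "K \<in> \<Lambda>" "L \<noteq> M" "p \<in> L" "p \<in> M" "p \<in> K"
  shows "K = L \<or> K = M"
proof (rule ccontr)
  assume "\<not> (K = L \<or> K = M)"
  then have "L \<noteq> K" "M \<noteq> K" by auto
  then have "card {L, M, K} = 3" using assms(4) by simp
  moreover have "card {L, M, K} \<le> card {L \<in> \<Lambda>. p \<in> L}"
    using assms finite_lines by (intro card_mono) auto
  moreover have "card {L \<in> \<Lambda>. p \<in> L} \<le> 2"
    using arrangement by (simp add: arrangement_def)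
  ultimately show False by simp
qed

lemma at_most_two_fn:
  assumes "L \<in> \<Lambda>" "M \<in> \<Lambda>" "K \<in> \<Lambda>" "L \<noteq> M" "fn L x = fn M x" "fn K x = fn L x"
  shows "K = L \<or> K = M"
  using at_most_two[of L M K "mproj (x, fn L x)"] assms by (auto simp: mem_line)

lemma locally_finite_meet:
  assumes "L \<in> \<Lambda>" "M \<in> \<Lambda>" "L \<noteq> M"
  shows "locally_finite {x. fn L x = fn M x}"
  using finite_inter_imp_locally_finite[OF pseudoline finite_inter] assms mem_line by simp

lemma locally_finite_meet':
  assumes "L \<in> \<Lambda>" "M \<in> \<Lambda>" "L \<noteq> M"
  shows "locally_finite {x. fn L x - fn M x = 0}"
  using locally_finite_meet[OF assms] by simp

lemma mproj_in_intersection_points: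
  "mproj (x, y) \<in> intersection_points \<Lambda> \<longleftrightarrow>
     (\<exists>L\<in>\<Lambda>. \<exists>M\<in>\<Lambda>. L \<noteq> M \<and> y = fn L x \<and> y = fn M x)"
  by (auto simp: intersection_points_def mem_line)

lemma in_lift_support: "(x, y) \<in> lift_support (support \<Lambda>) \<longleftrightarrow> (\<exists>L\<in>\<Lambda>. y = fn L x)"
  by (auto simp: lift_support_def support_def mem_line)

lemma finite_intersection_points: "finite (intersection_points \<Lambda>)"
proof -
  have "intersection_points \<Lambda> = (\<Union>L\<in>\<Lambda>. \<Union>M\<in>\<Lambda> - {L}. L \<inter> M)"
    by (auto simp: intersection_points_def)
  moreover have "finite (\<Union>L\<in>\<Lambda>. \<Union>M\<in>\<Lambda> - {L}. L \<inter> M)"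
    using finite_lines finite_inter by (intro finite_UN_I) auto
  ultimately show ?thesis by simp
qed

lemma crossings_subset: "crossings \<Lambda> \<subseteq> intersection_points \<Lambda>"
  using crossing_point_mem pseudoline
  unfolding crossings_def intersection_points_def by blast

lemma crossing_iff:
  "L \<in> \<Lambda> \<Longrightarrow> M \<in> \<Lambda> \<Longrightarrow> crossing_point L M (mproj (x, y)) \<longleftrightarrow>
     y = fn L x \<and> y = fn M x \<and> changes_sign (\<lambda>x. fn L x - fn M x) x"
  using crossing_point_iff pseudoline by blast

lemma crossing_sym: "L \<in> \<Lambda> \<Longrightarrow> M \<in> \<Lambda> \<Longrightarrow> crossing_point L M p \<longleftrightarrow> crossing_point M L p"
  using crossing_point_sym pseudoline by blast

lemma crossing_mem: "L \<in> \<Lambda> \<Longrightarrow> M \<in> \<Lambda> \<Longrightarrow> crossing_point L M p \<Longrightarrow> p \<in> L \<and> p \<in> M"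
  using crossing_point_mem pseudoline by blast

lemma same_pair:
  assumes "L \<in> \<Lambda>" "M \<in> \<Lambda>" "L \<noteq> M" "L' \<in> \<Lambda>" "M' \<in> \<Lambda>" "L' \<noteq> M'"
    "p \<in> L" "p \<in> M" "p \<in> L'" "p \<in> M'"
  shows "L' = L \<and> M' = M \<or> L' = M \<and> M' = L"
  using at_most_two[of L M L' p] at_most_two[of L M M' p] assms by blast

text \<open>Simplicity makes the pair of lines through a vertex unique, so being a crossing is a
  property of the point and not of the chosen pair.\<close>

lemma in_crossings_iff:
  assumes "L \<in> \<Lambda>" "M \<in> \<Lambda>" "L \<noteq> M" "p \<in> L" "p \<in> M"
  shows "p \<in> crossings \<Lambda> \<longleftrightarrow> crossing_point L M p"
proof
  assume "p \<in> crossings \<Lambda>"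
  then obtain L' M' where "L' \<in> \<Lambda>" "M' \<in> \<Lambda>" "L' \<noteq> M'" "crossing_point L' M' p"
    by (auto simp: crossings_def)
  then show "crossing_point L M p"
    using same_pair[of L M L' M' p] assms crossing_mem crossing_sym by metis
qed (use assms in \<open>auto simp: crossings_def\<close>)

lemma in_contact_points_iff:
  assumes "L \<in> \<Lambda>" "M \<in> \<Lambda>" "L \<noteq> M" "p \<in> L" "p \<in> M"
  shows "p \<in> contact_points \<Lambda> \<longleftrightarrow> \<not> crossing_point L M p"
proof
  assume "p \<in> contact_points \<Lambda>"
  then obtain L' M' where "L' \<in> \<Lambda>" "M' \<in> \<Lambda>" "L' \<noteq> M'" "contact_point L' M' p"
    by (auto simp: contact_points_def)
  then show "\<not> crossing_point L M p"
    using same_pair[of L M L' M' p] assms crossing_sym unfolding contact_point_def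
    by (metis IntD1 IntD2)
qed (use assms in \<open>auto simp: contact_points_def contact_point_def\<close>)

lemma contact_points_eq: "contact_points \<Lambda> = intersection_points \<Lambda> - crossings \<Lambda>"
proof (intro equalityI subsetI)
  fix p assume "p \<in> contact_points \<Lambda>"
  then obtain L M where LM: "L \<in> \<Lambda>" "M \<in> \<Lambda>" "L \<noteq> M" "p \<in> L" "p \<in> M" "\<not> crossing_point L M p"
    by (auto simp: contact_points_def contact_point_def)
  then show "p \<in> intersection_points \<Lambda> - crossings \<Lambda>"
    using in_crossings_iff unfolding intersection_points_def by blast
next
  fix p assume p: "p \<in> intersection_points \<Lambda> - crossings \<Lambda>"
  then obtain L M where LM: "L \<in> \<Lambda>" "M \<in> \<Lambda>" "L \<noteq> M" "p \<in> L" "p \<in> M"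
    by (auto simp: intersection_points_def)
  then show "p \<in> contact_points \<Lambda>"
    using p in_crossings_iff in_contact_points_iff by blast
qed

lemma crossings_eq: "crossings \<Lambda> = intersection_points \<Lambda> - contact_points \<Lambda>"
  using contact_points_eq crossings_subset by auto

end

section \<open>Comparison of two arrangements with the same support\<close>

lemma eventually_covered_locally:
  assumes "arr \<Lambda>" "arr \<Lambda>'" "support \<Lambda> = support \<Lambda>'"
  shows "eventually (\<lambda>t. \<forall>L\<in>\<Lambda>. fn L x = y \<longrightarrow> (\<exists>L'\<in>\<Lambda>'. fn L' x = y \<and> fn L' t = fn L t)) (nhds x)"
proof -
  interpret A: arr \<Lambda> by fact
  interpret B: arr \<Lambda>' by fact
  \<comment> \<open>By continuity a line of \<open>\<Lambda>'\<close> that misses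
    \<open>(x, y)\<close> stays, near \<open>x\<close>, off the lines of \<open>\<Lambda>\<close>
    through that point; finiteness gives one neighbourhood for all pairs.\<close>
  have "eventually (\<lambda>t. fn L x = y \<longrightarrow> fn L' x \<noteq> y \<longrightarrow> fn L' t \<noteq> fn L t) (nhds x)"
    if "L \<in> \<Lambda>" "L' \<in> \<Lambda>'" for L L'
  proof (cases "fn L x = y \<and> fn L' x \<noteq> y")
    case True
    have "open {t. fn L' t \<noteq> fn L t}"
      using A.continuous[OF that(1)] B.continuous[OF that(2)] by (intro open_Collect_neq)
    then have "eventually (\<lambda>t. t \<in> {t. fn L' t \<noteq> fn L t}) (nhds x)"
      using True by (intro eventually_nhds_in_open) auto
    then show ?thesis by (rule eventually_mono) auto
  qed auto
  then have "eventually (\<lambda>t. \<forall>L\<in>\<Lambda>. \<forall>L'\<in>\<Lambda>'. fn L x = y \<longrightarrow> fn L' x \<noteq> y \<longrightarrow> fn L' t \<noteq> fn L t) (nhds x)"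
    using A.finite_lines B.finite_lines by (intro eventually_ball_finite ballI) auto
  then show ?thesis
  proof (rule eventually_mono, intro ballI impI)
    fix t L
    assume t: "\<forall>L\<in>\<Lambda>. \<forall>L'\<in>\<Lambda>'. fn L x = y \<longrightarrow> fn L' x \<noteq> y \<longrightarrow> fn L' t \<noteq> fn L t"
      and L: "L \<in> \<Lambda>" "fn L x = y"
    have "(t, fn L t) \<in> lift_support (support \<Lambda>')"
      using A.in_lift_support L assms(3) by metis
    then obtain L' where "L' \<in> \<Lambda>'" "fn L t = fn L' t" using B.in_lift_support by blast
    then show "\<exists>L'\<in>\<Lambda>'. fn L' x = y \<and> fn L' t = fn L t" using t L by metis
  qed
qed

text \<open>A vertex is a branching of the support. Two lines of \<open>\<Lambda>\<close> through it
  separate arbitrarily close by, and the two branches must be covered by two lines of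
  \<open>\<Lambda>'\<close> through the same point.\<close>

lemma intersection_points_subset:
  assumes "arr \<Lambda>" "arr \<Lambda>'" "support \<Lambda> = support \<Lambda>'"
  shows "intersection_points \<Lambda> \<subseteq> intersection_points \<Lambda>'"
proof
  interpret A: arr \<Lambda> by fact
  interpret B: arr \<Lambda>' by fact
  fix p assume p: "p \<in> intersection_points \<Lambda>"
  obtain x y where xy: "p = mproj (x, y)" using mproj_surj by blast
  obtain L M where LM: "L \<in> \<Lambda>" "M \<in> \<Lambda>" "L \<noteq> M" "y = fn L x" "y = fn M x"
    using p unfolding xy A.mproj_in_intersection_points by blast
  obtain \<delta> where \<delta>: "\<delta> > 0" "\<And>t. dist t x < \<delta> \<Longrightarrow>
      \<forall>L\<in>\<Lambda>. fn L x = y \<longrightarrow> (\<exists>L'\<in>\<Lambda>'. fn L' x = y \<and> fn L' t = fn L t)"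
    using eventually_covered_locally[OF assms, of x y] unfolding eventually_nhds_metric by blast
  obtain t where t: "x < t" "t < x + \<delta>" "fn L t \<noteq> fn M t"
    using locally_finite_avoid[OF A.locally_finite_meet[OF LM(1-3)], of x "x + \<delta>"] \<delta>(1) by auto
  then have "dist t x < \<delta>" by (simp add: dist_real_def)
  then obtain L' M' where "L' \<in> \<Lambda>'" "fn L' x = y" "fn L' t = fn L t"
    "M' \<in> \<Lambda>'" "fn M' x = y" "fn M' t = fn M t"
    using \<delta>(2)[of t] LM by metis
  then show "p \<in> intersection_points \<Lambda>'"
    unfolding xy B.mproj_in_intersection_points using t(3) by metis
qed

lemma intersection_points_eq:
  assumes "arr \<Lambda>" "arr \<Lambda>'" "support \<Lambda> = support \<Lambda>'"
  shows "intersection_points \<Lambda> = intersection_points \<Lambda>'"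
  using intersection_points_subset assms by (metis subset_antisym)

lemma (in arr) vertices_eq: "vertices (support \<Lambda>) = intersection_points \<Lambda>"
proof -
  have "intersection_points \<Lambda>' = intersection_points \<Lambda>"
    if "\<Lambda>' \<in> arrangements_on (support \<Lambda>)" for \<Lambda>'
    using that intersection_points_eq[of \<Lambda>' \<Lambda>] arr_axioms
    by (auto simp: arrangements_on_def arr_def)
  moreover have "\<Lambda> \<in> arrangements_on (support \<Lambda>)"
    using arrangement by (simp add: arrangements_on_def)
  ultimately show ?thesis unfolding vertices_def by blast
qed

text \<open>Start a line of \<open>\<Lambda>\<close> and a line of \<open>\<Lambda>'\<close>
  together and follow them to the right. They could part only at a vertex, but there crossing or
  touching dictates the branch on which a line continues, and the two arrangements agree on the type
  of every vertex.\<close>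

lemma lines_subset_if_same_contacts:
  assumes "arr \<Lambda>" "arr \<Lambda>'" "support \<Lambda> = support \<Lambda>'" "contact_points \<Lambda> = contact_points \<Lambda>'"
  shows "\<Lambda> \<subseteq> \<Lambda>'"
proof
  interpret A: arr \<Lambda> by fact
  interpret B: arr \<Lambda>' by fact
  have cr: "crossings \<Lambda> = crossings \<Lambda>'"
    using A.crossings_eq B.crossings_eq assms(4) intersection_points_eq[OF assms(1-3)] by simp
  fix L assume L: "L \<in> \<Lambda>"
  \<comment> \<open>The start avoids all other lines of \<open>\<Lambda>\<close>, so a vertex at
    which the two could part lies strictly to its right.\<close>
  have "locally_finite (\<Union>M\<in>\<Lambda> - {L}. {x. fn L x = fn M x})"
    using A.finite_lines A.locally_finite_meet L by (intro locally_finite_UN) auto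
  then obtain x0 where x0: "x0 \<notin> (\<Union>M\<in>\<Lambda> - {L}. {x. fn L x = fn M x})"
    using locally_finite_avoid[of _ 0 1] zero_less_one by metis
  have "(x0, fn L x0) \<in> lift_support (support \<Lambda>')"
    using A.in_lift_support L assms(3) by metis
  then obtain L' where L': "L' \<in> \<Lambda>'" "fn L x0 = fn L' x0" using B.in_lift_support by blast
  have agree: "fn L t = fn L' t" if "x0 \<le> t" for t
  proof (rule ccontr)
    assume contra: "fn L t \<noteq> fn L' t"
    define T where "T = {t. x0 \<le> t \<and> fn L t \<noteq> fn L' t}"
    have ne: "T \<noteq> {}" using contra that by (auto simp: T_def)
    have bdd: "bdd_below T" unfolding T_def by (rule bdd_belowI[of _ x0]) auto
    define z where "z = Inf T"
    have x0z: "x0 \<le> z" unfolding z_def using ne T_def by (intro cInf_greatest) auto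
    have left: "fn L t = fn L' t" if "x0 \<le> t" "t < z" for t
      using cInf_lower[OF _ bdd, of t] that unfolding z_def T_def by force
    have right: "\<exists>t. z \<le> t \<and> t < z + \<epsilon> \<and> fn L t \<noteq> fn L' t" if "\<epsilon> > 0" for \<epsilon>
    proof -
      have "Inf T < z + \<epsilon>" using that by (simp add: z_def)
      then obtain t where "t \<in> T" "t < z + \<epsilon>" using cInf_lessD ne by blast
      moreover have "z \<le> t" using cInf_lower[OF \<open>t \<in> T\<close> bdd] by (simp add: z_def)
      ultimately show ?thesis by (auto simp: T_def)
    qed
    define y where "y = fn L z"
    have y': "fn L' z = y"
    proof (rule ccontr)
      assume "fn L' z \<noteq> y"
      then have neq: "fn L z \<noteq> fn L' z" by (simp add: y_def)
      then have "x0 < z" using x0z L'(2) by (cases "x0 = z") auto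
      have "open {t. fn L t \<noteq> fn L' t}"
        using A.continuous[OF L] B.continuous[OF L'(1)] by (intro open_Collect_neq)
      then obtain \<epsilon> where \<epsilon>: "\<epsilon> > 0" "\<And>t. dist t z < \<epsilon> \<Longrightarrow> fn L t \<noteq> fn L' t"
        using neq unfolding open_dist by blast
      define t where "t = max x0 (z - \<epsilon> / 2)"
      have "fn L t \<noteq> fn L' t" "x0 \<le> t" "t < z"
        using \<epsilon> \<open>x0 < z\<close> by (auto simp: t_def dist_real_def max_def)
      then show False using left by force
    qed
    have zL: "mproj (z, y) \<in> L" "mproj (z, y) \<in> L'"
      using L L' y' by (auto simp: A.mem_line B.mem_line y_def)
    obtain \<delta>1 where \<delta>1: "\<delta>1 > 0" "\<And>t. dist t z < \<delta>1 \<Longrightarrow>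
      \<forall>L\<in>\<Lambda>. fn L z = y \<longrightarrow> (\<exists>L'\<in>\<Lambda>'. fn L' z = y \<and> fn L' t = fn L t)"
      using eventually_covered_locally[OF assms(1-3), of z y] unfolding eventually_nhds_metric by blast
    obtain \<delta>2 where \<delta>2: "\<delta>2 > 0" "\<And>t. dist t z < \<delta>2 \<Longrightarrow>
      \<forall>L\<in>\<Lambda>'. fn L z = y \<longrightarrow> (\<exists>L'\<in>\<Lambda>. fn L' z = y \<and> fn L' t = fn L t)"
      using eventually_covered_locally[OF assms(2,1) assms(3)[symmetric], of z y]
      unfolding eventually_nhds_metric by blast
    show False
    proof (cases "mproj (z, y) \<in> intersection_points \<Lambda>")
      case False
      then have *: "mproj (z, y) \<notin> intersection_points \<Lambda>'"
        using intersection_points_eq[OF assms(1-3)] by simp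
      have "fn L' t = fn L t" if d: "dist t z < \<delta>1" for t
      proof -
        obtain K where "K \<in> \<Lambda>'" "fn K z = y" "fn K t = fn L t"
          using \<delta>1(2)[OF d] L y_def by blast
        moreover have "K = L'" using * B.mproj_in_intersection_points calculation L' y' by metis
        ultimately show ?thesis by simp
      qed
      then show False using right[OF \<delta>1(1)] by (force simp: dist_real_def)
    next
      case True
      then obtain M where M: "M \<in> \<Lambda>" "M \<noteq> L" "fn M z = y"
        using A.mproj_in_intersection_points by metis
      have "mproj (z, y) \<in> intersection_points \<Lambda>'"
        using True intersection_points_eq[OF assms(1-3)] by simp
      then obtain M' where M': "M' \<in> \<Lambda>'" "M' \<noteq> L'" "fn M' z = y"
        using B.mproj_in_intersection_points by metis
      have zM: "mproj (z, y) \<in> M" "mproj (z, y) \<in> M'"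
        using M M' by (auto simp: A.mem_line B.mem_line)
      have two: "K = L \<or> K = M" if "K \<in> \<Lambda>" "fn K z = y" for K
        using A.at_most_two_fn[of L M K z] L M that y_def by auto
      have two': "K = L' \<or> K = M'" if "K \<in> \<Lambda>'" "fn K z = y" for K
        using B.at_most_two_fn[of L' M' K z] L' M' that y' by auto
      have fwd: "fn L t = fn L' t \<or> fn L t = fn M' t" "fn M t = fn L' t \<or> fn M t = fn M' t"
        if "dist t z < \<delta>1" for t
        using \<delta>1(2)[OF that] L M two' y_def by metis+
      have bwd: "fn L' t = fn L t \<or> fn L' t = fn M t"
        if "dist t z < \<delta>2" for t
        using \<delta>2(2)[OF that] L' M' two y' by metis
      have "x0 < z"
      proof (rule ccontr)
        assume "\<not> x0 < z"
        then have "fn M x0 = fn L x0" using x0z M(3) by (simp add: y_def)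
        then have "M \<notin> \<Lambda> - {L}" using x0 by (metis (mono_tags) UN_iff mem_Collect_eq)
        then show False using M by blast
      qed
      define d where "d = (\<lambda>x. fn L x - fn M x)"
      define d' where "d' = (\<lambda>x. fn L' x - fn M' x)"
      have "crossing_point L M (mproj (z, y)) \<longleftrightarrow> crossing_point L' M' (mproj (z, y))"
        using cr A.in_crossings_iff[of L M] B.in_crossings_iff[of L' M'] L M L' M' zL zM by metis
      then have same: "changes_sign d z \<longleftrightarrow> changes_sign d' z"
        using A.crossing_iff[of L M z y] B.crossing_iff[of L' M' z y] L M L' M' y'
        by (auto simp: d_def d'_def y_def)
      have props: "continuous_on UNIV d" "locally_finite {x. d x = 0}"
        "continuous_on UNIV d'" "locally_finite {x. d' x = 0}"
        using A.continuous B.continuous A.locally_finite_meet' B.locally_finite_meet' L M L' M'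
        unfolding d_def d'_def by (auto intro!: continuous_on_diff)
      \<comment> \<open>The common type of the vertex fixes the sign of \<open>d s * d t\<close> and
        equally that of \<open>d' s * d' t\<close>, so their product is positive. Agreement on the
        left and exchange on the right will make it minus a square.\<close>
      have "\<exists>\<epsilon>>0. \<forall>s\<in>{z - \<epsilon><..<z}. \<forall>t\<in>{z<..<z + \<epsilon>}. (d s * d t) * (d' s * d' t) > 0"
      proof (cases "changes_sign d z")
        case True
        then obtain e1 where e1: "e1 > 0" "\<forall>s\<in>{z - e1<..<z}. \<forall>t\<in>{z<..<z + e1}. d s * d t < 0"
          by (auto simp: changes_sign_def)
        obtain e2 where e2: "e2 > 0" "\<forall>s\<in>{z - e2<..<z}. \<forall>t\<in>{z<..<z + e2}. d' s * d' t < 0"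
          using True same by (auto simp: changes_sign_def)
        show ?thesis using e1 e2
          by (intro exI[of _ "min e1 e2"]) (auto intro!: mult_neg_neg)
      next
        case False
        then obtain e1 where e1: "e1 > 0"
          "\<And>s t. s\<in>{z - e1<..<z} \<Longrightarrow> t\<in>{z<..<z + e1} \<Longrightarrow> d s * d t > 0"
          using not_changes_sign[OF props(1,2)] by blast
        obtain e2 where e2: "e2 > 0"
          "\<And>s t. s\<in>{z - e2<..<z} \<Longrightarrow> t\<in>{z<..<z + e2} \<Longrightarrow> d' s * d' t > 0"
          using not_changes_sign[OF props(3,4)] False same by blast
        have "\<forall>s\<in>{z - min e1 e2<..<z}. \<forall>t\<in>{z<..<z + min e1 e2}. (d s * d t) * (d' s * d' t) > 0"
          using e1(2) e2(2) by (auto intro!: mult_pos_pos[of "d _ * d _"])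
        then show ?thesis using e1(1) e2(1) by (intro exI[of _ "min e1 e2"]) simp
      qed
      then obtain \<epsilon> where \<epsilon>: "\<epsilon> > 0"
        "\<And>s t. s\<in>{z - \<epsilon><..<z} \<Longrightarrow> t\<in>{z<..<z + \<epsilon>} \<Longrightarrow> (d s * d t) * (d' s * d' t) > 0" by blast
      define \<eta> where "\<eta> = min (min \<epsilon> (z - x0)) (min \<delta>1 \<delta>2)"
      have \<eta>: "\<eta> > 0" using \<epsilon> \<delta>1 \<delta>2 \<open>x0 < z\<close> by (simp add: \<eta>_def)
      have \<eta>_le: "\<eta> \<le> \<epsilon>" "\<eta> \<le> z - x0" "\<eta> \<le> \<delta>1" "\<eta> \<le> \<delta>2" by (simp_all add: \<eta>_def)
      obtain t where t: "z \<le> t" "t < z + \<eta>" "fn L t \<noteq> fn L' t" using right \<eta> by blast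
      define s where "s = z - \<eta> / 2"
      have s: "x0 \<le> s" "s < z" "z - \<epsilon> < s" "dist s z < \<delta>1" "dist s z < \<delta>2"
        using \<eta> \<eta>_le by (auto simp: s_def dist_real_def)
      have t': "z < t" "t < z + \<epsilon>" "dist t z < \<delta>1" "dist t z < \<delta>2"
        using t y' by (cases "t = z"; auto simp: \<eta>_def dist_real_def y_def)+
      have pos: "(d s * d t) * (d' s * d' t) > 0" using \<epsilon>(2) s t' by auto
      have "fn L s = fn L' s" using left s by auto
      moreover have "fn L s \<noteq> fn M s" using pos by (auto simp: d_def)
      ultimately have "d s = d' s" using fwd(2)[OF s(4)] by (auto simp: d_def d'_def)
      moreover have "d' t = - d t"
        using fwd(1)[OF t'(3)] bwd[OF t'(4)] t(3) by (auto simp: d_def d'_def)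
      ultimately have "(d s * d t) * (d' s * d' t) = - ((d s * d t)\<^sup>2)"
        by (simp add: power2_eq_square)
      then show False using pos by (metis neg_less_0_iff_less not_less zero_le_power2 less_imp_le neg_0_less_iff_less)
    qed
  qed
  have "fn L = fn L'"
  proof
    fix t
    \<comment> \<open>A multiple of \<open>pi\<close> moves any abscissa to the right of
      \<open>x0\<close>, where agreement is known.\<close>
    define k where "k = \<lceil>(x0 - t) / pi\<rceil>"
    have "(x0 - t) / pi \<le> of_int k" by (simp add: k_def)
    then have "x0 \<le> t + of_int k * pi" by (simp add: pos_divide_le_eq)
    then have "fn L (t + of_int k * pi) = fn L' (t + of_int k * pi)" by (rule agree)
    then show "fn L t = fn L' t"
      using antiperiodic_shift[OF A.antiperiodic[OF L]] antiperiodic_shift[OF B.antiperiodic[OF L'(1)]]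
      by (auto split: if_splits)
  qed
  then have "L = L'" using A.pseudoline[OF L] B.pseudoline[OF L'(1)] pseudoline_eqI by blast
  then show "L \<in> \<Lambda>'" using L' by simp
qed

lemma arrangement_determined_by_contacts:
  assumes "arr \<Lambda>" "arr \<Lambda>'" "support \<Lambda> = support \<Lambda>'" "contact_points \<Lambda> = contact_points \<Lambda>'"
  shows "\<Lambda> = \<Lambda>'"
  using lines_subset_if_same_contacts assms by (metis subset_antisym)

subsection \<open>Flips\<close>

lemma changes_sign_cong_imp:
  assumes "changes_sign d x" "\<delta> > 0" "\<And>t. dist t x < \<delta> \<Longrightarrow> d t = e t"
  shows "changes_sign e x"
proof -
  obtain \<epsilon> where \<epsilon>: "\<epsilon> > 0" "\<forall>s\<in>{x - \<epsilon><..<x}. \<forall>t\<in>{x<..<x + \<epsilon>}. d s * d t < 0"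
    using assms(1) by (auto simp: changes_sign_def)
  have "e s * e t < 0" if "s \<in> {x - min \<epsilon> \<delta><..<x}" "t \<in> {x<..<x + min \<epsilon> \<delta>}" for s t
  proof -
    have "dist s x < \<delta>" "dist t x < \<delta>" using that by (auto simp: dist_real_def)
    moreover have "d s * d t < 0" using that \<epsilon>(2) by auto
    ultimately show ?thesis using assms(3) by simp
  qed
  then show ?thesis unfolding changes_sign_def using \<epsilon>(1) assms(2) by (intro exI[of _ "min \<epsilon> \<delta>"]) auto
qed

lemma changes_sign_cong:
  assumes "eventually (\<lambda>t. d t = e t) (nhds x)"
  shows "changes_sign d x \<longleftrightarrow> changes_sign e x"
proof -
  obtain \<delta> where "\<delta> > 0" "\<And>t. dist t x < \<delta> \<Longrightarrow> d t = e t"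
    using assms unfolding eventually_nhds_metric by blast
  then show ?thesis using changes_sign_cong_imp[of d x \<delta> e] changes_sign_cong_imp[of e x \<delta> d] by auto
qed

text \<open>Which function is taken at the zeros of \<open>\<phi>\<close> does not affect
  continuity: it is applied only where \<open>f\<close> and \<open>g\<close> agree there.\<close>

definition exchange :: "(real \<Rightarrow> real) \<Rightarrow> (real \<Rightarrow> real) \<Rightarrow> (real \<Rightarrow> real) \<Rightarrow> real \<Rightarrow> real" where
  "exchange \<phi> f g x = (if \<phi> x \<ge> 0 then g x else f x)"

lemma continuous_exchange:
  assumes "continuous_on UNIV \<phi>" "continuous_on UNIV f" "continuous_on UNIV g"
    "\<And>x. \<phi> x = 0 \<Longrightarrow> f x = g x"
  shows "continuous_on UNIV (exchange \<phi> f g)"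
proof -
  have "continuous_on ({x. \<phi> x \<ge> 0} \<union> {x. \<phi> x \<le> 0}) (\<lambda>x. if \<phi> x \<ge> 0 then g x else f x)"
    using assms by (intro continuous_on_If closed_Collect_le continuous_on_const)
      (auto intro: continuous_on_subset)
  moreover have "{x. \<phi> x \<ge> 0} \<union> {x. \<phi> x \<le> 0} = UNIV" by auto
  ultimately show ?thesis by (simp add: exchange_def[abs_def])
qed

lemma eventually_exchange:
  assumes "continuous_on UNIV \<phi>"
  shows "\<phi> x > 0 \<Longrightarrow> eventually (\<lambda>t. exchange \<phi> f g t = g t) (nhds x)"
    and "\<phi> x < 0 \<Longrightarrow> eventually (\<lambda>t. exchange \<phi> f g t = f t) (nhds x)"
proof -
  assume "\<phi> x > 0"
  then have "eventually (\<lambda>t. t \<in> {t. \<phi> t > 0}) (nhds x)"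
    using assms by (intro eventually_nhds_in_open open_Collect_less continuous_on_const) auto
  then show "eventually (\<lambda>t. exchange \<phi> f g t = g t) (nhds x)"
    by (rule eventually_mono) (auto simp: exchange_def)
next
  assume "\<phi> x < 0"
  then have "eventually (\<lambda>t. t \<in> {t. \<phi> t < 0}) (nhds x)"
    using assms by (intro eventually_nhds_in_open open_Collect_less continuous_on_const) auto
  then show "eventually (\<lambda>t. exchange \<phi> f g t = f t) (nhds x)"
    by (rule eventually_mono) (auto simp: exchange_def)
qed

text \<open>A flip exchanges the two lines between the abscissa \<open>a\<close> of the crossing and
  the abscissa \<open>b\<close> of the contact. Each end of the exchange reverses the type of the
  meeting there. A shift brings \<open>b\<close> into the period after \<open>a\<close>.\<close>

locale flip_setup = arr +
  fixes L M :: "moebius set" and a b :: real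
  assumes LM: "L \<in> \<Lambda>" "M \<in> \<Lambda>" "L \<noteq> M"
    and cross_a: "crossing_point L M (mproj (a, fn L a))"
    and contact_b: "contact_point L M (mproj (b, fn L b))"
    and ab: "a < b" "b < a + pi"
begin

abbreviation "f \<equiv> fn L"
abbreviation "g \<equiv> fn M"

text \<open>Up to multiples of \<open>pi\<close>, \<open>\<phi>\<close> vanishes at \<open>a\<close> and \<open>b\<close> only and is positive between them.\<close>

definition \<phi> :: "real \<Rightarrow> real" where
  "\<phi> x = sin (x - a) * sin (b - x)"

definition f' where "f' = exchange \<phi> f g"
definition g' where "g' = exchange \<phi> g f"
definition L' where "L' = mproj ` range (\<lambda>x. (x, f' x))"
definition M' where "M' = mproj ` range (\<lambda>x. (x, g' x))"
definition N where "N = \<Lambda> - {L, M}"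
definition \<Lambda>' where "\<Lambda>' = N \<union> {L', M'}"

text \<open>The letters are opposite to those of \<open>is_flip\<close>: here \<open>v\<close> is
  the crossing and \<open>w\<close> the contact of the old pair.\<close>

abbreviation v where "v \<equiv> mproj (a, f a)"
abbreviation w where "w \<equiv> mproj (b, f b)"

lemma eq_a: "f a = g a"
  using cross_a crossing_iff LM by metis

lemma eq_b: "f b = g b"
  using contact_b LM by (auto simp: contact_point_def mem_line)

lemma cont_\<phi>: "continuous_on UNIV \<phi>"
  unfolding \<phi>_def by (intro continuous_intros)

text \<open>Both sine factors change their sign, so the product is periodic. Hence the exchange
  happens at the same places in every period and preserves antiperiodicity.\<close>

lemma \<phi>_periodic: "\<phi> (x + pi) = \<phi> x"
proof -
  have "sin (x + pi - a) = - sin (x - a)" "sin (b - (x + pi)) = - sin (b - x)"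
    using sin_periodic_pi[of "x - a"] sin_periodic_pi[of "b - (x + pi)"]
    by (simp_all add: algebra_simps)
  then show ?thesis by (simp add: \<phi>_def)
qed

lemma \<phi>_zero: "\<phi> x = 0 \<Longrightarrow> \<exists>k::int. x = a + of_int k * pi \<or> x = b + of_int k * pi"
proof -
  assume "\<phi> x = 0"
  then consider "sin (x - a) = 0" | "sin (b - x) = 0" by (auto simp: \<phi>_def)
  then show ?thesis
  proof cases
    case 1
    then show ?thesis by (auto simp: sin_zero_iff_int2 algebra_simps)
  next
    case 2
    then obtain k :: int where "b - x = of_int k * pi" by (auto simp: sin_zero_iff_int2)
    then have "x = b + of_int (- k) * pi" by simp
    then show ?thesis by blast
  qed
qed

lemma \<phi>_zero_point: "\<phi> x = 0 \<Longrightarrow> f x = g x \<and> (mproj (x, f x) = v \<or> mproj (x, f x) = w)"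
proof -
  assume "\<phi> x = 0"
  then obtain k where k: "x = a + of_int k * pi \<or> x = b + of_int k * pi" using \<phi>_zero by blast
  have "f (a + of_int k * pi) = g (a + of_int k * pi)" "f (b + of_int k * pi) = g (b + of_int k * pi)"
    using antiperiodic_shift[OF antiperiodic] LM eq_a eq_b by auto
  moreover have "(a + of_int k * pi, f (a + of_int k * pi)) = shift k (a, f a)"
    "(b + of_int k * pi, f (b + of_int k * pi)) = shift k (b, f b)"
    using shift_graph[OF antiperiodic[OF LM(1)]] by auto
  ultimately show ?thesis using k by (metis mproj_shift)
qed

lemma \<phi>_at: "\<phi> a = 0" "\<phi> b = 0"
  by (simp_all add: \<phi>_def)

lemma \<phi>_shift: "\<phi> (x + of_int k * pi) = \<phi> x"
proof (induction k rule: int_induct[where k = 0])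
  case (step1 i)
  then show ?case using \<phi>_periodic[of "x + of_int i * pi"] by (simp add: algebra_simps)
next
  case (step2 i)
  then show ?case using \<phi>_periodic[of "x + of_int (i - 1) * pi"] by (simp add: algebra_simps)
qed simp

lemma \<phi>_zero_of_point: "mproj (x, y) = v \<or> mproj (x, y) = w \<Longrightarrow> \<phi> x = 0"
proof -
  assume "mproj (x, y) = v \<or> mproj (x, y) = w"
  then obtain k where "(x, y) = shift k (a, f a) \<or> (x, y) = shift k (b, f b)"
    using mproj_eq_iff by metis
  then have "x = a + of_int k * pi \<or> x = b + of_int k * pi" by (auto simp: shift_def)
  then show ?thesis using \<phi>_shift \<phi>_at by auto
qed

lemma \<phi>_pos: "a < x \<Longrightarrow> x < b \<Longrightarrow> \<phi> x > 0"
  using ab by (auto simp: \<phi>_def intro!: mult_pos_pos sin_gt_zero)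

lemma \<phi>_neg_left: "b - pi < x \<Longrightarrow> x < a \<Longrightarrow> \<phi> x < 0"
proof -
  assume x: "b - pi < x" "x < a"
  then have "sin (a - x) > 0" "sin (b - x) > 0" using ab by (auto intro!: sin_gt_zero)
  moreover have "sin (x - a) = - sin (a - x)" using sin_minus[of "a - x"] by simp
  ultimately show "\<phi> x < 0" by (simp add: \<phi>_def)
qed

lemma \<phi>_neg_right: "b < x \<Longrightarrow> x < a + pi \<Longrightarrow> \<phi> x < 0"
  using \<phi>_neg_left[of "x - pi"] \<phi>_periodic[of "x - pi"] by simp

lemma lines': "pseudoline_of f' L'" "pseudoline_of g' M'"
proof -
  have "continuous_on UNIV f'" "continuous_on UNIV g'"
    unfolding f'_def g'_def using \<phi>_zero_point continuous LM
    by (auto intro!: continuous_exchange cont_\<phi>)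
  moreover have "antiperiodic f'" "antiperiodic g'"
    using antiperiodic LM \<phi>_periodic
    by (auto simp: antiperiodic_def f'_def g'_def exchange_def)
  ultimately show "pseudoline_of f' L'" "pseudoline_of g' M'"
    by (auto simp: pseudoline_of_alt L'_def M'_def)
qed

lemma pseudolines': "pseudoline L'" "pseudoline M'"
  using lines' by (auto simp: pseudoline_def)

lemma fn': "fn L' = f'" "fn M' = g'"
  using lines' fn_eq by auto

lemma mem': "mproj (x, y) \<in> L' \<longleftrightarrow> y = f' x" "mproj (x, y) \<in> M' \<longleftrightarrow> y = g' x"
  using mem_pseudoline pseudolines' fn' by auto

lemma f'_cases: "f' x = g x \<and> g' x = f x \<or> f' x = f x \<and> g' x = g x"
  by (auto simp: f'_def g'_def exchange_def)

lemma union': "L' \<union> M' = L \<union> M"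
proof (rule set_eqI)
  fix p obtain x y where "p = mproj (x, y)" using mproj_surj by blast
  then show "p \<in> L' \<union> M' \<longleftrightarrow> p \<in> L \<union> M"
    using f'_cases[of x] LM mem' by (auto simp: mem_line)
qed

lemma inter': "L' \<inter> M' = L \<inter> M"
proof (rule set_eqI)
  fix p obtain x y where "p = mproj (x, y)" using mproj_surj by blast
  then show "p \<in> L' \<inter> M' \<longleftrightarrow> p \<in> L \<inter> M"
    using f'_cases[of x] LM mem' by (auto simp: mem_line)
qed

lemma L'_neq_M': "L' \<noteq> M'"
proof
  assume "L' = M'"
  then have "L' = L \<inter> M" "L' = L \<union> M" using union' inter' by auto
  then have "L = M" by blast
  then show False using LM by simp
qed

lemma v_neq_w: "v \<noteq> w"
  using cross_a contact_b by (auto simp: contact_point_def)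

lemma not_third: "K \<in> N \<Longrightarrow> p \<in> L \<Longrightarrow> p \<in> M \<Longrightarrow> p \<notin> K"
  using at_most_two[of L M K p] LM by (auto simp: N_def)

lemma not_third_fn: "K \<in> N \<Longrightarrow> f x = g x \<Longrightarrow> fn K x \<noteq> f x"
  using at_most_two_fn[of L M K x] LM by (auto simp: N_def)

text \<open>Away from the zeros of \<open>\<phi>\<close> the new difference is locally plus or minus
  the old one, so a crossing there would be a second crossing of \<open>L\<close> and
  \<open>M\<close>. At \<open>a\<close> and at \<open>b\<close> the difference is negated on one
  side only, which removes the sign change at \<open>a\<close> and creates one at
  \<open>b\<close>.\<close>

lemma crossing_new_pair: "crossing_point L' M' p \<longleftrightarrow> p = w"
proof -
  obtain x y where xy: "p = mproj (x, y)" using mproj_surj by blast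
  define d where "d = (\<lambda>x. f x - g x)"
  define d' where "d' = (\<lambda>x. f' x - g' x)"
  have cd: "continuous_on UNIV d" "locally_finite {x. d x = 0}"
    using continuous LM locally_finite_meet' by (auto simp: d_def intro!: continuous_on_diff)
  have iff: "crossing_point L' M' (mproj (x, y)) \<longleftrightarrow> y = f' x \<and> y = g' x \<and> changes_sign d' x" for x y
    using crossing_point_iff[OF pseudolines'] by (simp add: fn' d'_def)
  have ca: "changes_sign d a"
    using cross_a crossing_iff LM by (simp add: d_def)
  have cb: "\<not> changes_sign d b"
    using contact_b crossing_iff LM eq_b by (simp add: d_def contact_point_def)
  have d'_pos: "d' x = - d x" if "\<phi> x > 0" for x
    using that by (simp add: d'_def d_def f'_def g'_def exchange_def)
  have d'_neg: "d' x = d x" if "\<phi> x < 0" for x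
    using that by (simp add: d'_def d_def f'_def g'_def exchange_def)
  show ?thesis
  proof (cases "\<phi> x = 0")
    case False
    have "changes_sign d' x \<longleftrightarrow> changes_sign d x"
    proof (cases "\<phi> x > 0")
      case True
      have "eventually (\<lambda>t. d' t = g t - f t) (nhds x)"
        using eventually_conj[OF eventually_exchange(1)[OF cont_\<phi> True, of f g]
            eventually_exchange(1)[OF cont_\<phi> True, of g f]]
        by (rule eventually_mono) (simp add: d'_def f'_def g'_def)
      then have "changes_sign d' x \<longleftrightarrow> changes_sign (\<lambda>t. g t - f t) x" by (rule changes_sign_cong)
      then show ?thesis using changes_sign_minus[of g f] by (simp add: d_def)
    next
      case False
      then have neg: "\<phi> x < 0" using \<open>\<phi> x \<noteq> 0\<close> by simp
      have "eventually (\<lambda>t. d' t = f t - g t) (nhds x)"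
        using eventually_conj[OF eventually_exchange(2)[OF cont_\<phi> neg, of f g]
            eventually_exchange(2)[OF cont_\<phi> neg, of g f]]
        by (rule eventually_mono) (simp add: d'_def f'_def g'_def)
      then show ?thesis unfolding d_def by (rule changes_sign_cong)
    qed
    then have "crossing_point L' M' p \<Longrightarrow> crossing_point L M p"
      using iff f'_cases[of x] crossing_iff LM unfolding xy d_def by metis
    moreover have "\<not> crossing_point L M p"
      using False \<phi>_zero_of_point cross_a ex1_crossing[OF LM] xy by metis
    moreover have "p \<noteq> w" using False \<phi>_zero_of_point xy by metis
    ultimately show ?thesis by blast
  next
    case True
    \<comment> \<open>The zeros of \<open>\<phi>\<close> alternate with gaps \<open>b - a\<close>
      and \<open>pi - (b - a)\<close>, so within distance \<open>\<eta>\<close> of \<open>a\<close>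
      or \<open>b\<close> there is no further zero.\<close>
    define \<eta> where "\<eta> = min (b - a) (pi - (b - a))"
    have \<eta>: "\<eta> > 0" using ab by (simp add: \<eta>_def)
    obtain e1 where e1: "e1 > 0" "\<forall>s\<in>{a - e1<..<a}. \<forall>t\<in>{a<..<a + e1}. d s * d t < 0"
      using ca by (auto simp: changes_sign_def)
    have "\<not> changes_sign d' a"
    proof
      assume "changes_sign d' a"
      then obtain e2 where e2: "e2 > 0" "\<forall>s\<in>{a - e2<..<a}. \<forall>t\<in>{a<..<a + e2}. d' s * d' t < 0"
        by (auto simp: changes_sign_def)
      define r where "r = min (min e1 e2) \<eta> / 2"
      have r: "r > 0" "r < e1" "r < e2" "r < \<eta>" using e1 e2 \<eta> by (auto simp: r_def min_def)
      then have "d (a - r) * d (a + r) < 0" "d' (a - r) * d' (a + r) < 0"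
        using e1 e2 by auto
      moreover have "d' (a - r) = d (a - r)" using r \<phi>_neg_left by (intro d'_neg) (auto simp: \<eta>_def)
      moreover have "d' (a + r) = - d (a + r)" using r \<phi>_pos by (intro d'_pos) (auto simp: \<eta>_def)
      ultimately show False by simp
    qed
    then have "\<not> crossing_point L' M' v" using iff by blast
    obtain e1 where e1: "e1 > 0" "\<And>s t. s\<in>{b - e1<..<b} \<Longrightarrow> t\<in>{b<..<b + e1} \<Longrightarrow> d s * d t > 0"
      using not_changes_sign[OF cd cb] by blast
    have "d' s * d' t < 0" if "s\<in>{b - min e1 \<eta><..<b}" "t\<in>{b<..<b + min e1 \<eta>}" for s t
    proof -
      have "d' s = - d s" using that \<phi>_pos by (intro d'_pos) (auto simp: \<eta>_def)
      moreover have "d' t = d t" using that \<phi>_neg_right by (intro d'_neg) (auto simp: \<eta>_def)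
      moreover have "d s * d t > 0" using that by (intro e1) auto
      ultimately show ?thesis by simp
    qed
    then have "changes_sign d' b" unfolding changes_sign_def
      using e1(1) \<eta> by (intro exI[of _ "min e1 \<eta>"]) auto
    moreover have "f' b = f b" "g' b = f b" using f'_cases[of b] eq_b by auto
    ultimately have "crossing_point L' M' w" using iff by simp
    moreover have "p = v \<or> p = w" if "crossing_point L' M' p"
      using that \<phi>_zero_point[OF True] iff f'_cases[of x] unfolding xy by metis
    ultimately show ?thesis using \<open>\<not> crossing_point L' M' v\<close> by metis
  qed
qed

text \<open>By simplicity \<open>K\<close> avoids the exchange points, so near a point of
  \<open>K\<close> the new lines are the old ones, possibly with their names swapped. Hence the
  union of the two conditions is preserved, though not each of them.\<close>

lemma crossing_other:
  assumes "K \<in> N"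
  shows "crossing_point K L' p \<or> crossing_point K M' p \<longleftrightarrow> crossing_point K L p \<or> crossing_point K M p"
proof -
  have K: "K \<in> \<Lambda>" using assms by (simp add: N_def)
  obtain x y where xy: "p = mproj (x, y)" using mproj_surj by blast
  let ?c = "\<lambda>h. changes_sign (\<lambda>t. fn K t - h t) x"
  have iff: "crossing_point K L' p \<longleftrightarrow> y = fn K x \<and> y = f' x \<and> ?c f'"
    "crossing_point K M' p \<longleftrightarrow> y = fn K x \<and> y = g' x \<and> ?c g'"
    using crossing_point_iff[OF pseudoline[OF K] pseudolines'(1)]
      crossing_point_iff[OF pseudoline[OF K] pseudolines'(2)] by (simp_all add: fn' xy)
  have iff2: "crossing_point K L p \<longleftrightarrow> y = fn K x \<and> y = f x \<and> ?c f"
    "crossing_point K M p \<longleftrightarrow> y = fn K x \<and> y = g x \<and> ?c g"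
    using crossing_iff K LM by (simp_all add: xy)
  consider "\<phi> x = 0" | "\<phi> x > 0" | "\<phi> x < 0" by linarith
  then show ?thesis
  proof cases
    case 1
    then have "f x = g x" using \<phi>_zero_point by blast
    moreover have "fn K x \<noteq> f x" using not_third_fn[OF assms] calculation by simp
    ultimately show ?thesis using iff iff2 f'_cases[of x] by metis
  next
    case 2
    have "?c f' = ?c g" unfolding f'_def
      by (rule changes_sign_cong, rule eventually_mono[OF eventually_exchange(1)[OF cont_\<phi> 2]]) simp
    moreover have "?c g' = ?c f" unfolding g'_def
      by (rule changes_sign_cong, rule eventually_mono[OF eventually_exchange(1)[OF cont_\<phi> 2]]) simp
    moreover have "f' x = g x" "g' x = f x" using 2 by (auto simp: f'_def g'_def exchange_def)
    ultimately show ?thesis using iff iff2 by auto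
  next
    case 3
    have "?c f' = ?c f" unfolding f'_def
      by (rule changes_sign_cong, rule eventually_mono[OF eventually_exchange(2)[OF cont_\<phi> 3]]) simp
    moreover have "?c g' = ?c g" unfolding g'_def
      by (rule changes_sign_cong, rule eventually_mono[OF eventually_exchange(2)[OF cont_\<phi> 3]]) simp
    moreover have "f' x = f x" "g' x = g x" using 3 by (auto simp: f'_def g'_def exchange_def)
    ultimately show ?thesis using iff iff2 by auto
  qed
qed

text \<open>A zero of the new difference is a zero of one of the two old ones, so the zeros stay
  isolated and \<open>antiperiodic_changes_sign\<close> applies.\<close>

lemma ex_crossing_other:
  assumes "K \<in> N" "X \<in> {L', M'}"
  shows "\<exists>p. crossing_point K X p"
proof -
  have K: "K \<in> \<Lambda>" "K \<noteq> L" "K \<noteq> M" using assms by (auto simp: N_def)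
  have X: "pseudoline X" "fn X x = f x \<or> fn X x = g x" for x
    using assms pseudolines' fn' f'_cases[of x] by auto
  have "locally_finite (\<Union>h\<in>{L, M}. {x. fn K x = fn h x})"
    using K LM by (intro locally_finite_UN locally_finite_meet) auto
  then have "locally_finite {x. fn K x - fn X x = 0}"
  proof (rule locally_finite_subset, intro subsetI)
    fix x assume "x \<in> {x. fn K x - fn X x = 0}"
    then show "x \<in> (\<Union>h\<in>{L, M}. {x. fn K x = fn h x})" using X(2)[of x] by auto
  qed
  moreover have "continuous_on UNIV (\<lambda>x. fn K x - fn X x)"
    using continuous_fn X(1) pseudoline[OF K(1)] by (intro continuous_on_diff) auto
  moreover have "antiperiodic (\<lambda>x. fn K x - fn X x)"
    using antiperiodic_fn X(1) pseudoline[OF K(1)] by (intro antiperiodic_diff) auto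
  ultimately obtain x where "fn K x - fn X x = 0" "changes_sign (\<lambda>x. fn K x - fn X x) x"
    using antiperiodic_changes_sign[of "\<lambda>x. fn K x - fn X x"] by blast
  then have "crossing_point K X (mproj (x, fn K x))"
    using crossing_point_iff[OF pseudoline[OF K(1)] X(1)] by simp
  then show ?thesis by blast
qed

text \<open>A count: the new lines inherit exactly the crossings of \<open>K\<close> with
  \<open>L\<close> and with \<open>M\<close>, one each. Either new line gets at least one of them,
  and none is shared, because \<open>K\<close> misses \<open>L' \<inter> M'\<close>.\<close>

lemma ex1_crossing_other:
  assumes "K \<in> N"
  shows "\<exists>!p. crossing_point K L' p" "\<exists>!p. crossing_point K M' p"
proof -
  have K: "K \<in> \<Lambda>" "K \<noteq> L" "K \<noteq> M" using assms by (auto simp: N_def)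
  obtain p1 where p1: "crossing_point K L p \<longleftrightarrow> p = p1" for p
    using ex1_crossing[OF K(1) LM(1) K(2)] by metis
  obtain p2 where p2: "crossing_point K M p \<longleftrightarrow> p = p2" for p
    using ex1_crossing[OF K(1) LM(2) K(3)] by metis
  have "crossing_point K L' p \<or> crossing_point K M' p \<longleftrightarrow> p = p1 \<or> p = p2" for p
    using crossing_other[OF assms] p1 p2 by blast
  moreover have "\<not> (crossing_point K L' p \<and> crossing_point K M' p)" for p
  proof
    assume "crossing_point K L' p \<and> crossing_point K M' p"
    then have "p \<in> K" "p \<in> L' \<inter> M'"
      using crossing_point_mem[OF pseudoline[OF K(1)]] pseudolines' by blast+
    then show False using not_third[OF assms] inter' by blast
  qed
  ultimately show "\<exists>!p. crossing_point K L' p" "\<exists>!p. crossing_point K M' p"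
    using ex_crossing_other[OF assms] by (metis insertCI)+
qed

text \<open>A line does not cross itself, whereas each line of \<open>N\<close> crosses both new
  lines.\<close>

lemma new_notin_N: "L' \<notin> N" "M' \<notin> N"
proof -
  have "\<not> crossing_point K K p" if "K \<in> N" for K p
  proof -
    have K: "K \<in> \<Lambda>" using that by (simp add: N_def)
    obtain x y where xy: "p = mproj (x, y)" using mproj_surj by blast
    have "\<not> changes_sign (\<lambda>x. fn K x - fn K x) x"
    proof
      assume "changes_sign (\<lambda>x. fn K x - fn K x) x"
      then obtain \<epsilon> where "\<epsilon> > 0" "\<forall>s\<in>{x - \<epsilon><..<x}. \<forall>t\<in>{x<..<x + \<epsilon>}. (0::real) < 0"
        by (auto simp: changes_sign_def)
      moreover have "x - \<epsilon> / 2 \<in> {x - \<epsilon><..<x}" "x + \<epsilon> / 2 \<in> {x<..<x + \<epsilon>}"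
        using \<open>\<epsilon> > 0\<close> by auto
      ultimately show False by blast
    qed
    then show ?thesis using crossing_iff[OF K K] by (simp add: xy)
  qed
  then show "L' \<notin> N" "M' \<notin> N" using ex1_crossing_other by blast+
qed

text \<open>\<open>h\<close> assigns to an old line the new line that runs along it over the
  abscissa of \<open>p\<close>. It maps the old lines of the pair through \<open>p\<close> onto the
  new ones, so no point gains lines.\<close>

lemma card_through: "card {X \<in> \<Lambda>'. p \<in> X} \<le> 2"
proof -
  obtain x y where xy: "p = mproj (x, y)" using mproj_surj by blast
  define h where "h X = (if (X = L) = (\<phi> x \<ge> 0) then M' else L')" for X
  have fin: "finite {X \<in> N. p \<in> X}" using finite_lines by (simp add: N_def)
  have "{X \<in> {L', M'}. p \<in> X} \<subseteq> h ` {X \<in> {L, M}. p \<in> X}"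
  proof (cases "\<phi> x \<ge> 0")
    case True
    then have "h L = M'" "h M = L'" using LM(3) by (simp_all add: h_def)
    moreover have "p \<in> L' \<longleftrightarrow> p \<in> M" "p \<in> M' \<longleftrightarrow> p \<in> L"
      using True LM by (simp_all add: xy mem' mem_line f'_def g'_def exchange_def)
    ultimately show ?thesis by (metis (no_types, lifting) image_eqI insert_iff mem_Collect_eq singletonD subsetI)
  next
    case False
    then have "h L = L'" "h M = M'" using LM(3) by (simp_all add: h_def)
    moreover have "p \<in> L' \<longleftrightarrow> p \<in> L" "p \<in> M' \<longleftrightarrow> p \<in> M"
      using False LM by (simp_all add: xy mem' mem_line f'_def g'_def exchange_def)
    ultimately show ?thesis by (metis (no_types, lifting) image_eqI insert_iff mem_Collect_eq singletonD subsetI)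
  qed
  then have "card {X \<in> {L', M'}. p \<in> X} \<le> card (h ` {X \<in> {L, M}. p \<in> X})"
    by (intro card_mono) auto
  also have "\<dots> \<le> card {X \<in> {L, M}. p \<in> X}" by (intro card_image_le) auto
  finally have le: "card {X \<in> {L', M'}. p \<in> X} \<le> card {X \<in> {L, M}. p \<in> X}" .
  have "{X \<in> \<Lambda>'. p \<in> X} = {X \<in> N. p \<in> X} \<union> {X \<in> {L', M'}. p \<in> X}"
    by (auto simp: \<Lambda>'_def)
  then have "card {X \<in> \<Lambda>'. p \<in> X} \<le> card {X \<in> N. p \<in> X} + card {X \<in> {L', M'}. p \<in> X}"
    by (simp add: card_Un_le)
  also have "\<dots> \<le> card {X \<in> N. p \<in> X} + card {X \<in> {L, M}. p \<in> X}" using le by simp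
  also have "\<dots> = card ({X \<in> N. p \<in> X} \<union> {X \<in> {L, M}. p \<in> X})"
    using fin by (intro card_Un_disjoint[symmetric]) (auto simp: N_def)
  also have "{X \<in> N. p \<in> X} \<union> {X \<in> {L, M}. p \<in> X} = {X \<in> \<Lambda>. p \<in> X}"
    using LM unfolding N_def by blast
  also have "card \<dots> \<le> 2" using arrangement by (simp add: arrangement_def)
  finally show ?thesis .
qed

lemma pair_properties:
  assumes "X \<in> \<Lambda>'" "Y \<in> \<Lambda>'" "X \<noteq> Y"
  shows "finite (X \<inter> Y) \<and> (\<exists>!p. crossing_point X Y p)"
proof -
  have KX: "finite (K \<inter> X) \<and> (\<exists>!p. crossing_point K X p)" if "K \<in> N" "X \<in> {L', M'}" for K X
  proof
    have K: "K \<in> \<Lambda>" "K \<noteq> L" "K \<noteq> M" using that by (auto simp: N_def)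
    have "finite (K \<inter> L \<union> K \<inter> M)" using finite_inter K LM by blast
    then show "finite (K \<inter> X)" by (rule finite_subset[rotated]) (use union' that in blast)
    show "\<exists>!p. crossing_point K X p" using ex1_crossing_other that by blast
  qed
  have new: "finite (L' \<inter> M') \<and> (\<exists>!p. crossing_point L' M' p)"
    using crossing_new_pair finite_inter[OF LM] inter' by simp
  have N: "X \<in> N \<Longrightarrow> pseudoline X" for X using pseudoline by (simp add: N_def)
  have sym: "crossing_point X Y = crossing_point Y X"
    using crossing_point_sym[of X Y] assms N pseudolines' by (auto simp: \<Lambda>'_def fun_eq_iff)
  consider "X \<in> N" "Y \<in> N" | "X \<in> N" "Y \<in> {L', M'}" | "Y \<in> N" "X \<in> {L', M'}"
    | "X = L'" "Y = M'" | "X = M'" "Y = L'"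
  proof -
    have "X \<in> N \<or> X \<in> {L', M'}" "Y \<in> N \<or> Y \<in> {L', M'}" using assms by (auto simp: \<Lambda>'_def)
    then show thesis using assms(3) that by (metis insertE singletonD)
  qed
  then show ?thesis
  proof cases
    case 1
    then show ?thesis using finite_inter[of X Y] ex1_crossing[of X Y] assms(3) by (simp add: N_def)
  next
    case 2
    then show ?thesis by (rule KX)
  next
    case 3
    then show ?thesis using KX[of Y X] sym by (simp add: Int_commute)
  next
    case 4
    then show ?thesis using new by simp
  next
    case 5
    then show ?thesis using new sym by (simp add: Int_commute)
  qed
qed

lemma arrangement': "arrangement \<Lambda>'"
  unfolding arrangement_def
proof (intro conjI ballI allI impI)
  show "finite \<Lambda>'" using finite_lines by (simp add: \<Lambda>'_def N_def)
  show "pseudoline X" if "X \<in> \<Lambda>'" for X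
    using that pseudolines' pseudoline by (auto simp: \<Lambda>'_def N_def)
qed (use pair_properties card_through in auto)

lemma support': "support \<Lambda>' = support \<Lambda>"
proof -
  have "support \<Lambda>' = \<Union>N \<union> (L' \<union> M')" by (auto simp: support_def \<Lambda>'_def)
  also have "\<dots> = \<Union>N \<union> (L \<union> M)" by (simp add: union')
  also have "\<dots> = support \<Lambda>" using LM by (auto simp: support_def N_def)
  finally show ?thesis .
qed

lemma crossings_split:
  assumes "\<And>X. X \<in> insert A (insert B N) \<Longrightarrow> pseudoline X" "A \<notin> N" "B \<notin> N" "A \<noteq> B"
  shows "crossings (N \<union> {A, B}) = crossings N \<union>
    {p. \<exists>K\<in>N. crossing_point K A p \<or> crossing_point K B p} \<union> {p. crossing_point A B p}"
    (is "?l = ?r")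
proof -
  have sym: "crossing_point X Y p = crossing_point Y X p" if "X \<in> insert A (insert B N)" "Y \<in> insert A (insert B N)" for X Y p
    using crossing_point_sym assms(1) that by blast
  show ?thesis
  proof (intro equalityI subsetI)
    fix p assume "p \<in> ?l"
    then obtain X Y where "X \<in> N \<union> {A, B}" "Y \<in> N \<union> {A, B}" "X \<noteq> Y" "crossing_point X Y p"
      by (auto simp: crossings_def)
    then show "p \<in> ?r" using sym unfolding crossings_def by blast
  next
    fix p assume "p \<in> ?r"
    then consider X Y where "X \<in> N" "Y \<in> N" "X \<noteq> Y" "crossing_point X Y p"
      | K where "K \<in> N" "crossing_point K A p" | K where "K \<in> N" "crossing_point K B p"
      | "crossing_point A B p"
      unfolding crossings_def by blast
    then have "\<exists>X\<in>N \<union> {A, B}. \<exists>Y\<in>N \<union> {A, B}. X \<noteq> Y \<and> crossing_point X Y p"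
    proof cases
      case 2
      then have "K \<noteq> A" using assms(2) by auto
      then show ?thesis using 2 by blast
    next
      case 3
      then have "K \<noteq> B" using assms(3) by auto
      then show ?thesis using 3 by blast
    qed (use assms(4) in \<open>meson UnCI insertCI\<close>)+
    then show "p \<in> ?l" by (simp add: crossings_def)
  qed
qed

lemma crossings': "crossings \<Lambda>' = (crossings \<Lambda> - {v}) \<union> {w}"
proof -
  have \<Lambda>: "\<Lambda> = N \<union> {L, M}" using LM by (auto simp: N_def)
  have N: "X \<in> N \<Longrightarrow> pseudoline X" for X using pseudoline by (simp add: N_def)
  define R where "R = crossings N \<union> {p. \<exists>K\<in>N. crossing_point K L p \<or> crossing_point K M p}"
  have "crossings \<Lambda> = R \<union> {p. crossing_point L M p}"
    unfolding R_def using LM pseudoline N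
    by (subst \<Lambda>, intro crossings_split) (auto simp: N_def)
  moreover have "{p. crossing_point L M p} = {v}" using ex1_crossing[OF LM] cross_a by auto
  moreover have "crossings \<Lambda>' = crossings N \<union>
    {p. \<exists>K\<in>N. crossing_point K L' p \<or> crossing_point K M' p} \<union> {p. crossing_point L' M' p}"
    unfolding \<Lambda>'_def using new_notin_N L'_neq_M' pseudolines' N by (intro crossings_split) auto
  then have "crossings \<Lambda>' = R \<union> {w}"
    using crossing_other crossing_new_pair by (auto simp: R_def)
  \<comment> \<open>Otherwise a third line would pass through \<open>v\<close>. So deleting
    \<open>v\<close> affects only the crossing of \<open>L\<close> and \<open>M\<close>.\<close>
  moreover have "v \<notin> R"
  proof
    assume "v \<in> R"
    then obtain K where K: "K \<in> N" "v \<in> K"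
      unfolding R_def crossings_def using crossing_point_mem N pseudoline LM by blast
    then show False using not_third[OF K(1), of v] LM eq_a mem_line by blast
  qed
  ultimately show ?thesis by auto
qed

lemma contact_points': "contact_points \<Lambda>' = (contact_points \<Lambda> - {w}) \<union> {v}"
proof -
  have arr': "arr \<Lambda>'" using arrangement' by (simp add: arr_def)
  have "v \<in> intersection_points \<Lambda>"
    using LM eq_a unfolding mproj_in_intersection_points by blast
  then show ?thesis
    using arr.contact_points_eq[OF arr'] contact_points_eq crossings' v_neq_w
      intersection_points_eq[OF arr' arr_axioms support'] by auto
qed

end

text \<open>The conclusions about \<open>L'\<close> and \<open>M'\<close> say that \<open>v\<close>
  and \<open>w\<close> have interchanged their roles in the new pair. The flip can thus be undone,
  which \<open>source_iff\<close> uses in both directions.\<close>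

lemma (in arr) flip_exists:
  assumes "L \<in> \<Lambda>" "M \<in> \<Lambda>" "L \<noteq> M" "contact_point L M w" "crossing_point L M v"
  obtains \<Lambda>' L' M' where "arr \<Lambda>'" "support \<Lambda>' = support \<Lambda>"
    "contact_points \<Lambda>' = (contact_points \<Lambda> - {w}) \<union> {v}"
    "L' \<in> \<Lambda>'" "M' \<in> \<Lambda>'" "L' \<noteq> M'" "contact_point L' M' v" "crossing_point L' M' w"
proof -
  have on_L: "\<exists>x. p = mproj (x, fn L x)" if "p \<in> L" for p
    using that mproj_surj[of p] mem_line[OF assms(1)] by metis
  obtain a where a: "v = mproj (a, fn L a)"
    using on_L crossing_mem[OF assms(1,2,5)] by blast
  obtain b0 where b0: "w = mproj (b0, fn L b0)"
    using on_L assms(4) unfolding contact_point_def by blast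
  \<comment> \<open>This shift moves the lift of \<open>w\<close> into the half-open period from
    \<open>a\<close> to \<open>a + pi\<close>; the left end is excluded below because
    \<open>v\<close> and \<open>w\<close> differ in type.\<close>
  define k where "k = - \<lfloor>(b0 - a) / pi\<rfloor>"
  define b where "b = b0 + of_int k * pi"
  have "(b, fn L b) = shift k (b0, fn L b0)"
    using shift_graph[OF antiperiodic[OF assms(1)]] by (simp add: b_def)
  then have b: "w = mproj (b, fn L b)" using b0 by simp
  have "a \<le> b" "b < a + pi"
  proof -
    define q where "q = \<lfloor>(b0 - a) / pi\<rfloor>"
    have "of_int q \<le> (b0 - a) / pi" "(b0 - a) / pi < of_int q + 1"
      unfolding q_def by linarith+
    then have "of_int q * pi \<le> b0 - a" "b0 - a < (of_int q + 1) * pi"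
      by (simp_all add: pos_le_divide_eq pos_divide_less_eq)
    moreover have "b = b0 - of_int q * pi" by (simp add: b_def k_def q_def)
    ultimately show "a \<le> b" "b < a + pi" by (simp_all add: algebra_simps)
  qed
  moreover have "a \<noteq> b" using a b assms(4,5) unfolding contact_point_def by auto
  ultimately interpret flip_setup \<Lambda> L M a b
    using assms a b by unfold_locales auto
  have "contact_point L' M' v"
    using inter' crossing_new_pair v_neq_w assms(5) crossing_mem[OF assms(1,2,5)] a b
    unfolding contact_point_def by blast
  then show thesis
    using that[of \<Lambda>' L' M'] arrangement' support' contact_points' crossing_new_pair L'_neq_M' a b
    by (auto simp: arr_def \<Lambda>'_def)
qed

subsection \<open>Paths and filters in the lifted graph\<close>

definition arc :: "(real \<Rightarrow> real) \<Rightarrow> real \<Rightarrow> real \<Rightarrow> (real \<times> real) set" where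
  "arc h a b = (\<lambda>x. (x, h x)) ` {a..b}"

lemma mem_arc: "(x, y) \<in> arc h a b \<longleftrightarrow> a \<le> x \<and> x \<le> b \<and> y = h x"
  by (auto simp: arc_def)

lemma arc_eqD:
  assumes "arc h a b = arc h' a' b'" "a < b"
  shows "a = a'" "b = b'" "\<And>x. x \<in> {a..b} \<Longrightarrow> h x = h' x"
proof -
  have *: "a \<le> x \<and> x \<le> b \<and> y = h x \<longleftrightarrow> a' \<le> x \<and> x \<le> b' \<and> y = h' x" for x y
    using assms(1) mem_arc by metis
  have "a' \<le> a" "b \<le> b'" "a' \<le> b'" using *[of a "h a"] *[of b "h b"] assms(2) by auto
  moreover have "a \<le> a'" "b' \<le> b" using *[of a' "h' a'"] *[of b' "h' b'"] calculation by auto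
  ultimately show "a = a'" "b = b'" by auto
  show "h x = h' x" if "x \<in> {a..b}" for x using *[of x "h x"] that by auto
qed

lemma arc_cong: "(\<And>x. x \<in> {a..b} \<Longrightarrow> h x = h' x) \<Longrightarrow> arc h a b = arc h' a b"
  by (auto simp: arc_def)

lemma continuous_agree_at_ends:
  fixes h g :: "real \<Rightarrow> real"
  assumes "continuous_on {a..b} h" "continuous_on {a..b} g" "a < b"
    "\<And>x. x \<in> {a<..<b} \<Longrightarrow> h x = g x" "x \<in> {a..b}"
  shows "h x = g x"
proof -
  have "continuous_on {a..b} (\<lambda>x. h x - g x)" using assms by (intro continuous_on_diff)
  then have lim: "((\<lambda>x. h x - g x) \<longlongrightarrow> h a - g a) (at_right a)"
    "((\<lambda>x. h x - g x) \<longlongrightarrow> h b - g b) (at_left b)"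
    using assms(3) continuous_on_Icc_at_rightD continuous_on_Icc_at_leftD by blast+
  have "eventually (\<lambda>x. h x - g x = 0) (at_right a)" "eventually (\<lambda>x. h x - g x = 0) (at_left b)"
    using assms(4) eventually_at_right_real[OF assms(3)] eventually_at_left_real[OF assms(3)]
    by (auto elim!: eventually_mono)
  then have "((\<lambda>x. h x - g x) \<longlongrightarrow> 0) (at_right a)" "((\<lambda>x. h x - g x) \<longlongrightarrow> 0) (at_left b)"
    by (auto intro: tendsto_eventually)
  then have "h a - g a = 0" "h b - g b = 0"
    using lim tendsto_unique trivial_limit_at_right_real trivial_limit_at_left_real by blast+
  then show ?thesis using assms(4,5) by (cases "x = a"; cases "x = b") auto
qed

text \<open>Meant for the shifts of one point: membership in a filter is monotone in the shift, so
  there is exactly one place where it begins.\<close>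

lemma ex1_int_threshold:
  fixes P :: "int \<Rightarrow> bool"
  assumes mono: "\<And>k. P k \<Longrightarrow> P (k + 1)" and "P k1" "\<not> P k0"
  shows "\<exists>!k. P k \<and> \<not> P (k - 1)"
proof -
  have up: "P j" if "k \<le> j" "P k" for j k
    using that by (induction j rule: int_ge_induct) (auto simp: mono)
  have "k0 < k1" using up[of k1 k0] assms by linarith
  define n where "n = (LEAST n. P (k0 + int n))"
  have ex: "P (k0 + int (nat (k1 - k0)))" using \<open>k0 < k1\<close> assms(2) by simp
  have n: "P (k0 + int n)" unfolding n_def by (rule LeastI, rule ex)
  have "n \<noteq> 0" using n assms(3) by (cases n) auto
  have "\<not> P (k0 + int n - 1)"
  proof
    assume "P (k0 + int n - 1)"
    then have "P (k0 + int (n - 1))" using \<open>n \<noteq> 0\<close> by (simp add: of_nat_diff algebra_simps)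
    then have "n \<le> n - 1" unfolding n_def by (rule Least_le)
    then show False using \<open>n \<noteq> 0\<close> by simp
  qed
  moreover have "j = k" if "P j" "\<not> P (j - 1)" "P k" "\<not> P (k - 1)" for j k
    using up[of j "k - 1"] up[of k "j - 1"] that by linarith
  ultimately show ?thesis using n by blast
qed

lemma path_le_refl [simp]: "path_le S u u"
  by (simp add: path_le_def)

lemma path_le_trans: "path_le S u v \<Longrightarrow> path_le S v w \<Longrightarrow> path_le S u w"
  unfolding path_le_def by (rule rtrancl_trans)

lemma edge_path_le: "edge S e u v \<Longrightarrow> path_le S u v"
  unfolding path_le_def by blast

lemma path_le_fst: "path_le S u v \<Longrightarrow> u = v \<or> fst u < fst v"
  unfolding path_le_def
proof (induction rule: rtrancl_induct)
  case (step y z)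
  then show ?case by (auto simp: edge_def)
qed simp

lemma cut_filterD:
  assumes "cut_filter S F"
  shows "F \<subseteq> lift_vertices S" "u \<in> F \<Longrightarrow> v \<in> lift_vertices S \<Longrightarrow> path_le S u v \<Longrightarrow> v \<in> F"
  using assms by (auto simp: cut_filter_def)

context arr
begin

abbreviation "S \<equiv> support \<Lambda>"
abbreviation "vx \<equiv> lift_vertices S"

lemma in_vx: "(x, y) \<in> vx \<longleftrightarrow> (\<exists>L\<in>\<Lambda>. \<exists>M\<in>\<Lambda>. L \<noteq> M \<and> y = fn L x \<and> y = fn M x)"
  by (simp add: lift_vertices_def vertices_eq mproj_in_intersection_points)

lemma locally_finite_vx: "locally_finite (fst ` vx)"
proof -
  have "fst ` vx \<subseteq> (\<Union>L\<in>\<Lambda>. \<Union>M\<in>\<Lambda> - {L}. {x. fn L x = fn M x})"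
    by (force simp: in_vx)
  moreover have "locally_finite (\<Union>L\<in>\<Lambda>. \<Union>M\<in>\<Lambda> - {L}. {x. fn L x = fn M x})"
    using finite_lines by (intro locally_finite_UN locally_finite_meet) auto
  ultimately show ?thesis using locally_finite_subset by blast
qed

lemma locally_finite_vx_on: "locally_finite {x. (x, h x) \<in> vx}"
  by (rule locally_finite_subset[OF locally_finite_vx]) force

text \<open>A common frame for lines and for curves that change lines at vertices, as strands
  do.\<close>

definition section_on :: "real set \<Rightarrow> (real \<Rightarrow> real) \<Rightarrow> bool" where
  "section_on I h \<longleftrightarrow> continuous_on I h \<and> (\<forall>x\<in>I. \<exists>L\<in>\<Lambda>. h x = fn L x)"

lemma section_on_subset: "section_on I h \<Longrightarrow> J \<subseteq> I \<Longrightarrow> section_on J h"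
  unfolding section_on_def using continuous_on_subset by blast

lemma section_on_line: "L \<in> \<Lambda> \<Longrightarrow> section_on I (fn L)"
  by (auto simp: section_on_def continuous)

text \<open>Connectedness of the interval: the sets on which \<open>h\<close> agrees with the single
  lines are closed, finitely many, and cover it. The set of \<open>L\<close> meets no other one,
  since a common point would be a vertex on \<open>L\<close>.\<close>

lemma follow_Icc:
  assumes "section_on {c..d} h" "L \<in> \<Lambda>" "x0 \<in> {c..d}" "h x0 = fn L x0"
    "\<And>x. x \<in> {c..d} \<Longrightarrow> h x = fn L x \<Longrightarrow> (x, h x) \<notin> vx" "x \<in> {c..d}"
  shows "h x = fn L x"
proof -
  define A where "A M = {x \<in> {c..d}. h x = fn M x}" for M
  have clA: "closed (A M)" if "M \<in> \<Lambda>" for M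
  proof -
    have "continuous_on {c..d} (\<lambda>x. h x - fn M x)"
      using assms(1) continuous[OF that] by (intro continuous_on_diff) (auto simp: section_on_def)
    then have "closed ((\<lambda>x. h x - fn M x) -` {0} \<inter> {c..d})"
      using continuous_on_closed_vimage[of "{c..d}"] closed_atLeastAtMost closed_singleton by blast
    moreover have "(\<lambda>x. h x - fn M x) -` {0} \<inter> {c..d} = A M" by (auto simp: A_def)
    ultimately show ?thesis by simp
  qed
  have "A L \<inter> {c..d} = {} \<or> (\<Union>M\<in>\<Lambda> - {L}. A M) \<inter> {c..d} = {}"
  proof (rule connected_closedD)
    show "A L \<inter> (\<Union>M\<in>\<Lambda> - {L}. A M) \<inter> {c..d} = {}"
    proof (rule ccontr)
      assume "A L \<inter> (\<Union>M\<in>\<Lambda> - {L}. A M) \<inter> {c..d} \<noteq> {}"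
      then obtain x M where "x \<in> {c..d}" "h x = fn L x" "M \<in> \<Lambda>" "M \<noteq> L" "h x = fn M x"
        unfolding A_def by blast
      then show False using assms(2,5) in_vx by metis
    qed
    show "{c..d} \<subseteq> A L \<union> (\<Union>M\<in>\<Lambda> - {L}. A M)"
      using assms(1) unfolding section_on_def A_def by blast
    show "closed (\<Union>M\<in>\<Lambda> - {L}. A M)" using finite_lines clA by (intro closed_UN) auto
  qed (use clA assms(2) in auto)
  then have "(\<Union>M\<in>\<Lambda> - {L}. A M) \<inter> {c..d} = {}" using assms(3,4) by (auto simp: A_def)
  moreover obtain M where "M \<in> \<Lambda>" "h x = fn M x"
    using assms(1,6) unfolding section_on_def by blast
  ultimately show ?thesis using assms(6) unfolding A_def by blast
qed

lemma follow:
  assumes "section_on I h" "\<And>x y. x \<in> I \<Longrightarrow> y \<in> I \<Longrightarrow> {x..y} \<subseteq> I" "L \<in> \<Lambda>" "x0 \<in> I" "h x0 = fn L x0"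
    "\<And>x. x \<in> I \<Longrightarrow> h x = fn L x \<Longrightarrow> (x, h x) \<notin> vx" "x \<in> I"
  shows "h x = fn L x"
proof -
  have sub: "{min x0 x..max x0 x} \<subseteq> I" using assms(2,4,7) by (auto simp: min_def max_def)
  show ?thesis
    by (rule follow_Icc[of "min x0 x" "max x0 x" h L x0])
      (use assms sub in \<open>auto intro: section_on_subset\<close>)
qed

lemma edge_arc:
  assumes "a < b" "section_on {a..b} h" "(a, h a) \<in> vx" "(b, h b) \<in> vx"
    "\<And>x. x \<in> {a<..<b} \<Longrightarrow> (x, h x) \<notin> vx"
  shows "edge S (arc h a b) (a, h a) (b, h b)"
proof -
  have "arc h a b \<subseteq> lift_support S"
    using assms(2) by (auto simp: arc_def section_on_def in_lift_support)
  moreover have "arc h a b \<inter> vx = {(a, h a), (b, h b)}"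
  proof (intro equalityI subsetI)
    fix p assume "p \<in> arc h a b \<inter> vx"
    then obtain x where "p = (x, h x)" "x \<in> {a..b}" "(x, h x) \<in> vx" by (auto simp: arc_def)
    then show "p \<in> {(a, h a), (b, h b)}" using assms(5)[of x] by fastforce
  qed (use assms in \<open>auto simp: arc_def\<close>)
  ultimately show ?thesis using assms(1,2) unfolding edge_def section_on_def arc_def by auto
qed

text \<open>An edge is defined by the support alone. It has no vertex inside, so following it from
  its midpoint keeps it on one line of \<open>\<Lambda>\<close>; the ends, which are vertices, are
  reached by continuity.\<close>

lemma edge_lineE:
  assumes "edge S e u v"
  obtains L a b where "L \<in> \<Lambda>" "a < b" "u = (a, fn L a)" "v = (b, fn L b)" "e = arc (fn L) a b"
    "u \<in> vx" "v \<in> vx" "\<And>x. x \<in> {a<..<b} \<Longrightarrow> (x, fn L x) \<notin> vx"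
proof -
  obtain h a b where h: "a < b" "continuous_on {a..b} h" "u = (a, h a)" "v = (b, h b)" "e = arc h a b"
    "e \<subseteq> lift_support S" "e \<inter> vx = {u, v}"
    using assms unfolding edge_def arc_def by (metis prod.collapse)
  have sec: "section_on {a..b} h"
    using h(2,5,6) unfolding section_on_def arc_def by (force simp: in_lift_support)
  have nv: "(x, h x) \<notin> vx" if "x \<in> {a<..<b}" for x
  proof
    assume "(x, h x) \<in> vx"
    then have "(x, h x) \<in> e \<inter> vx" using that h(5) by (auto simp: mem_arc)
    then show False using h(3,4,7) that by auto
  qed
  have mid: "(a + b) / 2 \<in> {a<..<b}" using h(1) by auto
  then obtain L where L: "L \<in> \<Lambda>" "h ((a + b) / 2) = fn L ((a + b) / 2)"
    using sec unfolding section_on_def by (metis greaterThanLessThan_subseteq_atLeastAtMost_iff order_refl subsetD)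
  have open_eq: "h x = fn L x" if "x \<in> {a<..<b}" for x
    by (rule follow[of "{a<..<b}" h L "(a + b) / 2"])
      (use L mid nv[unfolded greaterThanLessThan_iff] that sec in \<open>fastforce intro: section_on_subset\<close>)+
  have eq: "h x = fn L x" if "x \<in> {a..b}" for x
    using continuous_agree_at_ends[OF h(2) continuous[OF L(1)] h(1) open_eq that] .
  show thesis
  proof (rule that[of L a b])
    show "e = arc (fn L) a b" using h(5) eq arc_cong by metis
    show "u \<in> vx" "v \<in> vx" using h(7) by auto
  qed (use L h eq nv in auto)
qed

text \<open>Induction on the number of interior vertices: without any the arc is an edge, otherwise
  it splits at one of them.\<close>

lemma arc_path_le:
  assumes "a \<le> b" "section_on {a..b} h" "(a, h a) \<in> vx" "(b, h b) \<in> vx"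
  shows "path_le S (a, h a) (b, h b)"
  using assms
proof (induction "card ({x. (x, h x) \<in> vx} \<inter> {a<..<b})" arbitrary: a b rule: less_induct)
  case less
  have fin: "finite ({x. (x, h x) \<in> vx} \<inter> {a<..<b})" for a b
    using locally_finite_vx_on[of h] unfolding locally_finite_def
    by (rule_tac finite_subset[of _ "{x. (x, h x) \<in> vx} \<inter> {a..b}"]) auto
  consider "a = b" | "a < b" "{x. (x, h x) \<in> vx} \<inter> {a<..<b} = {}"
    | c where "a < c" "c < b" "(c, h c) \<in> vx"
    using less.prems(1) by force
  then show ?case
  proof cases
    case 2
    then have "edge S (arc h a b) (a, h a) (b, h b)" using less.prems by (intro edge_arc) auto
    then show ?thesis by (rule edge_path_le)
  next
    case 3
    have "card ({x. (x, h x) \<in> vx} \<inter> {a<..<c}) < card ({x. (x, h x) \<in> vx} \<inter> {a<..<b})"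
      "card ({x. (x, h x) \<in> vx} \<inter> {c<..<b}) < card ({x. (x, h x) \<in> vx} \<inter> {a<..<b})"
      using 3 fin by (auto intro!: psubset_card_mono)
    then have "path_le S (a, h a) (c, h c)" "path_le S (c, h c) (b, h b)"
      using 3 less.prems by (auto intro!: less.hyps intro: section_on_subset)
    then show ?thesis by (rule path_le_trans)
  qed simp
qed

lemma line_path_le:
  "L \<in> \<Lambda> \<Longrightarrow> a \<le> b \<Longrightarrow> (a, fn L a) \<in> vx \<Longrightarrow> (b, fn L b) \<in> vx \<Longrightarrow> path_le S (a, fn L a) (b, fn L b)"
  using arc_path_le section_on_line by blast

section \<open>Vertices far to either side, and the lifts selected by a filter\<close>

lemma shift_in_vx: "shift k p \<in> vx \<longleftrightarrow> p \<in> vx"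
  by (simp add: lift_vertices_def)

lemma meet_above:
  assumes "L \<in> \<Lambda>" "M \<in> \<Lambda>" "L \<noteq> M"
  obtains x where "x > z" "fn L x = fn M x"
proof -
  obtain p where "crossing_point L M p" using ex1_crossing[OF assms] by blast
  then obtain c where c: "fn L c = fn M c" using mproj_surj[of p] crossing_iff assms by metis
  define k where "k = \<lfloor>(z - c) / pi\<rfloor> + 1"
  have "(z - c) / pi < of_int k" unfolding k_def by linarith
  then have "z < c + of_int k * pi" by (simp add: pos_divide_less_eq)
  moreover have "fn L (c + of_int k * pi) = fn M (c + of_int k * pi)"
    using c antiperiodic_shift[OF antiperiodic] assms by auto
  ultimately show thesis using that by blast
qed

lemma meet_below:
  assumes "L \<in> \<Lambda>" "M \<in> \<Lambda>" "L \<noteq> M"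
  obtains x where "x < z" "fn L x = fn M x"
proof -
  obtain c where c: "fn L c = fn M c" using meet_above[OF assms] by blast
  define k where "k = \<lceil>(z - c) / pi\<rceil> - 1"
  have "of_int k < (z - c) / pi" unfolding k_def by linarith
  then have "c + of_int k * pi < z" by (simp add: pos_less_divide_eq)
  moreover have "fn L (c + of_int k * pi) = fn M (c + of_int k * pi)"
    using c antiperiodic_shift[OF antiperiodic] assms by auto
  ultimately show thesis using that by blast
qed

text \<open>From \<open>u\<close> go along its line to a later meeting with \<open>L\<close>, then
  along \<open>L\<close>. Any two lines meet again further to the right, and since there are
  finitely many lines, one bound serves them all.\<close>

lemma vertex_far_right:
  assumes "u \<in> vx"
  obtains X where "\<And>v. v \<in> vx \<Longrightarrow> fst v \<ge> X \<Longrightarrow> path_le S u v"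
proof -
  obtain x0 y0 M where M: "u = (x0, y0)" "M \<in> \<Lambda>" "y0 = fn M x0"
    using assms by (metis in_vx prod.collapse)
  have "\<exists>X. \<forall>x\<ge>X. (x, fn L x) \<in> vx \<longrightarrow> path_le S u (x, fn L x)" if L: "L \<in> \<Lambda>" for L
  proof (cases "L = M")
    case True
    then show ?thesis using line_path_le[OF L, of x0] M assms by (intro exI[of _ x0]) auto
  next
    case False
    obtain c where c: "c > x0" "fn L c = fn M c" using meet_above[OF L M(2) False] by blast
    have vc: "(c, fn L c) \<in> vx" using L M(2) False c in_vx by blast
    have "path_le S u (c, fn L c)" using line_path_le[OF M(2), of x0 c] M assms vc c by auto
    then show ?thesis using line_path_le[OF L, of c] vc path_le_trans by (intro exI[of _ c]) blast
  qed
  then obtain X where X: "\<And>L x. L \<in> \<Lambda> \<Longrightarrow> x \<ge> X L \<Longrightarrow> (x, fn L x) \<in> vx \<Longrightarrow> path_le S u (x, fn L x)"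
    by metis
  show thesis
  proof (rule that[of "Max (X ` \<Lambda>)"])
    fix v assume v: "v \<in> vx" "fst v \<ge> Max (X ` \<Lambda>)"
    then obtain x L where L: "L \<in> \<Lambda>" "v = (x, fn L x)" by (metis in_vx prod.collapse)
    have "X L \<le> Max (X ` \<Lambda>)" using L finite_lines by simp
    then show "path_le S u v" using X L v by auto
  qed
qed

lemma vertex_far_left:
  assumes "u \<in> vx"
  obtains X where "\<And>v. v \<in> vx \<Longrightarrow> fst v \<le> X \<Longrightarrow> path_le S v u"
proof -
  obtain x0 y0 M where M: "u = (x0, y0)" "M \<in> \<Lambda>" "y0 = fn M x0"
    using assms by (metis in_vx prod.collapse)
  have "\<exists>X. \<forall>x\<le>X. (x, fn L x) \<in> vx \<longrightarrow> path_le S (x, fn L x) u" if L: "L \<in> \<Lambda>" for L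
  proof (cases "L = M")
    case True
    then show ?thesis using line_path_le[OF L, of _ x0] M assms by (intro exI[of _ x0]) auto
  next
    case False
    obtain c where c: "c < x0" "fn L c = fn M c" using meet_below[OF L M(2) False] by blast
    have vc: "(c, fn L c) \<in> vx" using L M(2) False c in_vx by blast
    have "path_le S (c, fn L c) u" using line_path_le[OF M(2), of c x0] M assms vc c by auto
    then show ?thesis using line_path_le[OF L, of _ c] vc path_le_trans by (intro exI[of _ c]) blast
  qed
  then obtain X where X: "\<And>L x. L \<in> \<Lambda> \<Longrightarrow> x \<le> X L \<Longrightarrow> (x, fn L x) \<in> vx \<Longrightarrow> path_le S (x, fn L x) u"
    by metis
  show thesis
  proof (rule that[of "Min (X ` \<Lambda>)"])
    fix v assume v: "v \<in> vx" "fst v \<le> Min (X ` \<Lambda>)"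
    then obtain x L where L: "L \<in> \<Lambda>" "v = (x, fn L x)" by (metis in_vx prod.collapse)
    have "X L \<ge> Min (X ` \<Lambda>)" using L finite_lines by simp
    then show "path_le S v u" using X L v by auto
  qed
qed

text \<open>One member of \<open>F\<close> reaches every vertex far to the right. One vertex outside
  \<open>F\<close> is reached from every vertex far to the left, and upward closure keeps these
  outside.\<close>

lemma filter_far:
  assumes "cut_filter S F"
  obtains X Y where "\<And>v. v \<in> vx \<Longrightarrow> fst v \<ge> X \<Longrightarrow> v \<in> F" "\<And>v. v \<in> vx \<Longrightarrow> fst v \<le> Y \<Longrightarrow> v \<notin> F"
proof -
  obtain u where u: "u \<in> F" "u \<in> vx" using assms unfolding cut_filter_def by blast
  obtain u' where u': "u' \<notin> F" "u' \<in> vx" using assms unfolding cut_filter_def by blast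
  obtain X where X: "\<And>v. v \<in> vx \<Longrightarrow> fst v \<ge> X \<Longrightarrow> path_le S u v" using vertex_far_right[OF u(2)] by blast
  obtain Y where Y: "\<And>v. v \<in> vx \<Longrightarrow> fst v \<le> Y \<Longrightarrow> path_le S v u'" using vertex_far_left[OF u'(2)] by blast
  show thesis using that[of X Y] X Y u u' cut_filterD[OF assms] by metis
qed

lemma filter_tau:
  assumes "cut_filter S F" "u \<in> F"
  shows "tau u \<in> F"
proof -
  have u: "u \<in> vx" using cut_filterD(1)[OF assms(1)] assms(2) by blast
  then obtain x L where L: "L \<in> \<Lambda>" "u = (x, fn L x)" by (metis in_vx prod.collapse)
  have "tau u = (x + pi, fn L (x + pi))"
    using antiperiodic[OF L(1)] L by (simp add: tau_def antiperiodic_def)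
  moreover have "tau u \<in> vx" using u shift_in_vx by (simp add: tau_eq_shift)
  ultimately have "path_le S u (tau u)" using line_path_le[OF L(1), of x "x + pi"] u L by simp
  then show ?thesis using cut_filterD(2)[OF assms(1) assms(2)] \<open>tau u \<in> vx\<close> by blast
qed

lemma in_tau_image: "u \<in> tau ` F \<longleftrightarrow> shift (- 1) u \<in> F"
proof
  assume "u \<in> tau ` F"
  then show "shift (- 1) u \<in> F" by (auto simp: tau_eq_shift shift_shift)
next
  assume "shift (- 1) u \<in> F"
  moreover have "u = tau (shift (- 1) u)" by (simp add: tau_eq_shift shift_shift)
  ultimately show "u \<in> tau ` F" by blast
qed

text \<open>Along the shifts of one lift, membership in \<open>F\<close> fails far to the left,
  holds far to the right, and is monotone by \<open>filter_tau\<close>. The lift sought is the first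
  member.\<close>

lemma ex1_filter_lift:
  assumes "cut_filter S F" "v \<in> vertices S"
  shows "\<exists>!u. u \<in> F - tau ` F \<and> mproj u = v"
proof -
  obtain x y where xy: "v = mproj (x, y)" using mproj_surj by blast
  then have vx: "(x, y) \<in> vx" using assms(2) by (simp add: lift_vertices_def)
  obtain X Y where XY: "\<And>v. v \<in> vx \<Longrightarrow> fst v \<ge> X \<Longrightarrow> v \<in> F" "\<And>v. v \<in> vx \<Longrightarrow> fst v \<le> Y \<Longrightarrow> v \<notin> F"
    using filter_far[OF assms(1)] by blast
  let ?P = "\<lambda>k. shift k (x, y) \<in> F"
  have fs: "fst (shift k (x, y)) = x + of_int k * pi" for k by (simp add: shift_def)
  obtain k1 :: int where "(X - x) / pi \<le> of_int k1" using le_of_int_ceiling by blast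
  then have "X \<le> x + of_int k1 * pi" by (simp add: pos_divide_le_eq)
  then have P1: "?P k1" using XY(1) shift_in_vx vx fs by auto
  obtain k0 :: int where "of_int k0 \<le> (Y - x) / pi" using of_int_floor_le by blast
  then have "x + of_int k0 * pi \<le> Y" by (simp add: pos_le_divide_eq)
  then have P0: "\<not> ?P k0" using XY(2) shift_in_vx vx fs by auto
  have "?P (k + 1)" if "?P k" for k
    using filter_tau[OF assms(1) that] by (simp add: tau_eq_shift shift_shift add.commute)
  then have ex1: "\<exists>!k. ?P k \<and> \<not> ?P (k - 1)"
    using ex1_int_threshold[of ?P, OF _ P1 P0] by blast
  have iff: "u \<in> F - tau ` F \<and> mproj u = v \<longleftrightarrow> (\<exists>k. u = shift k (x, y) \<and> ?P k \<and> \<not> ?P (k - 1))" for u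
  proof -
    have "mproj u = v \<longleftrightarrow> (\<exists>k. u = shift k (x, y))" unfolding xy using mproj_eq_iff by metis
    then show ?thesis by (auto simp: in_tau_image shift_shift)
  qed
  show ?thesis unfolding iff using ex1 by blast
qed

lemma filter_lift:
  assumes "cut_filter S F" "v \<in> vertices S"
  shows "filter_lift F v \<in> F - tau ` F" "mproj (filter_lift F v) = v"
  using theI'[OF ex1_filter_lift[OF assms]] unfolding filter_lift_def by auto

lemma filter_lift_eq:
  assumes "cut_filter S F" "u \<in> F - tau ` F"
  shows "filter_lift F (mproj u) = u"
proof -
  have "mproj u \<in> vertices S" using cut_filterD(1)[OF assms(1)] assms(2) by (auto simp: lift_vertices_def)
  then show ?thesis using ex1_filter_lift[OF assms(1)] filter_lift[OF assms(1)] assms(2) by blast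
qed

text \<open>The choice of lifts maps the finite set of vertices onto this difference. This is why a
  sweep of finite length can exist.\<close>

lemma finite_fundamental_domain:
  assumes "cut_filter S F" shows "finite (F - tau ` F)"
proof -
  have "F - tau ` F \<subseteq> filter_lift F ` intersection_points \<Lambda>"
  proof
    fix u assume u: "u \<in> F - tau ` F"
    then have "u \<in> vx" using cut_filterD(1)[OF assms] by blast
    then have "mproj u \<in> intersection_points \<Lambda>" by (simp add: lift_vertices_def vertices_eq)
    then show "u \<in> filter_lift F ` intersection_points \<Lambda>" using filter_lift_eq[OF assms u] by force
  qed
  then show ?thesis using finite_intersection_points finite_subset by blast
qed

section \<open>The edge at which a filter cuts a curve in the support\<close>

definition track :: "(real \<Rightarrow> real) \<Rightarrow> bool" where
  "track h \<longleftrightarrow> section_on UNIV h \<and> (\<forall>z. \<exists>x>z. (x, h x) \<in> vx) \<and> (\<forall>z. \<exists>x<z. (x, h x) \<in> vx)"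

text \<open>The arc of \<open>h\<close> over these abscissas is the edge that the cut crosses;
  keeping its ends explicit avoids handling the edge as a set.\<close>

definition cut_at :: "(real \<times> real) set \<Rightarrow> (real \<Rightarrow> real) \<Rightarrow> real \<Rightarrow> real \<Rightarrow> bool" where
  "cut_at F h a b \<longleftrightarrow> a < b \<and> (a, h a) \<in> vx - F \<and> (b, h b) \<in> F \<and> (\<forall>x\<in>{a<..<b}. (x, h x) \<notin> vx)"

lemma track_path_le:
  "track h \<Longrightarrow> a \<le> b \<Longrightarrow> (a, h a) \<in> vx \<Longrightarrow> (b, h b) \<in> vx \<Longrightarrow> path_le S (a, h a) (b, h b)"
  using arc_path_le section_on_subset unfolding track_def by blast

lemma ex_cut_at:
  assumes "cut_filter S F" "track h"
  obtains a b where "cut_at F h a b"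
proof -
  let ?X = "{x. (x, h x) \<in> vx}"
  obtain X Y where XY: "\<And>v. v \<in> vx \<Longrightarrow> fst v \<ge> X \<Longrightarrow> v \<in> F" "\<And>v. v \<in> vx \<Longrightarrow> fst v \<le> Y \<Longrightarrow> v \<notin> F"
    using filter_far[OF assms(1)] by blast
  obtain r where r: "r > X" "(r, h r) \<in> vx" using assms(2) unfolding track_def by blast
  obtain l where l: "l < Y" "(l, h l) \<in> vx" using assms(2) unfolding track_def by blast
  have rF: "(r, h r) \<in> F" using XY(1)[OF r(2)] r(1) by simp
  have lF: "(l, h l) \<notin> F" using XY(2)[OF l(2)] l(1) by simp
  have up: "(y, h y) \<in> F" if "x \<le> y" "(x, h x) \<in> F" "(y, h y) \<in> vx" for x y
    using track_path_le[OF assms(2) that(1)] cut_filterD[OF assms(1)] that by blast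
  have lr: "l < r" using up[of r l] rF lF l r by force
  \<comment> \<open>The window from \<open>l\<close> to \<open>r\<close> makes both sets finite, so
    a first vertex inside and a last vertex outside \<open>F\<close> exist.\<close>
  define R where "R = {x \<in> ?X \<inter> {l..r}. (x, h x) \<in> F}"
  define D where "D = {x \<in> ?X \<inter> {l..r}. (x, h x) \<notin> F}"
  have "finite (?X \<inter> {l..r})" using locally_finite_vx_on[of h] by (simp add: locally_finite_def)
  then have fin: "finite R" "finite D" unfolding R_def D_def by (auto intro: rev_finite_subset)
  have ne: "r \<in> R" "l \<in> D" using r l rF lF lr by (auto simp: R_def D_def)
  define b where "b = Min R"
  define a where "a = Max D"
  have b: "b \<in> R" "\<And>x. x \<in> R \<Longrightarrow> b \<le> x" using fin ne unfolding b_def by (auto intro: Min_in)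
  have a: "a \<in> D" "\<And>x. x \<in> D \<Longrightarrow> x \<le> a" using fin ne unfolding a_def by (auto intro: Max_in)
  have "a < b" using up[of b a] a(1) b(1) unfolding R_def D_def by force
  moreover have "(x, h x) \<notin> vx" if "x \<in> {a<..<b}" for x
  proof
    assume "(x, h x) \<in> vx"
    then have "x \<in> R \<or> x \<in> D" using that a(1) b(1) by (auto simp: R_def D_def)
    then show False using a(2) b(2) that by fastforce
  qed
  ultimately have "cut_at F h a b" using a(1) b(1) by (auto simp: cut_at_def R_def D_def)
  then show thesis by (rule that)
qed

text \<open>Along a track membership in \<open>F\<close> is monotone, so the two intervals cannot
  lie one after the other; having no interior vertices, they cannot overlap properly either.\<close>

lemma cut_at_unique:
  assumes "cut_filter S F" "track h" "cut_at F h a b" "cut_at F h c d"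
  shows "c = a \<and> d = b"
proof -
  have up: "(y, h y) \<in> F" if "x \<le> y" "(x, h x) \<in> F" "(y, h y) \<in> vx" for x y
    using track_path_le[OF assms(2) that(1)] cut_filterD[OF assms(1)] that by blast
  have one: "a \<ge> c \<and> b \<le> d" if "cut_at F h a b" "cut_at F h c d" for a b c d
  proof -
    have F: "(b, h b) \<in> vx" "(d, h d) \<in> vx" using that cut_filterD(1)[OF assms(1)] by (auto simp: cut_at_def)
    have "\<not> b \<le> c" using up[of b c] that unfolding cut_at_def by blast
    moreover have "\<not> (a < c \<and> c < b)" using that by (auto simp: cut_at_def)
    ultimately have "a \<ge> c" by linarith
    have "\<not> d \<le> a" using up[of d a] that unfolding cut_at_def by blast
    moreover have "\<not> (a < d \<and> d < b)" using that F by (auto simp: cut_at_def)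
    ultimately show ?thesis using \<open>a \<ge> c\<close> by linarith
  qed
  show ?thesis using one[OF assms(3,4)] one[OF assms(4,3)] by auto
qed

lemma cut_at_edge:
  assumes "cut_filter S F" "track h" "cut_at F h a b"
  shows "edge S (arc h a b) (a, h a) (b, h b)" "arc h a b \<in> cut_edges S F"
proof -
  have "section_on {a..b} h" using assms(2) section_on_subset unfolding track_def by blast
  then show e: "edge S (arc h a b) (a, h a) (b, h b)"
    using assms(3) cut_filterD(1)[OF assms(1)] unfolding cut_at_def by (intro edge_arc) auto
  then show "arc h a b \<in> cut_edges S F"
    using assms(3) unfolding cut_edges_def cut_at_def by blast
qed

lemma cut_edge_on_track:
  assumes "cut_filter S F" "track h" "e \<in> cut_edges S F" "e \<subseteq> range (\<lambda>x. (x, h x))"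
  obtains a b where "cut_at F h a b" "e = arc h a b"
proof -
  obtain u v where e: "edge S e u v" "(u \<in> F) \<noteq> (v \<in> F)" using assms(3) by (auto simp: cut_edges_def)
  obtain L a b where L: "L \<in> \<Lambda>" "a < b" "u = (a, fn L a)" "v = (b, fn L b)" "e = arc (fn L) a b"
    "u \<in> vx" "v \<in> vx" "\<And>x. x \<in> {a<..<b} \<Longrightarrow> (x, fn L x) \<notin> vx"
    using edge_lineE[OF e(1)] by metis
  have eq: "h x = fn L x" if "x \<in> {a..b}" for x
  proof -
    have "(x, fn L x) \<in> e" using L(5) that by (auto simp: mem_arc)
    then show ?thesis using assms(4) by auto
  qed
  have "u \<notin> F" "v \<in> F"
    using e(2) edge_path_le[OF e(1)] cut_filterD[OF assms(1)] L(6,7) by blast+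
  then have "cut_at F h a b" using L eq by (auto simp: cut_at_def)
  moreover have "e = arc h a b" using L(5) eq arc_cong by metis
  ultimately show thesis by (rule that)
qed

lemma other_line:
  assumes "cut_filter S F" "L \<in> \<Lambda>" obtains M where "M \<in> \<Lambda>" "M \<noteq> L"
proof -
  obtain u where "u \<in> vx" using assms(1) unfolding cut_filter_def by blast
  then show thesis using that by (metis in_vx prod.collapse)
qed

lemma track_line:
  assumes "cut_filter S F" "L \<in> \<Lambda>" shows "track (fn L)"
proof -
  obtain M where M: "M \<in> \<Lambda>" "M \<noteq> L" using other_line assms by blast
  have "(x, fn L x) \<in> vx" if "fn L x = fn M x" for x using that M assms(2) in_vx by blast
  then show ?thesis unfolding track_def
    using section_on_line[OF assms(2)] meet_above[OF assms(2) M(1)] meet_below[OF assms(2) M(1)] M(2) by metis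
qed

end

subsection \<open>Strands and cuts\<close>

lemma continuous_on_Max_image:
  fixes f :: "'i \<Rightarrow> real \<Rightarrow> real"
  assumes "finite A" "A \<noteq> {}" "\<And>i. i \<in> A \<Longrightarrow> continuous_on I (f i)"
  shows "continuous_on I (\<lambda>x. Max ((\<lambda>i. f i x) ` A))"
  using assms
proof (induction A rule: finite_ne_induct)
  case (insert i A)
  have "Max ((\<lambda>i. f i x) ` insert i A) = max (f i x) (Max ((\<lambda>i. f i x) ` A))" for x
    using insert by simp
  then show ?case using insert by (simp add: continuous_on_max)
qed simp

lemma continuous_on_Min_image:
  fixes f :: "'i \<Rightarrow> real \<Rightarrow> real"
  assumes "finite A" "A \<noteq> {}" "\<And>i. i \<in> A \<Longrightarrow> continuous_on I (f i)"
  shows "continuous_on I (\<lambda>x. Min ((\<lambda>i. f i x) ` A))"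
  using assms
proof (induction A rule: finite_ne_induct)
  case (insert i A)
  have "Min ((\<lambda>i. f i x) ` insert i A) = min (f i x) (Min ((\<lambda>i. f i x) ` A))" for x
    using insert by simp
  then show ?case using insert by (simp add: continuous_on_min)
qed simp

context arr
begin

abbreviation "n \<equiv> card \<Lambda>"

text \<open>The \<open>j\<close>-th strand takes the \<open>j\<close>-th largest value of the lines, counted with multiplicity.\<close>

definition strand :: "nat \<Rightarrow> real \<Rightarrow> real" where
  "strand j x = Max ((\<lambda>A. Min ((\<lambda>L. fn L x) ` A)) ` {A. A \<subseteq> \<Lambda> \<and> card A = j})"

definition lines_gt :: "real \<Rightarrow> real \<Rightarrow> nat" where
  "lines_gt x y = card {L \<in> \<Lambda>. y < fn L x}"

definition lines_ge :: "real \<Rightarrow> real \<Rightarrow> nat" where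
  "lines_ge x y = card {L \<in> \<Lambda>. y \<le> fn L x}"

lemma subsets_of_card:
  assumes "j \<in> {1..n}"
  shows "finite {A. A \<subseteq> \<Lambda> \<and> card A = j}" "{A. A \<subseteq> \<Lambda> \<and> card A = j} \<noteq> {}"
    "\<And>A. A \<subseteq> \<Lambda> \<Longrightarrow> card A = j \<Longrightarrow> finite A \<and> A \<noteq> {}"
proof -
  show "finite {A. A \<subseteq> \<Lambda> \<and> card A = j}" using finite_lines by simp
  show "{A. A \<subseteq> \<Lambda> \<and> card A = j} \<noteq> {}"
    using assms obtain_subset_with_card_n[of j \<Lambda>] by auto
  show "\<And>A. A \<subseteq> \<Lambda> \<Longrightarrow> card A = j \<Longrightarrow> finite A \<and> A \<noteq> {}"
    using finite_lines assms finite_subset by fastforce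
qed

lemma subset_of_card_iff:
  assumes "B \<subseteq> \<Lambda>"
  shows "(\<exists>A. A \<subseteq> \<Lambda> \<and> card A = j \<and> A \<subseteq> B) \<longleftrightarrow> j \<le> card B"
proof
  assume "\<exists>A. A \<subseteq> \<Lambda> \<and> card A = j \<and> A \<subseteq> B"
  then show "j \<le> card B" using assms finite_lines card_mono finite_subset by metis
next
  assume "j \<le> card B"
  then show "\<exists>A. A \<subseteq> \<Lambda> \<and> card A = j \<and> A \<subseteq> B"
    using assms obtain_subset_with_card_n[of j B] by (metis order_trans)
qed

text \<open>A maximum of minima over \<open>j\<close>-subsets is at least \<open>y\<close> iff some
  \<open>j\<close> lines all are. This turns the formula for strands into counting; together with
  the strict version it pins down which strands take a given value.\<close>

lemma strand_ge_iff:
  assumes "j \<in> {1..n}"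
  shows "y \<le> strand j x \<longleftrightarrow> j \<le> lines_ge x y"
proof -
  have "y \<le> strand j x \<longleftrightarrow> (\<exists>A. A \<subseteq> \<Lambda> \<and> card A = j \<and> y \<le> Min ((\<lambda>L. fn L x) ` A))"
    unfolding strand_def using subsets_of_card(1,2)[OF assms] by (subst Max_ge_iff) auto
  also have "\<dots> \<longleftrightarrow> (\<exists>A. A \<subseteq> \<Lambda> \<and> card A = j \<and> A \<subseteq> {L \<in> \<Lambda>. y \<le> fn L x})"
    using subsets_of_card(3)[OF assms] by (intro ex_cong1 conj_cong refl) (subst Min_ge_iff; auto)
  also have "\<dots> \<longleftrightarrow> j \<le> lines_ge x y" unfolding lines_ge_def by (rule subset_of_card_iff) auto
  finally show ?thesis .
qed

lemma strand_gt_iff: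
  assumes "j \<in> {1..n}"
  shows "y < strand j x \<longleftrightarrow> j \<le> lines_gt x y"
proof -
  have "y < strand j x \<longleftrightarrow> (\<exists>A. A \<subseteq> \<Lambda> \<and> card A = j \<and> y < Min ((\<lambda>L. fn L x) ` A))"
    unfolding strand_def using subsets_of_card(1,2)[OF assms] by (subst Max_gr_iff) auto
  also have "\<dots> \<longleftrightarrow> (\<exists>A. A \<subseteq> \<Lambda> \<and> card A = j \<and> A \<subseteq> {L \<in> \<Lambda>. y < fn L x})"
    using subsets_of_card(3)[OF assms] by (intro ex_cong1 conj_cong refl) (subst Min_gr_iff; auto)
  also have "\<dots> \<longleftrightarrow> j \<le> lines_gt x y" unfolding lines_gt_def by (rule subset_of_card_iff) auto
  finally show ?thesis .
qed

lemma strand_eq_iff: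
  "j \<in> {1..n} \<Longrightarrow> strand j x = y \<longleftrightarrow> lines_gt x y < j \<and> j \<le> lines_ge x y"
  using strand_ge_iff[of j y x] strand_gt_iff[of j y x] by auto

lemma lines_ge_split: "lines_ge x y = lines_gt x y + card {L \<in> \<Lambda>. fn L x = y}"
proof -
  have "{L \<in> \<Lambda>. y \<le> fn L x} = {L \<in> \<Lambda>. y < fn L x} \<union> {L \<in> \<Lambda>. fn L x = y}" by auto
  moreover have "card ({L \<in> \<Lambda>. y < fn L x} \<union> {L \<in> \<Lambda>. fn L x = y}) =
    card {L \<in> \<Lambda>. y < fn L x} + card {L \<in> \<Lambda>. fn L x = y}"
    using finite_lines by (intro card_Un_disjoint) auto
  ultimately show ?thesis by (simp add: lines_ge_def lines_gt_def)
qed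

lemma lines_ge_le: "lines_ge x y \<le> n"
  unfolding lines_ge_def using finite_lines by (intro card_mono) auto

lemma strand_on_line: "j \<in> {1..n} \<Longrightarrow> \<exists>L\<in>\<Lambda>. strand j x = fn L x"
proof -
  assume "j \<in> {1..n}"
  then have "lines_gt x (strand j x) < lines_ge x (strand j x)"
    using strand_eq_iff[of j x "strand j x"] by auto
  then have "{L \<in> \<Lambda>. fn L x = strand j x} \<noteq> {}"
    unfolding lines_ge_split by (metis card.empty add_0_right less_irrefl)
  then show ?thesis by force
qed

lemma strand_antimono: "j \<in> {1..n} \<Longrightarrow> Suc j \<le> n \<Longrightarrow> strand (Suc j) x \<le> strand j x"
  using strand_ge_iff[of "Suc j" "strand (Suc j) x" x] strand_ge_iff[of j "strand (Suc j) x" x] by auto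

lemma through_nonvertex:
  assumes "L \<in> \<Lambda>" "(x, fn L x) \<notin> vx" shows "{M \<in> \<Lambda>. fn M x = fn L x} = {L}"
proof (intro equalityI subsetI)
  fix M assume "M \<in> {M \<in> \<Lambda>. fn M x = fn L x}"
  then show "M \<in> {L}" using assms in_vx[of x "fn L x"] by (metis (mono_tags) mem_Collect_eq singletonI)
qed (use assms in auto)

lemma through_vertex:
  assumes "(x, y) \<in> vx"
  obtains L M where "L \<in> \<Lambda>" "M \<in> \<Lambda>" "L \<noteq> M" "{K \<in> \<Lambda>. fn K x = y} = {L, M}"
proof -
  obtain L M where LM: "L \<in> \<Lambda>" "M \<in> \<Lambda>" "L \<noteq> M" "y = fn L x" "y = fn M x"
    using assms in_vx by blast
  have "{K \<in> \<Lambda>. fn K x = y} = {L, M}"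
  proof (intro equalityI subsetI)
    fix K assume "K \<in> {K \<in> \<Lambda>. fn K x = y}"
    then show "K \<in> {L, M}" using LM at_most_two_fn[of L M K x] by simp
  next
    fix K assume "K \<in> {L, M}"
    then show "K \<in> {K \<in> \<Lambda>. fn K x = y}" using LM by auto
  qed
  then show thesis using that LM by blast
qed

lemma strand_nonvertex:
  assumes "L \<in> \<Lambda>" "(x, fn L x) \<notin> vx" "j \<in> {1..n}"
  shows "strand j x = fn L x \<longleftrightarrow> j = lines_ge x (fn L x)"
proof -
  have "card {M \<in> \<Lambda>. fn M x = fn L x} = 1" by (simp add: through_nonvertex[OF assms(1,2)])
  then have "lines_ge x (fn L x) = lines_gt x (fn L x) + 1" by (simp add: lines_ge_split)
  then show ?thesis using strand_eq_iff[OF assms(3), of x "fn L x"] by linarith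
qed

lemma lines_ge_pos: "L \<in> \<Lambda> \<Longrightarrow> lines_ge x (fn L x) \<in> {1..n}"
proof -
  assume "L \<in> \<Lambda>"
  then have "{M \<in> \<Lambda>. fn L x \<le> fn M x} \<noteq> {}" by auto
  then have "lines_ge x (fn L x) \<noteq> 0" unfolding lines_ge_def using finite_lines by simp
  then show ?thesis using lines_ge_le[of x "fn L x"] by simp
qed

text \<open>The lines strictly above \<open>y\<close> account for the first
  \<open>lines_gt x y\<close> strands, and exactly two lines pass through a vertex. So the next two
  strands take the value \<open>y\<close>, and no others.\<close>

lemma strand_vertex:
  assumes "(x, y) \<in> vx"
  shows "lines_gt x y + 2 \<le> n"
    "j \<in> {1..n} \<Longrightarrow> strand j x = y \<longleftrightarrow> j = lines_gt x y + 1 \<or> j = lines_gt x y + 2"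
proof -
  obtain L M where "L \<in> \<Lambda>" "M \<in> \<Lambda>" "L \<noteq> M" "{K \<in> \<Lambda>. fn K x = y} = {L, M}"
    using through_vertex[OF assms] .
  then have ge: "lines_ge x y = lines_gt x y + 2" by (simp add: lines_ge_split)
  then show "lines_gt x y + 2 \<le> n" using lines_ge_le[of x y] by simp
  show "strand j x = y \<longleftrightarrow> j = lines_gt x y + 1 \<or> j = lines_gt x y + 2" if "j \<in> {1..n}"
    using strand_eq_iff[OF that, of x y] ge by auto
qed

text \<open>Continuity is immediate from the formula by maxima and minima, which is the reason for
  that form of \<open>strand\<close>.\<close>

lemma section_on_strand: "j \<in> {1..n} \<Longrightarrow> section_on I (strand j)"
proof -
  assume j: "j \<in> {1..n}"
  have "continuous_on I (\<lambda>x. Max ((\<lambda>A. Min ((\<lambda>L. fn L x) ` A)) ` {A. A \<subseteq> \<Lambda> \<and> card A = j}))"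
    using subsets_of_card[OF j] continuous
    by (intro continuous_on_Max_image continuous_on_Min_image) auto
  then show ?thesis using strand_on_line[OF j] by (simp add: section_on_def strand_def[abs_def])
qed

text \<open>A strand without vertices beyond \<open>z\<close> would follow one line for ever, but
  every line has vertices beyond \<open>z\<close> on either side.\<close>

lemma track_strand:
  assumes "cut_filter S F" "j \<in> {1..n}" shows "track (strand j)"
  unfolding track_def
proof (intro conjI allI)
  show "section_on UNIV (strand j)" using section_on_strand assms by blast
  fix z
  show "\<exists>x>z. (x, strand j x) \<in> vx"
  proof (rule ccontr)
    assume *: "\<not> ?thesis"
    obtain L where L: "L \<in> \<Lambda>" "strand j (z + 1) = fn L (z + 1)" using strand_on_line assms(2) by blast
    have "strand j x = fn L x" if "x > z" for x
      by (rule follow[of "{z<..}" "strand j" L "z + 1"])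
        (use L * that section_on_strand[OF assms(2)] in auto)
    moreover obtain x where "x > z" "(x, fn L x) \<in> vx" using track_line[OF assms(1) L(1)] unfolding track_def by blast
    ultimately show False using * by metis
  qed
  show "\<exists>x<z. (x, strand j x) \<in> vx"
  proof (rule ccontr)
    assume *: "\<not> ?thesis"
    obtain L where L: "L \<in> \<Lambda>" "strand j (z - 1) = fn L (z - 1)" using strand_on_line assms(2) by blast
    have "strand j x = fn L x" if "x < z" for x
      by (rule follow[of "{..<z}" "strand j" L "z - 1"])
        (use L * that section_on_strand[OF assms(2)] in auto)
    moreover obtain x where "x < z" "(x, fn L x) \<in> vx" using track_line[OF assms(1) L(1)] unfolding track_def by blast
    ultimately show False using * by metis
  qed
qed

lemma strand_follows_edge:
  assumes "L \<in> \<Lambda>" "a < b" "\<And>x. x \<in> {a<..<b} \<Longrightarrow> (x, fn L x) \<notin> vx"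
    "j \<in> {1..n}" "x0 \<in> {a<..<b}" "strand j x0 = fn L x0" "x \<in> {a..b}"
  shows "strand j x = fn L x"
proof -
  have "strand j x = fn L x" if "x \<in> {a<..<b}" for x
  proof (rule follow[of "{a<..<b}" "strand j" L x0])
    show "(x, strand j x) \<notin> vx" if "x \<in> {a<..<b}" "strand j x = fn L x" for x
      using assms(3)[OF that(1)] that(2) by simp
  qed (use assms that section_on_strand in auto)
  then show ?thesis
    using continuous_agree_at_ends[of a b "strand j" "fn L" x] assms section_on_strand[OF assms(4)]
      continuous[OF assms(1)] by (auto simp: section_on_def)
qed

text \<open>Away from the abscissas of vertices the lines have distinct heights, so points of the
  support may be counted as lines. This ties \<open>at_level\<close> to strands.\<close>

lemma level_count:
  assumes "x \<notin> fst ` vx"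
  shows "card {y'. (x, y') \<in> lift_support S \<and> y \<le> y'} = lines_ge x y"
proof -
  have "{y'. (x, y') \<in> lift_support S \<and> y \<le> y'} = (\<lambda>L. fn L x) ` {L \<in> \<Lambda>. y \<le> fn L x}"
    by (auto simp: in_lift_support)
  moreover have "inj_on (\<lambda>L. fn L x) {L \<in> \<Lambda>. y \<le> fn L x}"
  proof (rule inj_onI, rule ccontr)
    fix L M assume "L \<in> {L \<in> \<Lambda>. y \<le> fn L x}" "M \<in> {L \<in> \<Lambda>. y \<le> fn L x}" "fn L x = fn M x" "L \<noteq> M"
    then have "(x, fn L x) \<in> vx" using in_vx by blast
    then show False using assms by force
  qed
  ultimately show ?thesis by (simp add: card_image lines_ge_def)
qed

text \<open>\<open>at_level\<close> looks at a single abscissa. The edge has no vertex inside, so a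
  strand that agrees with it at one interior point follows it to both ends.\<close>

lemma at_level_iff:
  assumes "edge S e u v"
  shows "at_level S e j \<longleftrightarrow> j \<in> {1..n} \<and> e \<subseteq> range (\<lambda>x. (x, strand j x))"
proof -
  obtain L a b where L: "L \<in> \<Lambda>" "a < b" "u = (a, fn L a)" "v = (b, fn L b)" "e = arc (fn L) a b"
    "u \<in> vx" "v \<in> vx" "\<And>x. x \<in> {a<..<b} \<Longrightarrow> (x, fn L x) \<notin> vx"
    using edge_lineE[OF assms] by metis
  have nonv: "x \<in> {a<..<b}" if "x \<notin> fst ` vx" "x \<in> {a..b}" for x
  proof -
    have "x \<noteq> a" "x \<noteq> b" using that L(3,4,6,7) by force+
    then show ?thesis using that by auto
  qed
  show ?thesis
  proof
    assume "at_level S e j"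
    then obtain x y where x: "(x, y) \<in> e" "x \<notin> fst ` vx" "lines_ge x y = j"
      unfolding at_level_def using level_count by auto
    then have y: "x \<in> {a..b}" "y = fn L x" using L(5) by (auto simp: mem_arc)
    have j: "j \<in> {1..n}" using x(3) y lines_ge_pos[OF L(1)] by blast
    have x': "x \<in> {a<..<b}" using nonv x y by blast
    have "strand j x = fn L x" using strand_nonvertex[OF L(1) L(8)[OF x'] j] x y by simp
    then have "strand j t = fn L t" if "t \<in> {a..b}" for t
      using strand_follows_edge[OF L(1,2,8) j x' _ that] by blast
    then show "j \<in> {1..n} \<and> e \<subseteq> range (\<lambda>x. (x, strand j x))" using j L(5) by (auto simp: arc_def)
  next
    assume j: "j \<in> {1..n} \<and> e \<subseteq> range (\<lambda>x. (x, strand j x))"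
    obtain x where x: "a < x" "x < b" "x \<notin> fst ` vx"
      using locally_finite_avoid[OF locally_finite_vx L(2)] by blast
    then have xe: "(x, fn L x) \<in> e" using L(5) by (simp add: mem_arc)
    then have "strand j x = fn L x" using j by auto
    then have "lines_ge x (fn L x) = j"
      using strand_nonvertex[OF L(1) L(8)] x j by auto
    then show "at_level S e j" unfolding at_level_def using level_count[OF x(3)] x(3) xe by blast
  qed
qed

lemma edge_on_strand:
  assumes "edge S e u v" obtains j where "j \<in> {1..n}" "e \<subseteq> range (\<lambda>x. (x, strand j x))"
proof -
  obtain L a b where L: "L \<in> \<Lambda>" "a < b" "e = arc (fn L) a b"
    "\<And>x. x \<in> {a<..<b} \<Longrightarrow> (x, fn L x) \<notin> vx"
    using edge_lineE[OF assms] by metis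
  define x where "x = (a + b) / 2"
  define j where "j = lines_ge x (fn L x)"
  have x: "x \<in> {a<..<b}" using L(2) by (simp add: x_def)
  have j: "j \<in> {1..n}" unfolding j_def using lines_ge_pos L(1) by blast
  have "strand j x = fn L x" using strand_nonvertex[OF L(1) L(4)[OF x] j] by (simp add: j_def)
  then have "strand j t = fn L t" if "t \<in> {a..b}" for t
    using strand_follows_edge[OF L(1,2,4) j x _ that] by blast
  then have "e \<subseteq> range (\<lambda>x. (x, strand j x))" using L(3) by (auto simp: arc_def)
  then show thesis using that j by blast
qed

lemma cut_edge_eq:
  assumes "cut_filter S F" "j \<in> {1..n}" "cut_at F (strand j) a b"
  shows "cut_edge S F j = arc (strand j) a b"
  unfolding cut_edge_def
proof (rule the_equality)
  have tr: "track (strand j)" using track_strand assms by blast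
  show "arc (strand j) a b \<in> cut_edges S F \<and> at_level S (arc (strand j) a b) j"
    using cut_at_edge[OF assms(1) tr assms(3)] at_level_iff assms(2) by (auto simp: arc_def)
  fix e assume e: "e \<in> cut_edges S F \<and> at_level S e j"
  then have "e \<subseteq> range (\<lambda>x. (x, strand j x))" using at_level_iff by (auto simp: cut_edges_def)
  then obtain c d where "cut_at F (strand j) c d" "e = arc (strand j) c d"
    using cut_edge_on_track[OF assms(1) tr] e by blast
  then show "e = arc (strand j) a b" using cut_at_unique[OF assms(1) tr assms(3)] by blast
qed

section \<open>The lines met by a cut, strand by strand\<close>

definition line_at :: "(real \<times> real) set \<Rightarrow> nat \<Rightarrow> moebius set" where
  "line_at F j = line_of \<Lambda> (cut_edge S F j)"

lemma line_of_arc: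
  assumes "L \<in> \<Lambda>" "a < b" "\<And>x. x \<in> {a<..<b} \<Longrightarrow> (x, fn L x) \<notin> vx"
  shows "line_of \<Lambda> (arc (fn L) a b) = L"
  unfolding line_of_def
proof (rule the_equality)
  show "L \<in> \<Lambda> \<and> mproj ` arc (fn L) a b \<subseteq> L" using assms(1) mem_line by (auto simp: arc_def)
  fix M assume M: "M \<in> \<Lambda> \<and> mproj ` arc (fn L) a b \<subseteq> M"
  have "((a + b) / 2, fn L ((a + b) / 2)) \<in> arc (fn L) a b" using assms(2) by (simp add: mem_arc)
  then have "mproj ((a + b) / 2, fn L ((a + b) / 2)) \<in> M" using M by blast
  then have "fn L ((a + b) / 2) = fn M ((a + b) / 2)" using M mem_line by blast
  moreover have "((a + b) / 2, fn L ((a + b) / 2)) \<notin> vx" using assms(2) by (intro assms(3)) simp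
  ultimately show "M = L" using M assms(1) in_vx by metis
qed

lemma line_at_props:
  assumes "cut_filter S F" "j \<in> {1..n}" "cut_at F (strand j) a b"
  shows "line_at F j \<in> \<Lambda>" "\<And>x. x \<in> {a..b} \<Longrightarrow> strand j x = fn (line_at F j) x" "cut_at F (fn (line_at F j)) a b"
proof -
  have "edge S (arc (strand j) a b) (a, strand j a) (b, strand j b)"
    using cut_at_edge track_strand assms by blast
  then obtain L c d where L: "L \<in> \<Lambda>" "c < d" "arc (strand j) a b = arc (fn L) c d"
    "\<And>x. x \<in> {c<..<d} \<Longrightarrow> (x, fn L x) \<notin> vx"
    using edge_lineE by metis
  have "a < b" using assms(3) by (simp add: cut_at_def)
  have cd: "a = c" "b = d" and eq: "\<And>x. x \<in> {a..b} \<Longrightarrow> strand j x = fn L x"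
    using arc_eqD[OF L(3) \<open>a < b\<close>] by blast+
  have "line_at F j = L" unfolding line_at_def cut_edge_eq[OF assms] L(3) by (rule line_of_arc[OF L(1,2,4)])
  then show "line_at F j \<in> \<Lambda>" "\<And>x. x \<in> {a..b} \<Longrightarrow> strand j x = fn (line_at F j) x" using L(1) eq by auto
  then show "cut_at F (fn (line_at F j)) a b" using assms(3) by (auto simp: cut_at_def)
qed

lemma cut_at_strand:
  assumes "cut_filter S F" "j \<in> {1..n}" obtains a b where "cut_at F (strand j) a b"
  using ex_cut_at[OF assms(1) track_strand[OF assms]] by blast

lemma line_at_in: "cut_filter S F \<Longrightarrow> j \<in> {1..n} \<Longrightarrow> line_at F j \<in> \<Lambda>"
  using line_at_props(1) cut_at_strand by metis

text \<open>A line is itself a track and is cut only once. Two strands giving the same line would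
  share its cut edge, but over the interior of an edge only one strand passes along it.\<close>

lemma line_at_inj:
  assumes "cut_filter S F" shows "inj_on (line_at F) {1..n}"
proof (rule inj_onI)
  fix i j assume ij: "i \<in> {1..n}" "j \<in> {1..n}" "line_at F i = line_at F j"
  obtain a b where ab: "cut_at F (strand i) a b" using cut_at_strand[OF assms ij(1)] .
  obtain c d where cd: "cut_at F (strand j) c d" using cut_at_strand[OF assms ij(2)] .
  note i = line_at_props[OF assms ij(1) ab] and j = line_at_props[OF assms ij(2) cd]
  have "cut_at F (fn (line_at F i)) c d" using j(3) ij(3) by simp
  then have eq: "c = a" "d = b"
    using cut_at_unique[OF assms track_line[OF assms i(1)] i(3)] by blast+
  have mid: "(a + b) / 2 \<in> {a<..<b}" using ab by (auto simp: cut_at_def)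
  then have nv: "((a + b) / 2, fn (line_at F i) ((a + b) / 2)) \<notin> vx" using i(3) unfolding cut_at_def by blast
  have "strand i ((a + b) / 2) = fn (line_at F i) ((a + b) / 2)" using i(2) mid by simp
  moreover have "strand j ((a + b) / 2) = fn (line_at F i) ((a + b) / 2)" using j(2) mid eq ij(3) by simp
  ultimately show "i = j" using strand_nonvertex[OF i(1) nv] ij by metis
qed

lemma line_at_bij:
  assumes "cut_filter S F" shows "bij_betw (line_at F) {1..n} \<Lambda>"
proof -
  have "line_at F ` {1..n} = \<Lambda>"
    using line_at_inj[OF assms] line_at_in[OF assms] finite_lines
    by (intro card_subset_eq) (auto simp: card_image)
  then show ?thesis using line_at_inj[OF assms] by (simp add: bij_betw_def)
qed

text \<open>The left side depends on the support and the filter only, so all arrangements with this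
  support have equally many lines. It also evaluates the bound in
  \<open>sweep_position\<close>.\<close>

lemma card_cut_edges:
  assumes "cut_filter S F" shows "card (cut_edges S F) = n"
proof -
  have "inj_on (cut_edge S F) {1..n}"
    using line_at_inj[OF assms] unfolding line_at_def inj_on_def by metis
  moreover have "cut_edge S F ` {1..n} = cut_edges S F"
  proof (intro equalityI subsetI)
    fix e assume "e \<in> cut_edge S F ` {1..n}"
    then obtain j where j: "j \<in> {1..n}" "e = cut_edge S F j" by blast
    then show "e \<in> cut_edges S F"
      using cut_at_strand[OF assms j(1)] cut_edge_eq[OF assms j(1)]
        cut_at_edge(2)[OF assms track_strand[OF assms j(1)]] by metis
  next
    fix e assume e: "e \<in> cut_edges S F"
    then obtain j where j: "j \<in> {1..n}" "e \<subseteq> range (\<lambda>x. (x, strand j x))"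
      using edge_on_strand unfolding cut_edges_def by blast
    then show "e \<in> cut_edge S F ` {1..n}"
      using cut_edge_on_track[OF assms track_strand[OF assms j(1)] e j(2)] cut_edge_eq[OF assms j(1)]
      by (metis image_eqI)
  qed
  ultimately show ?thesis using card_image by fastforce
qed

text \<open>Both sets are filters and differ by \<open>p\<close>, so on a track through
  \<open>p\<close> every later vertex lies in \<open>F\<close> while \<open>p\<close> does not: the
  cut of \<open>F\<close> begins at \<open>p\<close>. In \<open>cut_ends_at\<close> the cut of the
  larger filter ends there.\<close>

lemma cut_starts_at:
  assumes "cut_filter S F" "cut_filter S (insert p F)" "p \<notin> F" "p = (x0, y0)"
    "track h" "h x0 = y0"
  obtains b where "cut_at F h x0 b"
proof -
  obtain a b where ab: "cut_at F h a b" using ex_cut_at[OF assms(1,5)] .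
  have p: "p \<in> vx" using cut_filterD(1)[OF assms(2)] by blast
  have "\<not> a < x0"
  proof
    assume "a < x0"
    moreover have "\<not> b \<le> x0"
      using track_path_le[OF assms(5), of b x0] ab cut_filterD[OF assms(1)] p assms unfolding cut_at_def by blast
    ultimately show False using ab p assms(4,6) by (auto simp: cut_at_def)
  qed
  moreover have "\<not> x0 < a"
  proof
    assume "x0 < a"
    then have "(a, h a) \<in> insert p F"
      using track_path_le[OF assms(5), of x0 a] ab cut_filterD(2)[OF assms(2), of p "(a, h a)"] p assms(4,6)
      unfolding cut_at_def by auto
    then show False using ab \<open>x0 < a\<close> assms(4) unfolding cut_at_def by auto
  qed
  ultimately show thesis using that ab by (metis linorder_neqE_linordered_idom)
qed

lemma cut_ends_at:
  assumes "cut_filter S F" "cut_filter S (insert p F)" "p \<notin> F" "p = (x0, y0)"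
    "track h" "h x0 = y0"
  obtains a where "cut_at (insert p F) h a x0"
proof -
  obtain a b where ab: "cut_at (insert p F) h a b" using ex_cut_at[OF assms(2,5)] .
  have p: "p \<in> vx" using cut_filterD(1)[OF assms(2)] by blast
  have bv: "(b, h b) \<in> vx" using ab cut_filterD(1)[OF assms(2)] unfolding cut_at_def by blast
  have "\<not> x0 < b"
  proof
    assume "x0 < b"
    moreover have "\<not> x0 \<le> a"
      using track_path_le[OF assms(5), of x0 a] ab cut_filterD(2)[OF assms(2), of p "(a, h a)"] p assms(4,6)
      unfolding cut_at_def by blast
    ultimately show False using ab p assms(4,6) by (auto simp: cut_at_def)
  qed
  moreover have "\<not> b < x0"
  proof
    assume "b < x0"
    then have "(b, h b) \<in> F" using ab assms(4) by (auto simp: cut_at_def)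
    then show False
      using track_path_le[OF assms(5), of b x0] cut_filterD(2)[OF assms(1), of "(b, h b)" p] bv p
        \<open>b < x0\<close> assms(3,4,6) by auto
  qed
  ultimately show thesis using that ab by (metis linorder_neqE_linordered_idom)
qed

text \<open>On the two strands through \<open>p\<close>, the edges cut by \<open>F\<close> lie to
  the right of \<open>p\<close> and those cut by \<open>insert p F\<close> to the left. On both
  sides the upper strand carries the upper line, so the lines are exchanged exactly if their
  difference changes its sign at \<open>p\<close>. The other strands miss \<open>p\<close> and keep
  their cut edges.\<close>

lemma sweep_step:
  assumes F: "cut_filter S F" and F': "cut_filter S (insert p F)" and p: "p \<notin> F"
  obtains k where "k \<in> {1..<n}"
    "\<And>j. j \<in> {1..n} \<Longrightarrow> endpoint S (cut_edge S F j) p \<longleftrightarrow> j = k \<or> j = Suc k"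
    "mproj p \<in> line_at F k" "mproj p \<in> line_at F (Suc k)"
    "\<And>j. j \<in> {1..n} \<Longrightarrow> j \<noteq> k \<Longrightarrow> j \<noteq> Suc k \<Longrightarrow> line_at (insert p F) j = line_at F j"
    "crossing_point (line_at F k) (line_at F (Suc k)) (mproj p) \<Longrightarrow>
       line_at (insert p F) k = line_at F (Suc k) \<and> line_at (insert p F) (Suc k) = line_at F k"
    "\<not> crossing_point (line_at F k) (line_at F (Suc k)) (mproj p) \<Longrightarrow>
       line_at (insert p F) k = line_at F k \<and> line_at (insert p F) (Suc k) = line_at F (Suc k)"
proof -
  obtain x0 y0 where p0: "p = (x0, y0)" by (cases p)
  have pv: "(x0, y0) \<in> vx" using cut_filterD(1)[OF F'] p0 by blast
  \<comment> \<open>The lines strictly above \<open>p\<close> fill the strands before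
    \<open>k\<close>, so \<open>k\<close> and \<open>Suc k\<close> are the two strands through
    \<open>p\<close>.\<close>
  define k where "k = lines_gt x0 y0 + 1"
  have k: "k \<in> {1..<n}" "k \<in> {1..n}" "Suc k \<in> {1..n}" using strand_vertex(1)[OF pv] by (auto simp: k_def)
  have on_p: "strand j x0 = y0 \<longleftrightarrow> j = k \<or> j = Suc k" if "j \<in> {1..n}" for j
    using strand_vertex(2)[OF pv that] by (simp add: k_def)
  let ?F' = "insert p F"
  obtain b1 where b1: "cut_at F (strand k) x0 b1"
    using cut_starts_at[OF F F' p p0 track_strand[OF F k(2)]] on_p[OF k(2)] by blast
  obtain b2 where b2: "cut_at F (strand (Suc k)) x0 b2"
    using cut_starts_at[OF F F' p p0 track_strand[OF F k(3)]] on_p[OF k(3)] by blast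
  obtain a1 where a1: "cut_at ?F' (strand k) a1 x0"
    using cut_ends_at[OF F F' p p0 track_strand[OF F k(2)]] on_p[OF k(2)] by blast
  obtain a2 where a2: "cut_at ?F' (strand (Suc k)) a2 x0"
    using cut_ends_at[OF F F' p p0 track_strand[OF F k(3)]] on_p[OF k(3)] by blast
  define L M L' M' where "L = line_at F k" and "M = line_at F (Suc k)"
    and "L' = line_at ?F' k" and "M' = line_at ?F' (Suc k)"
  note L = line_at_props[OF F k(2) b1, folded L_def] and M = line_at_props[OF F k(3) b2, folded M_def]
    and L' = line_at_props[OF F' k(2) a1, folded L'_def] and M' = line_at_props[OF F' k(3) a2, folded M'_def]
  have lt: "x0 < b1" "x0 < b2" "a1 < x0" "a2 < x0" using b1 b2 a1 a2 by (auto simp: cut_at_def)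
  have val: "fn L x0 = y0" "fn M x0 = y0" "fn L' x0 = y0" "fn M' x0 = y0"
    using L(2)[of x0] M(2)[of x0] L'(2)[of x0] M'(2)[of x0] lt on_p[OF k(2)] on_p[OF k(3)] by auto
  have mem: "mproj p \<in> L" "mproj p \<in> M" "mproj p \<in> L'" "mproj p \<in> M'"
    using val L(1) M(1) L'(1) M'(1) by (auto simp: p0 mem_line)
  have "L \<noteq> M" using line_at_inj[OF F] k unfolding L_def M_def by (metis inj_onD n_not_Suc_n)
  have "L' \<noteq> M'" using line_at_inj[OF F'] k unfolding L'_def M'_def by (metis inj_onD n_not_Suc_n)
  have pair: "L' = L \<and> M' = M \<or> L' = M \<and> M' = L"
    using same_pair[of L M L' M' "mproj p"] L(1) M(1) L'(1) M'(1) mem \<open>L \<noteq> M\<close> \<open>L' \<noteq> M'\<close> by blast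
  have right: "fn L t > fn M t" if "x0 < t" "t < min b1 b2" for t
  proof -
    have "fn M t \<le> fn L t" using strand_antimono[OF k(2), of t] k(3) L(2)[of t] M(2)[of t] that by auto
    moreover have "fn M t \<noteq> fn L t"
    proof
      assume "fn M t = fn L t"
      then have "(t, fn L t) \<in> vx" using L(1) M(1) \<open>L \<noteq> M\<close> in_vx by metis
      then show False using L(3) that by (auto simp: cut_at_def)
    qed
    ultimately show ?thesis by simp
  qed
  have left: "fn L' s > fn M' s" if "max a1 a2 < s" "s < x0" for s
  proof -
    have "fn M' s \<le> fn L' s" using strand_antimono[OF k(2), of s] k(3) L'(2)[of s] M'(2)[of s] that by auto
    moreover have "fn M' s \<noteq> fn L' s"
    proof
      assume "fn M' s = fn L' s"
      then have "(s, fn L' s) \<in> vx" using L'(1) M'(1) \<open>L' \<noteq> M'\<close> in_vx by metis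
      then show False using L'(3) that by (auto simp: cut_at_def)
    qed
    ultimately show ?thesis by simp
  qed
  have cr: "crossing_point L M (mproj p) \<longleftrightarrow> changes_sign (\<lambda>x. fn L x - fn M x) x0"
    using crossing_iff[OF L(1) M(1)] val by (simp add: p0)
  \<comment> \<open>Within this distance of \<open>x0\<close> all four cut edges at \<open>p\<close>
    are still present, so \<open>right\<close> and \<open>left\<close> both apply.\<close>
  define \<epsilon> where "\<epsilon> = min (min b1 b2 - x0) (x0 - max a1 a2)"
  have \<epsilon>: "\<epsilon> > 0" using lt by (simp add: \<epsilon>_def)
  have \<epsilon>_le: "x0 + \<epsilon> \<le> min b1 b2" "max a1 a2 \<le> x0 - \<epsilon>" unfolding \<epsilon>_def by linarith+
  have swap: "L' = M \<and> M' = L" if "crossing_point L M (mproj p)"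
  proof (rule ccontr)
    assume "\<not> (L' = M \<and> M' = L)"
    then have same: "L' = L" "M' = M" using pair by auto
    obtain \<delta> where \<delta>: "\<delta> > 0" "\<forall>s\<in>{x0 - \<delta><..<x0}. \<forall>t\<in>{x0<..<x0 + \<delta>}. (fn L s - fn M s) * (fn L t - fn M t) < 0"
      using \<open>crossing_point L M (mproj p)\<close> cr unfolding changes_sign_def by blast
    define r where "r = min \<epsilon> \<delta> / 2"
    have r: "r > 0" "r < \<epsilon>" "r < \<delta>" using \<epsilon> \<delta>(1) by (auto simp: r_def min_def)
    have "(fn L (x0 - r) - fn M (x0 - r)) * (fn L (x0 + r) - fn M (x0 + r)) < 0" using \<delta>(2) r by auto
    moreover have "fn L' (x0 - r) > fn M' (x0 - r)" using r \<epsilon>_le by (intro left) linarith+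
    then have "fn L (x0 - r) > fn M (x0 - r)" using same by simp
    moreover have "fn L (x0 + r) > fn M (x0 + r)" using r \<epsilon>_le by (intro right) linarith+
    ultimately show False by (simp add: mult_less_0_iff)
  qed
  have stay: "L' = L \<and> M' = M" if "\<not> crossing_point L M (mproj p)"
  proof (rule ccontr)
    assume "\<not> (L' = L \<and> M' = M)"
    then have same: "L' = M" "M' = L" using pair by auto
    have "(fn L s - fn M s) * (fn L t - fn M t) < 0" if "s \<in> {x0 - \<epsilon><..<x0}" "t \<in> {x0<..<x0 + \<epsilon>}" for s t
    proof -
      have "s > x0 - \<epsilon>" "s < x0" "x0 < t" "t < x0 + \<epsilon>" using that by auto
      then have "fn L' s > fn M' s" "fn L t > fn M t"
        using \<epsilon>_le by (intro left right; linarith)+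
      then have "fn M s > fn L s" "fn L t > fn M t" using same by simp_all
      then show ?thesis by (simp add: mult_neg_pos)
    qed
    then have "changes_sign (\<lambda>x. fn L x - fn M x) x0" using \<epsilon> unfolding changes_sign_def by blast
    then show False using \<open>\<not> crossing_point L M (mproj p)\<close> cr by blast
  qed
  have other: "line_at ?F' j = line_at F j" if j: "j \<in> {1..n}" "j \<noteq> k" "j \<noteq> Suc k" for j
  proof -
    obtain a b where ab: "cut_at F (strand j) a b" using cut_at_strand[OF F j(1)] .
    have "strand j x0 \<noteq> y0" using on_p j by blast
    then have "(a, strand j a) \<noteq> p" using p0 by auto
    then have "cut_at ?F' (strand j) a b" using ab by (auto simp: cut_at_def)
    then show ?thesis using cut_edge_eq[OF F j(1) ab] cut_edge_eq[OF F' j(1)] by (simp add: line_at_def)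
  qed
  have ends: "endpoint S (cut_edge S F j) p \<longleftrightarrow> j = k \<or> j = Suc k" if j: "j \<in> {1..n}" for j
  proof
    assume e: "endpoint S (cut_edge S F j) p"
    obtain a b where ab: "cut_at F (strand j) a b" using cut_at_strand[OF F j] .
    have "p \<in> cut_edge S F j" using e unfolding endpoint_def edge_def by blast
    then have "strand j x0 = y0" unfolding cut_edge_eq[OF F j ab] p0 by (simp add: mem_arc)
    then show "j = k \<or> j = Suc k" using on_p[OF j] by blast
  next
    assume jk: "j = k \<or> j = Suc k"
    then obtain b where b: "cut_at F (strand j) x0 b" using b1 b2 by blast
    have "edge S (cut_edge S F j) (x0, strand j x0) (b, strand j b)"
      using cut_at_edge(1)[OF F track_strand[OF F j] b] cut_edge_eq[OF F j b] by simp
    moreover have "(x0, strand j x0) = p" using on_p[OF j] jk p0 by simp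
    ultimately show "endpoint S (cut_edge S F j) p" unfolding endpoint_def by metis
  qed
  show thesis
    using that[of k] k(1) ends mem(1,2) other swap stay unfolding L_def M_def L'_def M'_def by blast
qed

end

subsection \<open>Sweeps\<close>

text \<open>Points of \<open>V\<close> are exempt because flipping one of them leads out of the
  restricted graph.\<close>

definition contacts_precede_crossings ::
    "moebius set \<Rightarrow> (real \<times> real) set \<Rightarrow> moebius set \<Rightarrow> moebius set set \<Rightarrow> bool" where
  "contacts_precede_crossings S F V \<Lambda> \<longleftrightarrow>
     (\<forall>L\<in>\<Lambda>. \<forall>M\<in>\<Lambda>. \<forall>w u. L \<noteq> M \<and> contact_point L M w \<and> crossing_point L M u \<and> w \<notin> V \<longrightarrow>
        cut_less S F w u)"

locale sweeping = arr +
  fixes F :: "(real \<times> real) set" and m :: nat and Fs :: "nat \<Rightarrow> (real \<times> real) set"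
  assumes cut_filter: "cut_filter S F" and sweep: "sweep S F m Fs"
begin

abbreviation "sig \<equiv> sigma S Fs \<Lambda>"
abbreviation "pv i \<equiv> swept_vertex Fs i"
abbreviation "sv i \<equiv> mproj (swept_vertex Fs i)"
abbreviation "swept_pos i \<equiv> sweep_position S Fs i"

lemma filters: "i \<le> m \<Longrightarrow> cut_filter S (Fs i)"
  using sweep by (simp add: sweep_def)

lemma Fs_ends: "Fs 0 = tau ` F" "Fs m = F"
  using sweep by (simp_all add: sweep_def)

lemma Fs_Suc: "i < m \<Longrightarrow> Fs (Suc i) = insert (pv i) (Fs i) \<and> pv i \<notin> Fs i"
proof -
  assume "i < m"
  then obtain u where u: "Fs i \<subset> Fs (Suc i)" "Fs (Suc i) - Fs i = {u}"
    using sweep by (auto simp: sweep_def)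
  then have "pv i = u" by (simp add: swept_vertex_def)
  then show ?thesis using u by blast
qed

lemma Fs_mono: "i \<le> j \<Longrightarrow> j \<le> m \<Longrightarrow> Fs i \<subseteq> Fs j"
proof (induction j rule: dec_induct)
  case (step j)
  then show ?case using Fs_Suc[of j] by auto
qed simp

lemma pv_in: "i < j \<Longrightarrow> j \<le> m \<Longrightarrow> pv i \<in> Fs j"
  using Fs_mono[of "Suc i" j] Fs_Suc[of i] by auto

lemma pv_notin: "j \<le> i \<Longrightarrow> i < m \<Longrightarrow> pv i \<notin> Fs j"
  using Fs_mono[of j i] Fs_Suc[of i] by auto

lemma pv_domain: "i < m \<Longrightarrow> pv i \<in> F - tau ` F"
  using pv_in[of i m] pv_notin[of 0 i] Fs_ends by auto

lemma pv_vx: "i < m \<Longrightarrow> pv i \<in> vx"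
  using pv_domain cut_filterD(1)[OF cut_filter] by blast

lemma ex_pv:
  assumes "u \<in> F - tau ` F" shows "\<exists>i<m. u = pv i"
proof -
  have "\<exists>i<j. u = pv i" if "j \<le> m" "u \<in> Fs j" for j
    using that
  proof (induction j)
    case 0
    then show ?case using assms Fs_ends by simp
  next
    case (Suc j)
    then show ?case using Fs_Suc[of j] by (metis Suc_le_lessD insertE less_Suc_eq less_or_eq_imp_le)
  qed
  then show ?thesis using assms Fs_ends by auto
qed

lemma lift_sv: "i < m \<Longrightarrow> filter_lift F (sv i) = pv i"
  using filter_lift_eq[OF cut_filter pv_domain] .

lemma sv_inj: "i < m \<Longrightarrow> j < m \<Longrightarrow> sv i = sv j \<Longrightarrow> i = j"
  using lift_sv pv_in[of i j] pv_in[of j i] pv_notin[of j j] pv_notin[of i i]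
  by (metis linorder_neqE_nat order_refl less_imp_le)

lemma ex_sv:
  assumes "v \<in> vertices S" shows "\<exists>i<m. v = sv i"
  using ex_pv[OF filter_lift(1)[OF cut_filter assms]] filter_lift(2)[OF cut_filter assms] by metis

text \<open>Carries \<open>sweep_step\<close> over to the sweep: the position found there is the one
  selected by \<open>sweep_position\<close>, and the test for a crossing is put in terms of the
  point alone.\<close>

lemma step:
  assumes "i < m"
  shows "swept_pos i \<in> {1..<n}"
    "sv i \<in> line_at (Fs i) (swept_pos i)" "sv i \<in> line_at (Fs i) (Suc (swept_pos i))"
    "\<And>j. j \<in> {1..n} \<Longrightarrow> j \<noteq> swept_pos i \<Longrightarrow> j \<noteq> Suc (swept_pos i) \<Longrightarrow> line_at (Fs (Suc i)) j = line_at (Fs i) j"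
    "sv i \<in> crossings \<Lambda> \<Longrightarrow> line_at (Fs (Suc i)) (swept_pos i) = line_at (Fs i) (Suc (swept_pos i)) \<and>
       line_at (Fs (Suc i)) (Suc (swept_pos i)) = line_at (Fs i) (swept_pos i)"
    "sv i \<notin> crossings \<Lambda> \<Longrightarrow> line_at (Fs (Suc i)) (swept_pos i) = line_at (Fs i) (swept_pos i) \<and>
       line_at (Fs (Suc i)) (Suc (swept_pos i)) = line_at (Fs i) (Suc (swept_pos i))"
    "line_at (Fs i) (swept_pos i) \<noteq> line_at (Fs i) (Suc (swept_pos i))"
proof -
  have eq: "Fs (Suc i) = insert (pv i) (Fs i)" "pv i \<notin> Fs i" using Fs_Suc assms by auto
  have Fi: "cut_filter S (Fs i)" "cut_filter S (insert (pv i) (Fs i))"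
    using filters[of i] filters[of "Suc i"] assms eq by auto
  obtain k where k: "k \<in> {1..<n}"
    "\<And>j. j \<in> {1..n} \<Longrightarrow> endpoint S (cut_edge S (Fs i) j) (pv i) \<longleftrightarrow> j = k \<or> j = Suc k"
    "sv i \<in> line_at (Fs i) k" "sv i \<in> line_at (Fs i) (Suc k)"
    "\<And>j. j \<in> {1..n} \<Longrightarrow> j \<noteq> k \<Longrightarrow> j \<noteq> Suc k \<Longrightarrow> line_at (insert (pv i) (Fs i)) j = line_at (Fs i) j"
    "crossing_point (line_at (Fs i) k) (line_at (Fs i) (Suc k)) (sv i) \<Longrightarrow>
       line_at (insert (pv i) (Fs i)) k = line_at (Fs i) (Suc k) \<and> line_at (insert (pv i) (Fs i)) (Suc k) = line_at (Fs i) k"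
    "\<not> crossing_point (line_at (Fs i) k) (line_at (Fs i) (Suc k)) (sv i) \<Longrightarrow>
       line_at (insert (pv i) (Fs i)) k = line_at (Fs i) k \<and> line_at (insert (pv i) (Fs i)) (Suc k) = line_at (Fs i) (Suc k)"
    using sweep_step[OF Fi eq(2)] by blast
  have pk: "swept_pos i = k"
    unfolding sweep_position_def card_cut_edges[OF Fi(1)]
  proof (rule the_equality)
    show "k \<in> {1..<n} \<and> endpoint S (cut_edge S (Fs i) k) (pv i) \<and>
        endpoint S (cut_edge S (Fs i) (k + 1)) (pv i)"
      using k(1) k(2)[of k] k(2)[of "k + 1"] by auto
    fix j assume "j \<in> {1..<n} \<and> endpoint S (cut_edge S (Fs i) j) (pv i) \<and>
        endpoint S (cut_edge S (Fs i) (j + 1)) (pv i)"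
    then show "j = k" using k(2)[of j] k(2)[of "j + 1"] by auto
  qed
  have kn: "k \<in> {1..n}" "Suc k \<in> {1..n}" using k(1) by auto
  show ne: "line_at (Fs i) (swept_pos i) \<noteq> line_at (Fs i) (Suc (swept_pos i))"
    using line_at_inj[OF Fi(1)] kn unfolding pk by (metis inj_onD n_not_Suc_n)
  have "sv i \<in> crossings \<Lambda> \<longleftrightarrow> crossing_point (line_at (Fs i) k) (line_at (Fs i) (Suc k)) (sv i)"
    using in_crossings_iff[OF line_at_in[OF Fi(1) kn(1)] line_at_in[OF Fi(1) kn(2)]] k(3,4) ne pk by blast
  then show "swept_pos i \<in> {1..<n}"
    "sv i \<in> line_at (Fs i) (swept_pos i)" "sv i \<in> line_at (Fs i) (Suc (swept_pos i))"
    "\<And>j. j \<in> {1..n} \<Longrightarrow> j \<noteq> swept_pos i \<Longrightarrow> j \<noteq> Suc (swept_pos i) \<Longrightarrow> line_at (Fs (Suc i)) j = line_at (Fs i) j"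
    "sv i \<in> crossings \<Lambda> \<Longrightarrow> line_at (Fs (Suc i)) (swept_pos i) = line_at (Fs i) (Suc (swept_pos i)) \<and>
       line_at (Fs (Suc i)) (Suc (swept_pos i)) = line_at (Fs i) (swept_pos i)"
    "sv i \<notin> crossings \<Lambda> \<Longrightarrow> line_at (Fs (Suc i)) (swept_pos i) = line_at (Fs i) (swept_pos i) \<and>
       line_at (Fs (Suc i)) (Suc (swept_pos i)) = line_at (Fs i) (Suc (swept_pos i))"
    using k unfolding pk eq(1) by blast+
qed

lemma swept_pos_range: "i < m \<Longrightarrow> swept_pos i \<in> {1..n} \<and> Suc (swept_pos i) \<in> {1..n}"
  using step(1) by fastforce

section \<open>Positions of the lines along the sweep\<close>

definition pos :: "nat \<Rightarrow> moebius set \<Rightarrow> nat" where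
  "pos i L = inv_into {1..n} (line_at (Fs i)) L"

lemma pos_line_at: "i \<le> m \<Longrightarrow> j \<in> {1..n} \<Longrightarrow> pos i (line_at (Fs i) j) = j"
  unfolding pos_def using line_at_inj[OF filters] by (intro inv_into_f_f)

lemma pos_in:
  assumes "i \<le> m" "L \<in> \<Lambda>" shows "pos i L \<in> {1..n}" "line_at (Fs i) (pos i L) = L"
proof -
  have "L \<in> line_at (Fs i) ` {1..n}" using line_at_bij[OF filters[OF assms(1)]] assms(2) by (simp add: bij_betw_def)
  then show "pos i L \<in> {1..n}" "line_at (Fs i) (pos i L) = L"
    unfolding pos_def by (rule inv_into_into, rule f_inv_into_f)
qed

lemma pos_neq: "i \<le> m \<Longrightarrow> L \<in> \<Lambda> \<Longrightarrow> M \<in> \<Lambda> \<Longrightarrow> L \<noteq> M \<Longrightarrow> pos i L \<noteq> pos i M"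
  using pos_in(2) by metis

lemma pos_Suc:
  assumes "i < m" "L \<in> \<Lambda>"
  shows "pos (Suc i) L = (if sv i \<in> crossings \<Lambda> then
       (if pos i L = swept_pos i then Suc (swept_pos i) else if pos i L = Suc (swept_pos i) then swept_pos i else pos i L)
     else pos i L)" (is "_ = ?j")
proof -
  define j where "j = ?j"
  have L: "pos i L \<in> {1..n}" "line_at (Fs i) (pos i L) = L" using pos_in assms by auto
  have j: "j \<in> {1..n}" unfolding j_def using L(1) swept_pos_range[OF assms(1)] by simp
  have "line_at (Fs (Suc i)) j = L"
  proof (cases "pos i L = swept_pos i \<or> pos i L = Suc (swept_pos i)")
    case True
    then consider "pos i L = swept_pos i" | "pos i L = Suc (swept_pos i)" by blast
    then show ?thesis
    proof cases
      case 1
      then show ?thesis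
        using step(5,6)[OF assms(1)] L(2) by (cases "sv i \<in> crossings \<Lambda>") (simp_all add: j_def)
    next
      case 2
      then show ?thesis
        using step(5,6)[OF assms(1)] L(2) by (cases "sv i \<in> crossings \<Lambda>") (simp_all add: j_def)
    qed
  next
    case False
    then have "j = pos i L" unfolding j_def by simp
    then show ?thesis using step(4)[OF assms(1) L(1)] False L(2) by simp
  qed
  then have "pos (Suc i) L = j" using pos_line_at[OF _ j, of "Suc i"] assms(1) by simp
  then show ?thesis unfolding j_def .
qed

lemma swept_pair:
  assumes "i < m" "a \<in> \<Lambda>" "b \<in> \<Lambda>" "a \<noteq> b" "sv i \<in> a" "sv i \<in> b"
  shows "a = line_at (Fs i) (swept_pos i) \<and> b = line_at (Fs i) (Suc (swept_pos i)) \<or>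
    a = line_at (Fs i) (Suc (swept_pos i)) \<and> b = line_at (Fs i) (swept_pos i)"
proof -
  have "line_at (Fs i) (swept_pos i) \<in> \<Lambda>" "line_at (Fs i) (Suc (swept_pos i)) \<in> \<Lambda>"
    using line_at_in[OF filters] swept_pos_range[OF assms(1)] assms(1) by simp_all
  then show ?thesis
    by (rule same_pair[OF _ _ step(7)[OF assms(1)] assms(2-4) step(2,3)[OF assms(1)] assms(5,6)])
qed

text \<open>The order of two lines changes only when they hold the swept places at a crossing, hence
  at their own crossing point, and this is swept at most once.\<close>

lemma order_iff:
  assumes "a \<in> \<Lambda>" "b \<in> \<Lambda>" "a \<noteq> b" "i \<le> m"
  shows "pos i a < pos i b \<longleftrightarrow> ((pos 0 a < pos 0 b) \<noteq> (\<exists>c<i. crossing_point a b (sv c)))"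
  using assms(4)
proof (induction i)
  case (Suc i)
  then have i: "i < m" by simp
  let ?k = "swept_pos i"
  have ne: "pos i a \<noteq> pos i b" using pos_neq i assms by simp
  have kr: "?k \<in> {1..n}" "Suc ?k \<in> {1..n}" using swept_pos_range[OF i] by auto
  show ?case
  proof (cases "crossing_point a b (sv i)")
    case True
    then have mem: "sv i \<in> a" "sv i \<in> b" using crossing_mem assms by blast+
    have "sv i \<in> crossings \<Lambda>" using True in_crossings_iff assms mem by blast
    moreover have "pos i a = ?k \<and> pos i b = Suc ?k \<or> pos i a = Suc ?k \<and> pos i b = ?k"
      using swept_pair[OF i assms(1-3) mem] pos_line_at[OF _ kr(1), of i] pos_line_at[OF _ kr(2), of i] i by auto
    ultimately have "pos (Suc i) a < pos (Suc i) b \<longleftrightarrow> \<not> pos i a < pos i b"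
      using pos_Suc[OF i assms(1)] pos_Suc[OF i assms(2)] by auto
    moreover have "\<not> crossing_point a b (sv c)" if "c < i" for c
      using True ex1_crossing[OF assms(1-3)] sv_inj[of c i] that i by (metis less_trans less_irrefl)
    then have "(\<exists>c<Suc i. crossing_point a b (sv c))" "\<not> (\<exists>c<i. crossing_point a b (sv c))"
      using True by auto
    ultimately show ?thesis using Suc.IH i by auto
  next
    case False
    then have ev: "(\<exists>c<Suc i. crossing_point a b (sv c)) \<longleftrightarrow> (\<exists>c<i. crossing_point a b (sv c))"
      using less_Suc_eq by auto
    have "pos (Suc i) a < pos (Suc i) b \<longleftrightarrow> pos i a < pos i b"
    proof (cases "sv i \<in> crossings \<Lambda>")
      case True
      \<comment> \<open>At a crossing of another pair at most one of \<open>a\<close> and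
        \<open>b\<close> moves, and only into a neighbouring place that the other does not hold, so
        their order stays.\<close>
      have "\<not> (pos i a \<in> {?k, Suc ?k} \<and> pos i b \<in> {?k, Suc ?k})"
      proof
        assume *: "pos i a \<in> {?k, Suc ?k} \<and> pos i b \<in> {?k, Suc ?k}"
        have "a \<in> {line_at (Fs i) ?k, line_at (Fs i) (Suc ?k)}" "b \<in> {line_at (Fs i) ?k, line_at (Fs i) (Suc ?k)}"
          using * pos_in(2)[of i a] pos_in(2)[of i b] assms i by auto
        then have "sv i \<in> a" "sv i \<in> b" using step(2,3)[OF i] by auto
        then show False using False True in_crossings_iff assms by blast
      qed
      then show ?thesis using pos_Suc[OF i assms(1)] pos_Suc[OF i assms(2)] True ne by auto
    next
      case False
      then show ?thesis using pos_Suc[OF i assms(1)] pos_Suc[OF i assms(2)] by simp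
    qed
    then show ?thesis using Suc.IH i ev by auto
  qed
qed simp

section \<open>The lists of indices\<close>

definition idx :: "moebius set \<Rightarrow> nat" where
  "idx L = n + 1 - pos 0 L"

lemma line_index_eq:
  assumes "L \<in> \<Lambda>" shows "line_index S (Fs 0) \<Lambda> L = idx L"
  unfolding line_index_def line_at_def[symmetric]
proof (rule the_equality)
  have p: "pos 0 L \<in> {1..n}" "line_at (Fs 0) (pos 0 L) = L" using pos_in assms by auto
  then show "idx L \<in> {1..n} \<and> line_at (Fs 0) (n + 1 - idx L) = L" by (auto simp: idx_def)
  fix k assume k: "k \<in> {1..n} \<and> line_at (Fs 0) (n + 1 - k) = L"
  then have "n + 1 - k \<in> {1..n}" by auto
  then have "pos 0 L = n + 1 - k" using pos_line_at[of 0 "n + 1 - k"] k by simp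
  then show "k = idx L" using k by (auto simp: idx_def)
qed

text \<open>The initial list reads from \<open>n\<close> down to 1, so an index and the initial
  position add up to \<open>n + 1\<close> and their orders are opposite.\<close>

lemma idx_less_iff: "L \<in> \<Lambda> \<Longrightarrow> M \<in> \<Lambda> \<Longrightarrow> idx L < idx M \<longleftrightarrow> pos 0 M < pos 0 L"
  using pos_in(1)[of 0 L] pos_in(1)[of 0 M] by (auto simp: idx_def)

lemma idx_inj: "L \<in> \<Lambda> \<Longrightarrow> M \<in> \<Lambda> \<Longrightarrow> idx L = idx M \<Longrightarrow> L = M"
  using idx_less_iff[of L M] idx_less_iff[of M L] pos_neq[of 0 L M] by force

lemma length_sigma [simp]: "length (sig i) = n"
  by (simp add: sigma_def)

lemma sigma_nth:
  assumes "i \<le> m" "j < n" shows "sig i ! j = idx (line_at (Fs i) (Suc j))"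
proof -
  have "line_at (Fs i) (Suc j) \<in> \<Lambda>" using line_at_in[OF filters[OF assms(1)]] assms(2) by simp
  then have "line_index S (Fs 0) \<Lambda> (line_at (Fs i) (Suc j)) = idx (line_at (Fs i) (Suc j))" by (rule line_index_eq)
  moreover have "[1..<n + 1] ! j = Suc j" using assms(2) by (subst nth_upt) auto
  ultimately show ?thesis
    unfolding sigma_def line_at_def[symmetric] using assms(2) by (subst nth_map) auto
qed

lemma sigma_0: "sig 0 = map (\<lambda>j. n - j) [0..<n]"
proof (rule nth_equalityI)
  fix j assume "j < length (sig 0)"
  then have j: "j < n" by simp
  then have "idx (line_at (Fs 0) (Suc j)) = n - j" using pos_line_at[of 0 "Suc j"] by (simp add: idx_def)
  then show "sig 0 ! j = map (\<lambda>j. n - j) [0..<n] ! j" using sigma_nth[of 0 j] j by simp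
qed simp

lemma sigma_Suc:
  assumes "i < m"
  shows "sig (Suc i) = (if sv i \<in> crossings \<Lambda>
     then (sig i)[swept_pos i - 1 := sig i ! swept_pos i, swept_pos i := sig i ! (swept_pos i - 1)]
     else sig i)" (is "_ = ?r")
proof (rule nth_equalityI)
  show "length (sig (Suc i)) = length ?r" by simp
  fix j assume "j < length (sig (Suc i))"
  then have j: "j < n" by simp
  \<comment> \<open>Positions count from 1 and list entries from 0, so the swept entries are those
    at \<open>k\<close> and \<open>Suc k\<close>.\<close>
  obtain k where k: "swept_pos i = Suc k" "Suc k < n" using step(1)[OF assms] by (cases "swept_pos i") auto
  have nth: "sig (Suc i) ! j = idx (line_at (Fs (Suc i)) (Suc j))"
    "sig i ! j = idx (line_at (Fs i) (Suc j))"
    "sig i ! k = idx (line_at (Fs i) (Suc k))"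
    "sig i ! (Suc k) = idx (line_at (Fs i) (Suc (Suc k)))"
    using sigma_nth assms j k by auto
  show "sig (Suc i) ! j = ?r ! j"
  proof (cases "j = k \<or> j = Suc k")
    case True
    then show ?thesis using nth step(5,6)[OF assms] k by (auto simp: nth_list_update)
  next
    case False
    then have "line_at (Fs (Suc i)) (Suc j) = line_at (Fs i) (Suc j)" using step(4)[OF assms, of "Suc j"] k j by auto
    then show ?thesis using nth False k by (auto simp: nth_list_update)
  qed
qed

lemma swept_entries:
  assumes "i < m"
  shows "sig i ! (swept_pos i - 1) = idx (line_at (Fs i) (swept_pos i))"
    "sig i ! swept_pos i = idx (line_at (Fs i) (Suc (swept_pos i)))"
    "idx (line_at (Fs i) (swept_pos i)) \<noteq> idx (line_at (Fs i) (Suc (swept_pos i)))"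
proof -
  have k: "swept_pos i \<in> {1..<n}" using step(1)[OF assms] .
  then show "sig i ! (swept_pos i - 1) = idx (line_at (Fs i) (swept_pos i))"
    "sig i ! swept_pos i = idx (line_at (Fs i) (Suc (swept_pos i)))"
    using sigma_nth[of i "swept_pos i - 1"] sigma_nth[of i "swept_pos i"] assms by auto
  show "idx (line_at (Fs i) (swept_pos i)) \<noteq> idx (line_at (Fs i) (Suc (swept_pos i)))"
    using idx_inj line_at_in[OF filters] swept_pos_range[OF assms] step(7)[OF assms] assms by (metis less_imp_le)
qed

text \<open>The two swept entries belong to different lines and hence differ, so an exchange is
  visible in the list.\<close>

lemma sigma_unchanged_iff:
  assumes "i < m" shows "sig (Suc i) = sig i \<longleftrightarrow> sv i \<notin> crossings \<Lambda>"
proof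
  assume eq: "sig (Suc i) = sig i"
  show "sv i \<notin> crossings \<Lambda>"
  proof
    assume cr: "sv i \<in> crossings \<Lambda>"
    have k: "swept_pos i \<in> {1..<n}" using step(1)[OF assms] .
    have "sig (Suc i) ! swept_pos i = sig i ! (swept_pos i - 1)"
      using sigma_Suc[OF assms] cr k by simp
    then show False using eq swept_entries[OF assms] by simp
  qed
qed (use sigma_Suc[OF assms] in simp)

text \<open>A crossing swaps the two entries; they were still in the initial, decreasing order
  because the lines cross only once, so the swap sorts them. A contact leaves the list alone, which
  is a sorting step only if the entries increase already, that is, if the lines have crossed
  before.\<close>

lemma sigma_sorted_iff:
  assumes "i < m"
  shows "sig (Suc i) = sort_entries (swept_pos i) (sig i) \<longleftrightarrow>
    sv i \<in> crossings \<Lambda> \<or> (\<exists>c<i. crossing_point (line_at (Fs i) (swept_pos i)) (line_at (Fs i) (Suc (swept_pos i))) (sv c))"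
proof -
  define L where "L = line_at (Fs i) (swept_pos i)"
  define M where "M = line_at (Fs i) (Suc (swept_pos i))"
  have k: "swept_pos i \<in> {1..<n}" "swept_pos i \<in> {1..n}" "Suc (swept_pos i) \<in> {1..n}"
    using step(1)[OF assms] swept_pos_range[OF assms] by auto
  have LM: "L \<in> \<Lambda>" "M \<in> \<Lambda>" "L \<noteq> M"
    using line_at_in[OF filters] k step(7)[OF assms] assms by (auto simp: L_def M_def)
  note e = swept_entries[OF assms, folded L_def M_def]
  have "pos i L < pos i M" using pos_line_at[OF _ k(2), of i] pos_line_at[OF _ k(3), of i] assms by (simp add: L_def M_def)
  then have ord: "pos 0 L < pos 0 M \<longleftrightarrow> \<not> (\<exists>c<i. crossing_point L M (sv c))"
    using order_iff[OF LM, of i] assms by auto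
  show ?thesis
  proof (cases "sv i \<in> crossings \<Lambda>")
    case True
    then have "crossing_point L M (sv i)"
      using in_crossings_iff[OF LM] step(2,3)[OF assms] by (simp add: L_def M_def)
    then have "\<not> (\<exists>c<i. crossing_point L M (sv c))"
      using ex1_crossing[OF LM] sv_inj[of _ i] assms by (metis less_trans less_irrefl)
    then have "idx M < idx L" using ord idx_less_iff[OF LM(2,1)] by blast
    then have "sig (Suc i) = sort_entries (swept_pos i) (sig i)"
      unfolding sigma_Suc[OF assms] sort_entries_def e(1,2) using True by (simp del: One_nat_def)
    then show ?thesis using True by simp
  next
    case False
    have "sig i = sort_entries (swept_pos i) (sig i) \<longleftrightarrow> idx L < idx M"
    proof
      assume "idx L < idx M"
      then have "min (sig i ! (swept_pos i - 1)) (sig i ! swept_pos i) = sig i ! (swept_pos i - 1)"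
        "max (sig i ! (swept_pos i - 1)) (sig i ! swept_pos i) = sig i ! swept_pos i"
        unfolding e(1,2) by simp_all
      then show "sig i = sort_entries (swept_pos i) (sig i)"
        unfolding sort_entries_def by simp
    next
      assume *: "sig i = sort_entries (swept_pos i) (sig i)"
      have "sort_entries (swept_pos i) (sig i) ! swept_pos i = max (idx L) (idx M)"
        unfolding sort_entries_def e(1,2) using k by simp
      then have "max (idx L) (idx M) = idx M" using * e(2) by simp
      then show "idx L < idx M" using e(3) by simp
    qed
    moreover have "sig (Suc i) = sig i" using sigma_Suc[OF assms] False by simp
    moreover have "idx L < idx M \<longleftrightarrow> (\<exists>c<i. crossing_point L M (sv c))"
      using ord idx_less_iff[OF LM(1,2)] pos_neq[OF _ LM, of 0] by auto
    ultimately show ?thesis using False by (simp add: L_def M_def)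
  qed
qed

text \<open>Each filter of the sweep is upward closed, so a vertex above a swept one has itself been
  swept. Vertices on one line are comparable, which gives the converse.\<close>

lemma cut_less_iff_swept_later:
  assumes "L \<in> \<Lambda>" "i < m" "c < m" "sv i \<in> L" "sv c \<in> L"
  shows "cut_less S F (sv i) (sv c) \<longleftrightarrow> c < i"
proof -
  have down: "j < i" if "path_le S (pv i) (pv j)" "i \<noteq> j" "i < m" "j < m" for i j
  proof (rule ccontr)
    assume "\<not> j < i"
    then have "i < j" using that by simp
    have "pv j \<in> Fs (Suc i)"
      using cut_filterD(2)[OF filters[of "Suc i"] pv_in[of i "Suc i"] pv_vx[OF \<open>j < m\<close>]] that by simp
    then show False using pv_notin[of "Suc i" j] \<open>i < j\<close> that by simp
  qed
  have on: "pv j = (fst (pv j), fn L (fst (pv j)))" if "sv j \<in> L" for j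
    using that mem_line[OF assms(1)] by (metis prod.collapse)
  have cmp: "path_le S (pv i) (pv c) \<or> path_le S (pv c) (pv i)"
    using line_path_le[OF assms(1), of "fst (pv i)" "fst (pv c)"]
      line_path_le[OF assms(1), of "fst (pv c)" "fst (pv i)"] on[OF assms(4)] on[OF assms(5)]
      pv_vx[OF assms(2)] pv_vx[OF assms(3)] by (metis linear)
  have "cut_less S F (sv i) (sv c) \<longleftrightarrow> path_le S (pv i) (pv c) \<and> sv i \<noteq> sv c"
    by (simp add: cut_less_def cut_le_def lift_sv assms)
  also have "\<dots> \<longleftrightarrow> c < i"
    using down[of i c] down[of c i] cmp assms(2,3) sv_inj[of i c] by (metis less_asym less_irrefl)
  finally show ?thesis .
qed

text \<open>By \<open>sigma_sorted_iff\<close> a crossing outside \<open>V\<close> always obeys the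
  sorting rule. So outside \<open>V\<close> only contacts impose a condition: the crossing of the
  same pair must have been swept earlier, that is, lie higher in the order.\<close>

lemma greedy_iff:
  assumes V: "V \<subseteq> vertices S"
  shows "(\<forall>i<m. (sv i \<in> V \<longrightarrow> sig (Suc i) = sig i) \<and>
      (sv i \<notin> V \<longrightarrow> sig (Suc i) = sort_entries (swept_pos i) (sig i))) \<longleftrightarrow>
    V \<subseteq> contact_points \<Lambda> \<and> contacts_precede_crossings S F V \<Lambda>" (is "?l \<longleftrightarrow> ?r")
proof
  assume l: ?l
  have "V \<subseteq> contact_points \<Lambda>"
  proof
    fix v assume v: "v \<in> V"
    then obtain i where i: "i < m" "v = sv i" using ex_sv V by blast
    then have "v \<notin> crossings \<Lambda>" using l v sigma_unchanged_iff by blast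
    then show "v \<in> contact_points \<Lambda>" using contact_points_eq vertices_eq V v by blast
  qed
  moreover have "cut_less S F w u"
    if LM: "L \<in> \<Lambda>" "M \<in> \<Lambda>" "L \<noteq> M" and wu: "contact_point L M w" "crossing_point L M u" "w \<notin> V" for L M w u
  proof -
    have w: "w \<in> L" "w \<in> M" "\<not> crossing_point L M w" using wu(1) by (auto simp: contact_point_def)
    have u: "u \<in> L" "u \<in> M" using crossing_mem[OF LM(1,2) wu(2)] by auto
    have "w \<in> vertices S" using w LM unfolding vertices_eq intersection_points_def by blast
    then obtain i where i: "i < m" "w = sv i" using ex_sv by blast
    have "w \<notin> crossings \<Lambda>" using in_crossings_iff[OF LM w(1,2)] w(3) by blast
    then obtain c where c: "c < i" "crossing_point (line_at (Fs i) (swept_pos i)) (line_at (Fs i) (Suc (swept_pos i))) (sv c)"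
      using l i wu(3) sigma_sorted_iff by blast
    \<comment> \<open>The lines at the swept places are \<open>L\<close> and \<open>M\<close>, but
      in unknown order; hence the symmetry of crossings.\<close>
    have "crossing_point L M (sv c)"
      using swept_pair[OF i(1) LM] w i(2) c(2) crossing_sym[OF LM(1,2)] by metis
    then have "u = sv c" using ex1_crossing[OF LM] wu(2) by blast
    then show ?thesis using cut_less_iff_swept_later[OF LM(1) i(1), of c] c i w u by simp
  qed
  ultimately show ?r unfolding contacts_precede_crossings_def by blast
next
  assume r: ?r
  show ?l
  proof (intro allI impI conjI)
    fix i assume i: "i < m"
    show "sig (Suc i) = sig i" if "sv i \<in> V"
      using that r sigma_unchanged_iff[OF i] contact_points_eq by blast
    show "sig (Suc i) = sort_entries (swept_pos i) (sig i)" if nV: "sv i \<notin> V"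
    proof (cases "sv i \<in> crossings \<Lambda>")
      case True
      then show ?thesis using sigma_sorted_iff[OF i] by blast
    next
      case False
      define L where "L = line_at (Fs i) (swept_pos i)"
      define M where "M = line_at (Fs i) (Suc (swept_pos i))"
      have LM: "L \<in> \<Lambda>" "M \<in> \<Lambda>" "L \<noteq> M"
        using line_at_in[OF filters] swept_pos_range[OF i] step(7)[OF i] i by (auto simp: L_def M_def)
      have mem: "sv i \<in> L" "sv i \<in> M" using step(2,3)[OF i] by (auto simp: L_def M_def)
      have con: "contact_point L M (sv i)"
        using in_crossings_iff[OF LM mem] False mem by (simp add: contact_point_def)
      obtain u where u: "crossing_point L M u" using ex1_crossing[OF LM] by blast
      have um: "u \<in> L" "u \<in> M" using crossing_mem[OF LM(1,2) u] by auto
      then have "u \<in> vertices S" using LM unfolding vertices_eq intersection_points_def by blast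
      then obtain c where c: "c < m" "u = sv c" using ex_sv by blast
      have "cut_less S F (sv i) u" using r LM con u nV unfolding contacts_precede_crossings_def by blast
      then have "c < i" using cut_less_iff_swept_later[OF LM(1) i c(1) mem(1)] um c by simp
      then show ?thesis using sigma_sorted_iff[OF i] u c by (auto simp: L_def M_def)
    qed
  qed
qed

end

subsection \<open>The restricted flip graph\<close>

context arr
begin

section \<open>Existence of a sweep\<close>

lemma path_le_shift: "path_le S u v \<Longrightarrow> path_le S (shift k u) (shift k v)"
  unfolding path_le_def[of S u v]
proof (induction rule: rtrancl_induct)
  case (step v w)
  then obtain e where "edge S e v w" by blast
  then obtain L a b where L: "L \<in> \<Lambda>" "a < b" "v = (a, fn L a)" "w = (b, fn L b)" "v \<in> vx" "w \<in> vx"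
    using edge_lineE by metis
  have sh: "shift k v = (a + of_int k * pi, fn L (a + of_int k * pi))"
    "shift k w = (b + of_int k * pi, fn L (b + of_int k * pi))"
    using shift_graph[OF antiperiodic[OF L(1)]] L(3,4) by auto
  have "path_le S (shift k v) (shift k w)"
    using line_path_le[OF L(1), of "a + of_int k * pi" "b + of_int k * pi"] L sh shift_in_vx by (metis add_le_cancel_right less_imp_le)
  then show ?case using step.IH path_le_trans by blast
qed simp

lemma cut_filter_tau:
  assumes "cut_filter S F" shows "cut_filter S (tau ` F)"
  unfolding cut_filter_def
proof (intro conjI ballI impI)
  obtain w where w: "w \<in> vx" "w \<notin> F" using assms unfolding cut_filter_def by blast
  have "shift (- 1) (tau w) = w" by (simp add: tau_eq_shift shift_shift)
  then have "tau w \<notin> tau ` F" "tau w \<in> vx"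
    using w shift_in_vx in_tau_image by (auto simp: tau_eq_shift)
  moreover have "tau ` F \<subseteq> vx" using cut_filterD(1)[OF assms] shift_in_vx by (auto simp: tau_eq_shift)
  ultimately show "tau ` F \<subset> vx" by blast
  show "tau ` F \<noteq> {}" using assms by (simp add: cut_filter_def)
  fix u v assume "u \<in> tau ` F" "v \<in> vx" "path_le S u v"
  then show "v \<in> tau ` F"
    using cut_filterD(2)[OF assms, of "shift (- 1) u" "shift (- 1) v"] path_le_shift shift_in_vx
    unfolding in_tau_image by blast
qed

text \<open>A vertex of \<open>F\<close> outside \<open>G\<close> with smallest abscissa can be
  removed: paths increase the abscissa, so no other vertex of \<open>F\<close> outside
  \<open>G\<close> reaches it, and none of \<open>G\<close> does because \<open>G\<close> is a
  filter.\<close>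

lemma ex_filter_chain:
  assumes "cut_filter S G" "cut_filter S F" "G \<subseteq> F" "finite (F - G)"
  shows "\<exists>m Fs. Fs m = F \<and> Fs 0 = G \<and> (\<forall>i\<le>m. cut_filter S (Fs i)) \<and>
     (\<forall>i<m. Fs i \<subset> Fs (Suc i) \<and> (\<exists>u. Fs (Suc i) - Fs i = {u}))"
  using assms(2-4)
proof (induction "card (F - G)" arbitrary: F)
  case 0
  then have "F = G" by auto
  then show ?case using assms(1) by (intro exI[of _ 0] exI[of _ "\<lambda>_. G"]) auto
next
  case (Suc n)
  define x where "x = Min (fst ` (F - G))"
  have ne: "F - G \<noteq> {}" using Suc.hyps(2) by (metis card.empty nat.distinct(1))
  have "x \<in> fst ` (F - G)" unfolding x_def using Suc.prems(3) ne by (intro Min_in) auto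
  then obtain u where u: "u \<in> F - G" "fst u = x" by blast
  have min: "fst u \<le> fst w" if "w \<in> F - G" for w
    unfolding u(2) x_def using Suc.prems(3) that by (intro Min_le) auto
  have F': "cut_filter S (F - {u})"
    unfolding cut_filter_def
  proof (intro conjI ballI impI)
    show "F - {u} \<noteq> {}" using assms(1) u Suc.prems(2) unfolding cut_filter_def by blast
    show "F - {u} \<subset> vx" using Suc.prems(1) unfolding cut_filter_def by blast
    fix w z assume w: "w \<in> F - {u}" and z: "z \<in> vx" "path_le S w z"
    have "z \<in> F" using cut_filterD(2)[OF Suc.prems(1)] w z by blast
    moreover have "z \<noteq> u"
    proof
      assume "z = u"
      then have "fst w < fst u" using path_le_fst[OF z(2)] w by auto
      then have "w \<in> G" using min[of w] w by force
      then have "u \<in> G" using cut_filterD(2)[OF assms(1)] z \<open>z = u\<close> by blast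
      then show False using u by simp
    qed
    ultimately show "z \<in> F - {u}" by simp
  qed
  have "F - {u} - G = (F - G) - {u}" by auto
  then have "n = card (F - {u} - G)" using Suc.hyps(2) Suc.prems(3) u by simp
  then obtain m Fs where IH: "Fs m = F - {u}" "Fs 0 = G" "\<forall>i\<le>m. cut_filter S (Fs i)"
     "\<forall>i<m. Fs i \<subset> Fs (Suc i) \<and> (\<exists>u. Fs (Suc i) - Fs i = {u})"
  proof -
    have "G \<subseteq> F - {u}" "finite (F - {u} - G)" using Suc.prems(2,3) u by (auto intro: rev_finite_subset)
    then show thesis using Suc.hyps(1)[OF \<open>n = card (F - {u} - G)\<close> F'] that by blast
  qed
  \<comment> \<open>The removed vertex is put back by one further step at the end of the
    chain.\<close>
  define Fs' where "Fs' = Fs(Suc m := F)"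
  have "Fs' (Suc m) = F" "Fs' 0 = G" using IH by (auto simp: Fs'_def)
  moreover have "\<forall>i\<le>Suc m. cut_filter S (Fs' i)" using IH(3) Suc.prems(1) by (auto simp: Fs'_def le_Suc_eq)
  moreover have "\<forall>i<Suc m. Fs' i \<subset> Fs' (Suc i) \<and> (\<exists>u. Fs' (Suc i) - Fs' i = {u})"
  proof (intro allI impI)
    fix i assume "i < Suc m"
    then consider "i < m" | "i = m" by linarith
    then show "Fs' i \<subset> Fs' (Suc i) \<and> (\<exists>u. Fs' (Suc i) - Fs' i = {u})"
    proof cases
      case 1
      then show ?thesis using IH(4) by (simp add: Fs'_def)
    next
      case 2
      have "F - (F - {u}) = {u}" "F - {u} \<subset> F" using u by auto
      then show ?thesis using 2 IH(1) by (simp add: Fs'_def)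
    qed
  qed
  ultimately show ?case by blast
qed

text \<open>The uniqueness argument compares lists along some sweep, so one has to be
  provided.\<close>

lemma sweep_exists:
  assumes "cut_filter S F" obtains m Fs where "sweep S F m Fs"
proof -
  have "tau ` F \<subseteq> F" using filter_tau[OF assms] by blast
  from ex_filter_chain[OF cut_filter_tau[OF assms] assms this finite_fundamental_domain[OF assms]]
  obtain m Fs where "sweep S F m Fs" unfolding sweep_def by auto
  then show thesis by (rule that)
qed

text \<open>Both selected lifts lie on the same lifted line, along which any two vertices are joined
  by a path. So a contact that does not precede its crossing follows it.\<close>

lemma cut_less_total:
  assumes "cut_filter S F" "L \<in> \<Lambda>" "v \<in> L" "w \<in> L" "v \<in> vertices S" "w \<in> vertices S" "v \<noteq> w"
  shows "cut_less S F v w \<or> cut_less S F w v"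
proof -
  have "\<exists>x. filter_lift F p = (x, fn L x) \<and> (x, fn L x) \<in> vx" if "p \<in> L" "p \<in> vertices S" for p
    using filter_lift[OF assms(1) that(2)] that mem_line[OF assms(2)] cut_filterD(1)[OF assms(1)]
    by (metis DiffD1 prod.collapse subsetD)
  then obtain x y where "filter_lift F v = (x, fn L x)" "(x, fn L x) \<in> vx"
    "filter_lift F w = (y, fn L y)" "(y, fn L y) \<in> vx"
    using assms by metis
  then show ?thesis
    using line_path_le[OF assms(2), of x y] line_path_le[OF assms(2), of y x] assms(7)
    unfolding cut_less_def cut_le_def by (metis linear)
qed

lemma cut_less_lift:
  assumes "cut_filter S F" "v \<in> vertices S" "w \<in> vertices S" "cut_less S F v w"
  shows "fst (filter_lift F v) < fst (filter_lift F w)"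
proof -
  have "path_le S (filter_lift F v) (filter_lift F w)" "v \<noteq> w"
    using assms(4) by (simp_all add: cut_less_def cut_le_def)
  moreover have "filter_lift F v \<noteq> filter_lift F w"
    using filter_lift(2)[OF assms(1,2)] filter_lift(2)[OF assms(1,3)] \<open>v \<noteq> w\<close> by metis
  ultimately show ?thesis using path_le_fst by blast
qed

lemma contact_point_vertex: "L \<in> \<Lambda> \<Longrightarrow> M \<in> \<Lambda> \<Longrightarrow> L \<noteq> M \<Longrightarrow> p \<in> L \<Longrightarrow> p \<in> M \<Longrightarrow> p \<in> vertices S"
  unfolding vertices_eq intersection_points_def by blast

end

section \<open>Arcs and sources of the restricted flip graph\<close>

abbreviation "RG \<equiv> restricted_flip_graph"

lemma verts_restricted:
  "verts (RG S F V) = {\<Lambda> \<in> arrangements_on S. V \<subseteq> contact_points \<Lambda>}"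
  by (simp add: restricted_flip_graph_def induce_subgraph_def)

lemma arcs_restricted:
  "(\<Lambda>, \<Lambda>') \<in> arcs (RG S F V) \<longleftrightarrow>
     \<Lambda> \<in> verts (RG S F V) \<and> \<Lambda>' \<in> verts (RG S F V) \<and>
     (\<exists>v w. is_flip \<Lambda> v w \<Lambda>' \<and> cut_less S F v w)"
  unfolding verts_restricted
  by (simp add: restricted_flip_graph_def induce_subgraph_def flip_graph_def with_proj_def)
    (metis (no_types, lifting))

lemma arcs_ends_restricted:
  "arcs_ends (RG S F V) = arcs (RG S F V)"
  by (auto simp: arcs_ends_def arc_to_ends_def restricted_flip_graph_def induce_subgraph_def with_proj_def)

lemma source_restricted:
  "source (RG S F V) \<Lambda> \<longleftrightarrow> \<Lambda> \<in> verts (RG S F V) \<and>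
     (\<forall>\<Lambda>'. (\<Lambda>', \<Lambda>) \<notin> arcs (RG S F V))"
proof -
  have "head (RG S F V) = snd"
    by (simp add: restricted_flip_graph_def induce_subgraph_def with_proj_def)
  then show ?thesis unfolding source_def in_arcs_def by force
qed

lemma wf_digraph_restricted: "wf_digraph (RG S F V)"
  by unfold_locales (auto simp: restricted_flip_graph_def induce_subgraph_def with_proj_def)

lemma in_arrangements_on: "\<Lambda> \<in> arrangements_on S \<longleftrightarrow> arr \<Lambda> \<and> support \<Lambda> = S"
  by (simp add: arrangements_on_def arr_def)

lemma (in arr) is_flip_vertices:
  assumes "is_flip \<Lambda> v w \<Lambda>'"
  shows "v \<in> vertices S" "w \<in> vertices S" "v \<in> contact_points \<Lambda>" "w \<notin> contact_points \<Lambda>"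
proof -
  obtain L M where LM: "L \<in> \<Lambda>" "M \<in> \<Lambda>" "L \<noteq> M" "contact_point L M v" "crossing_point L M w"
    using assms unfolding is_flip_def by blast
  have v: "v \<in> L" "v \<in> M" "\<not> crossing_point L M v" using LM(4) by (auto simp: contact_point_def)
  have w: "w \<in> L" "w \<in> M" using crossing_mem LM by blast+
  show "v \<in> vertices S" "w \<in> vertices S" using contact_point_vertex[OF LM(1-3)] v w by blast+
  show "v \<in> contact_points \<Lambda>" "w \<notin> contact_points \<Lambda>"
    using in_contact_points_iff[OF LM(1-3)] v w LM(5) by blast+
qed

text \<open>If a contact \<open>w\<close> outside \<open>V\<close> does not precede its crossing
  \<open>u\<close>, flipping it gives an arrangement from which the increasing flip of
  \<open>u\<close> leads back, so there is an incoming arc. Conversely, undoing and redoing an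
  incoming arc exhibits a pair of lines of \<open>\<Lambda>\<close> whose contact follows its
  crossing.\<close>

lemma (in arr) source_iff:
  assumes F: "cut_filter S F"
  shows "source (RG S F V) \<Lambda> \<longleftrightarrow>
    V \<subseteq> contact_points \<Lambda> \<and> contacts_precede_crossings S F V \<Lambda>"
proof
  assume src: "source (RG S F V) \<Lambda>"
  then have V: "V \<subseteq> contact_points \<Lambda>" by (simp add: source_restricted verts_restricted)
  have "cut_less S F w u"
    if LM: "L \<in> \<Lambda>" "M \<in> \<Lambda>" "L \<noteq> M" "contact_point L M w" "crossing_point L M u" "w \<notin> V" for L M w u
  proof (rule ccontr)
    assume not_less: "\<not> cut_less S F w u"
    have w: "w \<in> L" "w \<in> M" "\<not> crossing_point L M w" using LM(4) by (auto simp: contact_point_def)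
    have u: "u \<in> L" "u \<in> M" using crossing_mem LM by blast+
    have "u \<noteq> w" using w(3) LM(5) by blast
    then have less: "cut_less S F u w"
      using cut_less_total[OF F LM(1) u(1) w(1)] contact_point_vertex[OF LM(1-3)] u w not_less by blast
    obtain \<Lambda>' L' M' where \<Lambda>': "arr \<Lambda>'" "support \<Lambda>' = S"
      "contact_points \<Lambda>' = (contact_points \<Lambda> - {w}) \<union> {u}"
      "L' \<in> \<Lambda>'" "M' \<in> \<Lambda>'" "L' \<noteq> M'" "contact_point L' M' u" "crossing_point L' M' w"
      using flip_exists[OF LM(1-5)] by metis
    have "w \<in> contact_points \<Lambda>" "u \<notin> contact_points \<Lambda>"
      using in_contact_points_iff[OF LM(1-3)] w u LM(5) by blast+
    then have "contact_points \<Lambda> = (contact_points \<Lambda>' - {u}) \<union> {w}"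
      using \<Lambda>'(3) \<open>u \<noteq> w\<close> by auto
    then have "is_flip \<Lambda>' u w \<Lambda>"
      unfolding is_flip_def using \<Lambda>' arrangement by blast
    moreover have "V \<subseteq> contact_points \<Lambda>'" using V LM(6) \<Lambda>'(3) by auto
    ultimately have "(\<Lambda>', \<Lambda>) \<in> arcs (RG S F V)"
      using V less \<Lambda>'(1,2) arr_axioms unfolding arcs_restricted verts_restricted in_arrangements_on by blast
    then show False using src source_restricted by blast
  qed
  then show "V \<subseteq> contact_points \<Lambda> \<and> contacts_precede_crossings S F V \<Lambda>"
    using V unfolding contacts_precede_crossings_def by blast
next
  assume r: "V \<subseteq> contact_points \<Lambda> \<and> contacts_precede_crossings S F V \<Lambda>"
  have "(\<Lambda>', \<Lambda>) \<notin> arcs (RG S F V)" for \<Lambda>'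
  proof
    assume "(\<Lambda>', \<Lambda>) \<in> arcs (RG S F V)"
    then obtain v w where arc: "arr \<Lambda>'" "support \<Lambda>' = S" "V \<subseteq> contact_points \<Lambda>'"
      "is_flip \<Lambda>' v w \<Lambda>" "cut_less S F v w"
      unfolding arcs_restricted verts_restricted in_arrangements_on by blast
    interpret B: arr \<Lambda>' by fact
    obtain L M where LM: "L \<in> \<Lambda>'" "M \<in> \<Lambda>'" "L \<noteq> M" "contact_point L M v" "crossing_point L M w"
      using arc(4) unfolding is_flip_def by blast
    obtain \<Lambda>'' L' M' where \<Lambda>'': "arr \<Lambda>''" "support \<Lambda>'' = support \<Lambda>'"
      "contact_points \<Lambda>'' = (contact_points \<Lambda>' - {v}) \<union> {w}"
      "L' \<in> \<Lambda>''" "M' \<in> \<Lambda>''" "L' \<noteq> M'" "contact_point L' M' w" "crossing_point L' M' v"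
      using B.flip_exists[OF LM] by metis
    \<comment> \<open>\<open>is_flip\<close> describes its result by contact sets only, so the
      constructed flip is identified with \<open>\<Lambda>\<close> through its contacts; this gives
      access to the new pair of lines.\<close>
    have "\<Lambda>'' = \<Lambda>"
    proof (rule arrangement_determined_by_contacts[OF \<Lambda>''(1) arr_axioms])
      show "support \<Lambda>'' = S" using \<Lambda>''(2) arc(2) by simp
      show "contact_points \<Lambda>'' = contact_points \<Lambda>" using \<Lambda>''(3) arc(4) unfolding is_flip_def by simp
    qed
    \<comment> \<open>Before the flip \<open>w\<close> was a crossing, so it is not among the
      contacts in \<open>V\<close>, and the condition on \<open>\<Lambda>\<close> applies to
      it.\<close>
    moreover have "w \<notin> V" using B.is_flip_vertices(4)[OF arc(4)] arc(3) by blast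
    ultimately have "cut_less S F w v"
      using r \<Lambda>'' unfolding contacts_precede_crossings_def by blast
    then show False
      using cut_less_lift[OF F _ _ arc(5)] cut_less_lift[OF F, of w v] B.is_flip_vertices(1,2)[OF arc(4)]
      by (simp add: arc(2))
  qed
  then show "source (RG S F V) \<Lambda>"
    using r arr_axioms by (simp add: source_restricted verts_restricted in_arrangements_on)
qed

lemma greedy_unique:
  assumes "arr \<Lambda>" "arr \<Lambda>'" "support \<Lambda>' = support \<Lambda>" "cut_filter (support \<Lambda>) F" "V \<subseteq> vertices (support \<Lambda>)"
    "V \<subseteq> contact_points \<Lambda>" "contacts_precede_crossings (support \<Lambda>) F V \<Lambda>"
    "V \<subseteq> contact_points \<Lambda>'" "contacts_precede_crossings (support \<Lambda>) F V \<Lambda>'"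
  shows "\<Lambda> = \<Lambda>'"
proof -
  interpret A: arr \<Lambda> by fact
  interpret B: arr \<Lambda>' by fact
  obtain m Fs where sw: "sweep (support \<Lambda>) F m Fs" using A.sweep_exists[OF assms(4)] .
  interpret A: sweeping \<Lambda> F m Fs using assms(4) sw by unfold_locales
  interpret B: sweeping \<Lambda>' F m Fs using assms(3,4) sw by unfold_locales simp_all
  let ?S = "support \<Lambda>"
  note gA = A.greedy_iff[OF assms(5), THEN iffD2, OF conjI, OF assms(6,7)]
  note gB = B.greedy_iff[unfolded assms(3), OF assms(5), THEN iffD2, OF conjI, OF assms(8,9)]
  \<comment> \<open>Both initial lists are decreasing from the number of lines, so this equality
    starts the induction.\<close>
  have n: "card \<Lambda> = card \<Lambda>'"
    using A.card_cut_edges[OF assms(4)] B.card_cut_edges[unfolded assms(3), OF assms(4)] by simp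
  have eq: "sigma ?S Fs \<Lambda> i = sigma ?S Fs \<Lambda>' i" if "i \<le> m" for i
    using that
  proof (induction i)
    case 0
    then show ?case using A.sigma_0 B.sigma_0[unfolded assms(3)] n by simp
  next
    case (Suc i)
    then show ?case using gA gB by (cases "mproj (swept_vertex Fs i) \<in> V") auto
  qed
  \<comment> \<open>Sweeping a vertex changes the list exactly if it is a crossing, so equal lists
    give equal sets of crossings.\<close>
  have "p \<in> crossings \<Lambda> \<longleftrightarrow> p \<in> crossings \<Lambda>'" if p: "p \<in> vertices ?S" for p
  proof -
    obtain i where i: "i < m" "p = mproj (swept_vertex Fs i)" using A.ex_sv[OF p] by blast
    then show ?thesis
      using A.sigma_unchanged_iff[OF i(1)] B.sigma_unchanged_iff[OF i(1), unfolded assms(3)]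
        eq[of i] eq[of "Suc i"] by auto
  qed
  then have "contact_points \<Lambda> = contact_points \<Lambda>'"
    unfolding A.contact_points_eq B.contact_points_eq
      A.vertices_eq[symmetric] B.vertices_eq[symmetric] assms(3) by blast
  then show ?thesis using arrangement_determined_by_contacts assms(1-3) by metis
qed

theorem theorem11:
  fixes \<Lambda>\<^sub>0 :: "moebius set set" and S V :: "moebius set"
    and F :: "(real \<times> real) set" and m :: nat
  assumes "arrangement \<Lambda>\<^sub>0" and "S = support \<Lambda>\<^sub>0" and "m = card (intersection_points \<Lambda>\<^sub>0)"
    and "cut_filter S F" and "V \<subseteq> vertices S"
  shows "verts (restricted_flip_graph S F V) = {} \<or>
    (acyclic (arcs_ends (restricted_flip_graph S F V)) \<and>
     Digraph_Component.connected (restricted_flip_graph S F V) \<and>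
     (\<exists>\<Gamma>. (\<forall>\<Lambda>. source (restricted_flip_graph S F V) \<Lambda> \<longleftrightarrow> \<Lambda> = \<Gamma>) \<and>
        (\<forall>Fs. sweep S F m Fs \<longrightarrow>
          (\<forall>\<Lambda>\<in>arrangements_on S. \<Lambda> = \<Gamma> \<longleftrightarrow>
            (\<forall>i<m.
              (mproj (swept_vertex Fs i) \<in> V \<longrightarrow>
                 sigma S Fs \<Lambda> (Suc i) = sigma S Fs \<Lambda> i) \<and>
              (mproj (swept_vertex Fs i) \<notin> V \<longrightarrow>
                 sigma S Fs \<Lambda> (Suc i) =
                   sort_entries (sweep_position S Fs i) (sigma S Fs \<Lambda> i)))))))"
proof (cases "verts (restricted_flip_graph S F V) = {}")
  case False
  define G where "G = restricted_flip_graph S F V"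
  interpret Z: arr \<Lambda>\<^sub>0 using assms(1) by unfold_locales
  have on_S: "arr \<Lambda>" "support \<Lambda> = S" if "\<Lambda> \<in> arrangements_on S" for \<Lambda>
    using that in_arrangements_on by blast+
  have verts_on: "\<Lambda> \<in> arrangements_on S" if "\<Lambda> \<in> verts G" for \<Lambda>
    using that by (simp add: G_def verts_restricted)
  have vert: "vertices S = intersection_points \<Lambda>" if "\<Lambda> \<in> arrangements_on S" for \<Lambda>
    using arr.vertices_eq on_S[OF that] by metis
  have fin_vert: "finite (vertices S)"
    using Z.finite_intersection_points Z.vertices_eq assms(2) by simp
  have con_vert: "contact_points \<Lambda> \<subseteq> vertices S" if "\<Lambda> \<in> arrangements_on S" for \<Lambda>
    using arr.contact_points_eq[OF on_S(1)[OF that]] vert[OF that] by blast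
  have src: "source G \<Lambda> \<longleftrightarrow> V \<subseteq> contact_points \<Lambda> \<and> contacts_precede_crossings S F V \<Lambda>"
    if "\<Lambda> \<in> arrangements_on S" for \<Lambda>
    using arr.source_iff[OF on_S(1)[OF that]] on_S(2)[OF that] assms(4) by (simp add: G_def)
  define height where "height \<Lambda> = (\<Sum>p\<in>contact_points \<Lambda>. fst (filter_lift F p))" for \<Lambda>
  have up: "height \<Lambda> < height \<Lambda>'" if "(\<Lambda>, \<Lambda>') \<in> arcs_ends G" for \<Lambda> \<Lambda>'
  proof -
    have "(\<Lambda>, \<Lambda>') \<in> arcs (restricted_flip_graph S F V)"
      using that unfolding G_def arcs_ends_restricted .
    then obtain v w where vw: "\<Lambda> \<in> arrangements_on S" "is_flip \<Lambda> v w \<Lambda>'" "cut_less S F v w"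
      unfolding arcs_restricted verts_restricted by blast
    interpret A: arr \<Lambda> using on_S vw by blast
    have S: "support \<Lambda> = S" using on_S vw by blast
    note vert = A.is_flip_vertices[OF vw(2), unfolded S]
    have less: "fst (filter_lift F v) < fst (filter_lift F w)"
      using A.cut_less_lift[unfolded S, OF assms(4) vert(1,2) vw(3)] .
    have fin: "finite (contact_points \<Lambda>)" using con_vert[OF vw(1)] fin_vert finite_subset by blast
    have "contact_points \<Lambda>' = insert w (contact_points \<Lambda> - {v})"
      using vw(2) unfolding is_flip_def by blast
    then have "height \<Lambda>' = fst (filter_lift F w) + (\<Sum>p\<in>contact_points \<Lambda> - {v}. fst (filter_lift F p))"
      using fin vert(4) by (simp add: height_def)
    moreover have "height \<Lambda> = fst (filter_lift F v) + (\<Sum>p\<in>contact_points \<Lambda> - {v}. fst (filter_lift F p))"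
      unfolding height_def using fin vert(3) by (rule sum.remove)
    ultimately show ?thesis using less by simp
  qed
  have "height \<Lambda> < height \<Lambda>'" if "(\<Lambda>, \<Lambda>') \<in> (arcs_ends G)\<^sup>+" for \<Lambda> \<Lambda>'
    using that by (induction rule: trancl_induct) (use up in force)+
  then have acyc: "acyclic (arcs_ends G)" unfolding acyclic_def by force
  interpret G: wf_digraph G unfolding G_def by (rule wf_digraph_restricted)
  \<comment> \<open>Arrangements are sets of curves, so finiteness of the graph is taken from their
    contact sets, which are subsets of the finite vertex set.\<close>
  have "inj_on contact_points (verts G)"
    using arrangement_determined_by_contacts on_S verts_on by (intro inj_onI) metis
  moreover have "contact_points ` verts G \<subseteq> Pow (vertices S)" using con_vert verts_on by blast
  ultimately have "finite (verts G)" using fin_vert finite_imageD finite_subset finite_Pow_iff by metis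
  moreover have "arcs_ends G \<subseteq> verts G \<times> verts G" using G.adj_in_verts by auto
  ultimately have "finite (arcs_ends G)" using finite_subset by blast
  then have wf: "wf (arcs_ends G)" using acyc finite_acyclic_wf by blast
  obtain \<Lambda>\<^sub>1 where "\<Lambda>\<^sub>1 \<in> verts G" using False unfolding G_def by blast
  then obtain \<Gamma> where \<Gamma>: "\<Gamma> \<in> verts G" "\<And>\<Lambda>. (\<Lambda>, \<Gamma>) \<in> arcs_ends G \<Longrightarrow> \<Lambda> \<notin> verts G"
    using wfE_min[OF wf] by metis
  have src_verts: "source G \<Lambda> \<longleftrightarrow> \<Lambda> \<in> verts G \<and> (\<forall>\<Lambda>'. (\<Lambda>', \<Lambda>) \<notin> arcs_ends G)" for \<Lambda>
    unfolding G_def source_restricted arcs_ends_restricted ..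
  have \<Gamma>_src: "source G \<Gamma>" using \<Gamma> G.adj_in_verts src_verts by blast
  have uniq: "source G \<Lambda> \<longleftrightarrow> \<Lambda> = \<Gamma>" for \<Lambda>
  proof
    assume s: "source G \<Lambda>"
    then have on: "\<Lambda> \<in> arrangements_on S" "\<Gamma> \<in> arrangements_on S"
      using \<Gamma>(1) src_verts verts_on by blast+
    show "\<Lambda> = \<Gamma>"
      using greedy_unique[of \<Lambda> \<Gamma> F V] on_S[OF on(1)] on_S[OF on(2)] src[OF on(1)] src[OF on(2)]
        s \<Gamma>_src assms(4,5) by simp
  qed (use \<Gamma>_src in simp)
  have reach: "\<Gamma> \<rightarrow>\<^sup>*\<^bsub>G\<^esub> \<Lambda>" if "\<Lambda> \<in> verts G" for \<Lambda>
    using wf that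
  proof (induction \<Lambda> rule: wf_induct_rule)
    case (less \<Lambda>)
    show ?case
    proof (cases "source G \<Lambda>")
      case True
      then show ?thesis using uniq less.prems by auto
    next
      case False
      then obtain \<Lambda>' where "(\<Lambda>', \<Lambda>) \<in> arcs_ends G" using src_verts less.prems by blast
      then show ?thesis using less.IH G.adj_in_verts G.reachable_adj_trans by blast
    qed
  qed
  \<comment> \<open>Connectedness is strong connectedness of the symmetric closure, in which a path
    leads from \<open>u\<close> back to \<open>\<Gamma>\<close> and on to \<open>v\<close>.\<close>
  interpret sym: pair_wf_digraph "mk_symmetric G" by (rule G.wellformed_mk_symmetric)
  have "Digraph_Component.connected G"
    unfolding connected_def
  proof (rule strongly_connectedI)
    show "verts (with_proj (mk_symmetric G)) \<noteq> {}" using \<Gamma>(1) by auto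
    fix u v assume "u \<in> verts (with_proj (mk_symmetric G))" "v \<in> verts (with_proj (mk_symmetric G))"
    then have "u \<in> verts G" "v \<in> verts G" by simp_all
    then have *: "\<Gamma> \<rightarrow>\<^sup>*\<^bsub>with_proj (mk_symmetric G)\<^esub> u" "\<Gamma> \<rightarrow>\<^sup>*\<^bsub>with_proj (mk_symmetric G)\<^esub> v"
      by (simp_all add: reach G.reachable_mk_symmetricI)
    show "u \<rightarrow>\<^sup>*\<^bsub>with_proj (mk_symmetric G)\<^esub> v"
      by (rule sym.reachable_trans[OF symmetric_reachable[OF symmetric_mk_symmetric *(1)] *(2)])
  qed
  moreover have "\<Lambda> = \<Gamma> \<longleftrightarrow>
      (\<forall>i<m. (mproj (swept_vertex Fs i) \<in> V \<longrightarrow> sigma S Fs \<Lambda> (Suc i) = sigma S Fs \<Lambda> i) \<and>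
        (mproj (swept_vertex Fs i) \<notin> V \<longrightarrow>
           sigma S Fs \<Lambda> (Suc i) = sort_entries (sweep_position S Fs i) (sigma S Fs \<Lambda> i)))"
    if sw: "sweep S F m Fs" and on: "\<Lambda> \<in> arrangements_on S" for Fs \<Lambda>
  proof -
    \<comment> \<open>For each sweep the rule is equivalent to the same sweep-free condition, hence
      to being the source \<open>\<Gamma>\<close>.\<close>
    have "sweeping \<Lambda> F m Fs"
      using on_S[OF on] assms(4) sw by (auto simp: sweeping_def sweeping_axioms_def)
    from sweeping.greedy_iff[OF this, unfolded on_S(2)[OF on], OF assms(5)] show ?thesis
      using uniq src[OF on] by blast
  qed
  ultimately show ?thesis using acyc uniq unfolding G_def[symmetric] by blast
qed simp

end
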